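(* Consider the regression framework on $\mathcal{X}=[0,1)^d$, $d\ge1$, with $X$ uniform, where $s:\mathcal{X}\to\mathbb{R}$ is differentiable and $C_2>0$ satisfies $|s(t)-s(x)-\nabla s(x)\cdot(t-x)|\le C_2\|t-x\|_2^2$ for all $t,x\in\mathcal{X}$. Let $\alpha=-\log(1-\frac1{2d})/\log2$ and $P_n=\big(\sqrt{\frac54+\log n}-\frac{\sqrt5}2\big)^2$. Below, $L(\cdot)$ denotes a constant depending only on the quantities in parentheses, which may change from one occurrence to another. (1) (Infinite BPRF forest, with $p$ chosen optimally in the range $0\le p\le P_n$.) If $d\le3$, then for all $n\ge L(\sigma^2)$, $$\inf_{p\in\mathbb{N},\,0\le p\le P_n}\mathbb{E}\big[(\hat s_{\infty,p}(X;D_n)-s(X))^2\big]\le L(s,d)\Big(\frac{\sigma^2}n\Big)^{\frac{2\alpha}{2\alpha+1}} .$$ If $d\ge4$, then $$\inf_{p\in\mathbb{N},\,0\le p\le P_n}\mathbb{E}\big[(\hat s_{\infty,p}(X;D_n)-s(X))^2\big]\le L(s,d,\sigma^2)\,n^{-2\alpha\log2}\,2^{2\alpha\sqrt5\sqrt{\log n+5/4}} ;$$ in particular, this gives a rate of order $n^{-(2\alpha\log2-\delta)}$ for every $\delta>0$. (2) (Single BPRF tree.) There exists $p_0=L(s,d)$ such that for all $n\ge L(d,\sigma^2)$ and every integer $p$ with $p_0\le p\le P_n$, if $\mathbb{U}\sim\mathcal{U}_p^{\mathtt{bprf}}$ is independent of $(D_n,X)$, $$\mathbb{E}\big[(\hat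 s(X;\mathbb{U};D_n)-s(X))^2\big]\ge\begin{cases}L(s,d)\,\big(\frac{\sigma^2}n\big)^{\alpha/(\alpha+1)}&\text{if }d\le3,\\ L(s,d)\,n^{-\alpha\log2}&\text{if }d\ge4.\end{cases}$$
   Context: $D_n=(X_i,Y_i)_{1\le i\le n}$ are independent with common law such that $X_i$ is uniform on $[0,1)^d$, $\mathbb{E}[Y_i\mid X_i]=s(X_i)$ and $\mathbb{E}[(Y_i-s(X_i))^2\mid X_i]=\sigma^2>0$; $X$ is uniform on $[0,1)^d$ and independent of $D_n$. For a finite partition $\mathbb{U}$ of $\mathcal{X}$ the tree (regressogram) estimator is $$\hat s(x;\mathbb{U};D_n)=\sum_{\lambda\in\mathbb{U}}\frac{\sum_{i=1}^nY_i\mathbf{1}_{X_i\in\lambda}}{\operatorname{Card}\{i: X_i\in\lambda\}}\mathbf{1}_{x\in\lambda}\qquad(0/0=0),$$ and the infinite forest estimator is $\hat s_{\infty,p}(x;D_n)=\mathbb{E}_{\mathbb{U}\sim\mathcal{U}_p^{\mathtt{bprf}}}[\hat s(x;\mathbb{U};D_n)\mid D_n]$ with $\mathbb{U}$ independent of $D_n$. BPRF model $\mathcal{U}_p^{\mathtt{bprf}}$: define random partitions $(\mathbb{U}_m)_{m\in\mathbb{N}}$ of $[0,1)^d$ recursively by $\mathbb{U}_0=\{[0,1)^d\}$ and, given $\mathbb{U}_m=\{\lambda_{1,m},\dots,\lambda_{2^m,m}\}$, draw random variables $L_{1,m},\dots,L_{2^m,m}$ uniform on $\{1,\dots,d\}$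 and $Z_{1,m},\dots,Z_{2^m,m}$ uniform on $[0,1]$, all independent and independent of $\mathbb{U}_m$; each $\lambda_{j,m}=\prod_{i=1}^d[A_i,B_i)$ is split along coordinate $\ell=L_{j,m}$ into two cells of $\mathbb{U}_{m+1}$, by replacing $[A_\ell,B_\ell)$ with $[A_\ell,(1-Z_{j,m})A_\ell+Z_{j,m}B_\ell)$ and $[(1-Z_{j,m})A_\ell+Z_{j,m}B_\ell,B_\ell)$ respectively, the other coordinates being unchanged. $\mathcal{U}_p^{\mathtt{bprf}}$ is the law of $\mathbb{U}_p$ ($2^p$ cells).
   Formalization: In part (2) the constant L(s,d) in the lower bound is positive only when s is not constant on the cube (nonnegative otherwise): for constant s and fixed p the tree's risk is of order 1/n, so the lower bound with a positive constant fails. *)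

theory Defs
  imports "HOL-Probability.Probability"
begin

text \<open>
  A point of \<open>\<real>^d\<close> is a function \<open>nat \<Rightarrow> real\<close> supported on the index set \<open>{..<d}\<close>. The dimension is
  thus an ordinary natural number, so that constants can be quantified before or after it.
\<close>

definition box_set :: "nat \<Rightarrow> (nat \<Rightarrow> real) \<Rightarrow> (nat \<Rightarrow> real) \<Rightarrow> (nat \<Rightarrow> real) set" where
  "box_set d A B = (\<Pi>\<^sub>E i\<in>{..<d}. {A i..<B i})"

abbreviation cube :: "nat \<Rightarrow> (nat \<Rightarrow> real) set" where
  "cube d \<equiv> box_set d (\<lambda>_. 0) (\<lambda>_. 1)"

definition edist :: "nat \<Rightarrow> (nat \<Rightarrow> real) \<Rightarrow> (nat \<Rightarrow> real) \<Rightarrow> real" where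
  "edist d x t = L2_set (\<lambda>i. t i - x i) {..<d}"

text \<open>
  Frechet differentiability relative to the cube; on its faces \<open>x i = 0\<close> it is one-sided in direction \<open>i\<close>.
\<close>

definition has_gradient_at ::
    "nat \<Rightarrow> ((nat \<Rightarrow> real) \<Rightarrow> real) \<Rightarrow> (nat \<Rightarrow> real) \<Rightarrow> (nat \<Rightarrow> real) \<Rightarrow> bool" where
  "has_gradient_at d s g x \<longleftrightarrow>
     (\<forall>e>0. \<exists>r>0. \<forall>t\<in>cube d. edist d x t < r \<longrightarrow>
        \<bar>s t - s x - (\<Sum>i<d. g i * (t i - x i))\<bar> \<le> e * edist d x t)"

definition smooth_regression_function :: "nat \<Rightarrow> ((nat \<Rightarrow> real) \<Rightarrow> real) \<Rightarrow> real \<Rightarrow> bool" where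
  "smooth_regression_function d s C2 \<longleftrightarrow>
     (\<exists>grad. (\<forall>x\<in>cube d. has_gradient_at d s (grad x) x) \<and>
       (\<forall>t\<in>cube d. \<forall>x\<in>cube d.
          \<bar>s t - s x - (\<Sum>i<d. grad x i * (t i - x i))\<bar> \<le> C2 * (edist d x t)\<^sup>2))"

text \<open>
  The underlying space is exactly the cube (and not \<open>\<real>^d\<close>), so the values of \<open>s\<close> outside the cube,
  about which nothing is assumed, play no role, not even for measurability.
\<close>

definition unif_cube :: "nat \<Rightarrow> (nat \<Rightarrow> real) measure" where
  "unif_cube d = PiM {..<d} (\<lambda>_. restrict_space lborel {0..<1})"

text \<open>\<open>P\<close> is the common law of the pairs \<open>(X_i, Y_i)\<close>.\<close>

definition regression_law ::
    "nat \<Rightarrow> ((nat \<Rightarrow> real) \<Rightarrow> real) \<Rightarrow> real \<Rightarrow> ((nat \<Rightarrow> real) \<times> real) measure \<Rightarrow> bool" where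
  "regression_law d s \<sigma> P \<longleftrightarrow>
     prob_space P \<and> sets P = sets (unif_cube d \<Otimes>\<^sub>M borel) \<and>
     distr P (unif_cube d) fst = unif_cube d \<and>
     integrable P snd \<and> integrable P (\<lambda>z. (snd z - s (fst z))\<^sup>2) \<and>
     (let \<F> = vimage_algebra (space P) fst (unif_cube d) in
       (AE z in P. real_cond_exp P \<F> snd z = s (fst z)) \<and>
       (AE z in P. real_cond_exp P \<F> (\<lambda>z. (snd z - s (fst z))\<^sup>2) z = \<sigma>\<^sup>2))"

definition regression_framework ::
    "nat \<Rightarrow> ((nat \<Rightarrow> real) \<Rightarrow> real) \<Rightarrow> real \<Rightarrow> ((nat \<Rightarrow> real) \<times> real) measure \<Rightarrow> bool" where
  "regression_framework d s \<sigma> P \<longleftrightarrow>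
     1 \<le> d \<and> (\<exists>C2>0. smooth_regression_function d s C2) \<and> 0 < \<sigma> \<and> regression_law d s \<sigma> P"

text \<open>An i.i.d. sample is drawn from a product measure; its \<open>i\<close>-th element is \<open>D i = (X_i, Y_i)\<close>, \<open>i < n\<close>.\<close>

definition sample_law ::
    "nat \<Rightarrow> ((nat \<Rightarrow> real) \<times> real) measure \<Rightarrow> (nat \<Rightarrow> (nat \<Rightarrow> real) \<times> real) measure" where
  "sample_law n P = PiM {..<n} (\<lambda>_. P)"

text \<open>Division by zero being zero matches the convention \<open>0/0 = 0\<close> for empty cells.\<close>

definition tree_estimator ::
    "(nat \<Rightarrow> real) set set \<Rightarrow> nat \<Rightarrow> (nat \<Rightarrow> (nat \<Rightarrow> real) \<times> real) \<Rightarrow> (nat \<Rightarrow> real) \<Rightarrow> real" where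
  "tree_estimator U n D x =
     (\<Sum>c\<in>U. (\<Sum>i<n. snd (D i) * indicator c (fst (D i))) / real (card {i. i < n \<and> fst (D i) \<in> c})
        * indicator c x)"

text \<open>
  The partition of depth \<open>p\<close> is a deterministic function of independent draws \<open>\<omega> (m, j) = (L, Z)\<close>,
  one for each cell \<open>j < 2 ^ m\<close> of each level \<open>m < p\<close>. Coordinates are numbered from 0. Cell \<open>j\<close> of
  level \<open>m\<close> is split into the cells \<open>2 * j\<close> and \<open>2 * j + 1\<close> of level \<open>m + 1\<close>; a cell is represented by
  its corners \<open>(A, B)\<close>.
\<close>

definition bprf_draws :: "nat \<Rightarrow> nat \<Rightarrow> (nat \<times> nat \<Rightarrow> nat \<times> real) measure" where
  "bprf_draws d p = PiM {(m, j). m < p \<and> j < 2 ^ m}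
     (\<lambda>_. uniform_count_measure {..<d} \<Otimes>\<^sub>M restrict_space lborel {0..1})"

fun bprf_cell :: "(nat \<times> nat \<Rightarrow> nat \<times> real) \<Rightarrow> nat \<Rightarrow> nat \<Rightarrow> (nat \<Rightarrow> real) \<times> (nat \<Rightarrow> real)" where
  "bprf_cell \<omega> 0 j = ((\<lambda>_. 0), (\<lambda>_. 1))"
| "bprf_cell \<omega> (Suc m) j =
     (let (A, B) = bprf_cell \<omega> m (j div 2);
          (l, z) = \<omega> (m, j div 2);
          c = (1 - z) * A l + z * B l
      in if even j then (A, B(l := c)) else (A(l := c), B))"

definition bprf_partition :: "nat \<Rightarrow> nat \<Rightarrow> (nat \<times> nat \<Rightarrow> nat \<times> real) \<Rightarrow> (nat \<Rightarrow> real) set set" where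
  "bprf_partition d p \<omega> = (\<lambda>j. case bprf_cell \<omega> p j of (A, B) \<Rightarrow> box_set d A B) ` {..<2 ^ p}"

text \<open>As the partition is independent of the sample, conditioning on \<open>D\<close> amounts to fixing \<open>D\<close>.\<close>

definition forest_estimator ::
    "nat \<Rightarrow> nat \<Rightarrow> nat \<Rightarrow> (nat \<Rightarrow> (nat \<Rightarrow> real) \<times> real) \<Rightarrow> (nat \<Rightarrow> real) \<Rightarrow> real" where
  "forest_estimator d p n D x = (\<integral>\<omega>. tree_estimator (bprf_partition d p \<omega>) n D x \<partial>bprf_draws d p)"

text \<open>
  Quadratic risks, as \<open>[0, \<infinity>]\<close>-valued expectations of nonnegative variables; the sample, the new
  point \<open>X\<close> and the partition are independent.
\<close>

definition forest_risk ::
    "nat \<Rightarrow> nat \<Rightarrow> nat \<Rightarrow> ((nat \<Rightarrow> real) \<Rightarrow> real) \<Rightarrow> ((nat \<Rightarrow> real) \<times> real) measure \<Rightarrow> ennreal" where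
  "forest_risk d p n s P =
     (\<integral>\<^sup>+ (D, x). ennreal ((forest_estimator d p n D x - s x)\<^sup>2) \<partial>(sample_law n P \<Otimes>\<^sub>M unif_cube d))"

definition tree_risk ::
    "nat \<Rightarrow> nat \<Rightarrow> nat \<Rightarrow> ((nat \<Rightarrow> real) \<Rightarrow> real) \<Rightarrow> ((nat \<Rightarrow> real) \<times> real) measure \<Rightarrow> ennreal" where
  "tree_risk d p n s P =
     (\<integral>\<^sup>+ (D, x, \<omega>). ennreal ((tree_estimator (bprf_partition d p \<omega>) n D x - s x)\<^sup>2)
        \<partial>(sample_law n P \<Otimes>\<^sub>M (unif_cube d \<Otimes>\<^sub>M bprf_draws d p)))"

definition bprf_alpha :: "nat \<Rightarrow> real" where
  "bprf_alpha d = - ln (1 - 1 / (2 * real d)) / ln 2"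

definition depth_bound :: "nat \<Rightarrow> real" where
  "depth_bound n = (sqrt (5 / 4 + ln (real n)) - sqrt 5 / 2)\<^sup>2"

end

theory Submission
  imports Defs
begin

text \<open>
  Write \<open>\<kappa> = 1 - 1 / (2 d)\<close>, so that \<open>\<kappa> = 2 powr (- \<alpha>)\<close>, and \<open>\<rho> = 1 - 2 / (3 d)\<close>, so that \<open>\<rho> < \<kappa>\<close>.
  Everything about the random partition is reduced to the functional \<open>cell_mean d p f\<close>, the expectation
  of the sum of \<open>f c\<close> over the \<open>2 ^ p\<close> cells \<open>c\<close> of depth \<open>p\<close>. Since every cell is split by a fresh draw,
  \<open>cell_mean d (p + 1) f = cell_mean d p (R f)\<close>, where \<open>R f c\<close> is the expected sum of \<open>f\<close> over the two
  children of \<open>c\<close> (\<open>cell_mean_Suc\<close>). Hence an eigenfunction of \<open>R\<close> has an explicit expectation at every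
  depth (\<open>cell_mean_eigen\<close>), and an inequality \<open>R f \<le> r f\<close> gives an upper bound (\<open>cell_mean_le\<close>). With
  \<open>c = [A, B)\<close>, side lengths \<open>w\<close> and volume \<open>v\<close>, the eigenfunctions that matter are, for a fixed point
  \<open>x\<close> and with the factor \<open>1[x \<in> c]\<close>, \<open>A_i + B_i - 2 x_i\<close> and \<open>(x_i - A_i) (B_i - x_i)\<close> with eigenvalue
  \<open>\<kappa>\<close> and \<open>w_i^2 - 6 (x_i - A_i) (B_i - x_i)\<close> with eigenvalue \<open>\<rho>\<close>; without a point, \<open>w_i^2\<close> with \<open>2 \<rho>\<close>
  and \<open>v w_i^4\<close> with \<open>\<rho>\<close>; and \<open>(v + e) powr (- k)\<close>, for which \<open>R f \<le> 2 / (1 - k) f\<close>.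

  The average of the \<open>Y_i\<close> over a cell of volume \<open>q\<close> has, around the mean \<open>m\<close> of \<open>s\<close> over that cell, the
  quadratic risk \<open>(\<sigma>^2 + V) E[1 / N] + m^2 (1 - q)^n\<close>, where \<open>N\<close> is binomial, \<open>1 / 0 = 0\<close> and \<open>V\<close> is the
  variance of \<open>s\<close> over the cell (\<open>cell_average_risk\<close>). Moreover \<open>q E[1 / N]\<close> is at most \<open>2 / (n + 1)\<close>, and it
  is at least \<open>1 / (4 n)\<close> when \<open>q \<ge> 1 / n\<close>.

  Forest. Averaging over the partition before squaring makes the first order Taylor term of the bias
  an exact multiple of \<open>\<kappa>^p\<close>, and the second order term is of order \<open>E[w_i^2 | x]\<close>, again \<open>\<kappa>^p\<close>
  (\<open>forest_bias\<close>). So the squared bias is of order \<open>\<kappa>^(2 p)\<close>. By Jensen's inequality the rest is at most the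
  estimation error of a tree, of order \<open>2^p / n (\<sigma>^2 + \<rho>^p + n powr (- k) (1 - k)^(- p))\<close>, where the last
  term, for any \<open>k\<close> in \<open>[0, 1)\<close>, accounts for the empty cells (\<open>forest_risk_le\<close>). For \<open>d \<le> 3\<close> the depth
  that balances the two errors is \<open>b ln (n / \<sigma>^2)\<close> with \<open>b = 1 / ((1 + 2 \<alpha>) ln 2) < 1\<close>. Because \<open>b < 1\<close>,
  this depth is admissible and some \<open>k > 0\<close> makes the extra terms smaller than \<open>\<sigma>^2\<close>. For \<open>d \<ge> 4\<close> one has
  \<open>(1 + 2 \<alpha>) ln 2 \<le> 1\<close>; the largest admissible depth is used, with \<open>k = 0\<close>, and the bound for the bias dominates.

  Tree. The risk of a single tree contains the full variation of \<open>s\<close> inside the cells. Where a partial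
  derivative of \<open>s\<close> does not vanish, comparing the two halves of a cell bounds this variation below
  by a multiple of \<open>w_i^2\<close>, up to a remainder of order \<open>w^4\<close>; the expectations are of order \<open>\<kappa>^p\<close> and
  \<open>\<rho>^p\<close> (\<open>tree_risk_ge_bias\<close>). The risk is also at least a multiple of \<open>\<sigma>^2 2^p / n\<close>, because for an admissible depth
  a fixed proportion of the cells has a volume of at least \<open>1 / n\<close>: this is Markov's inequality for
  \<open>(v + 1 / n) powr (- k)\<close> with \<open>k = 1 / (2 sqrt p)\<close> (\<open>small_cell_proportion\<close>, \<open>tree_risk_ge_noise\<close>). The
  maximum of the two bounds gives the rate.
\<close>

text \<open>
  The factors by which, in expectation, the offset and the fourth powers of the widths shrink from one
  level to the next.
\<close>

abbreviation kappa :: "nat \<Rightarrow> real" where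
  "kappa d \<equiv> 1 - 1 / (2 * real d)"

abbreviation rho :: "nat \<Rightarrow> real" where
  "rho d \<equiv> 1 - 2 / (3 * real d)"


section \<open>Cells of the random partition\<close>


text \<open>
  A cell is given by its lower and upper corner. Both are total functions; only their values at indices
  below the dimension matter.
\<close>

type_synonym cell = "(nat \<Rightarrow> real) \<times> (nat \<Rightarrow> real)"

text \<open>
  The left (first argument true) or right child of a cell for the draw \<open>(l, z)\<close>: the side \<open>l\<close> is cut at the
  proportion \<open>z\<close>.
\<close>

definition split_cell :: "bool \<Rightarrow> cell \<Rightarrow> nat \<times> real \<Rightarrow> cell" where
  "split_cell left c y =
     (let cut = (1 - snd y) * fst c (fst y) + snd y * snd c (fst y)
      in if left then (fst c, (snd c)(fst y := cut)) else ((fst c)(fst y := cut), snd c))"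

text \<open>
  The set of points of a cell.
\<close>

definition cell_box :: "nat \<Rightarrow> cell \<Rightarrow> (nat \<Rightarrow> real) set" where
  "cell_box d c = box_set d (fst c) (snd c)"

text \<open>
  Cells contained in the closed unit cube, with ordered corners. Empty and flat cells are allowed, as a
  draw may be 0 or 1.
\<close>

definition valid_cell :: "nat \<Rightarrow> cell \<Rightarrow> bool" where
  "valid_cell d c \<longleftrightarrow> (\<forall>i<d. 0 \<le> fst c i \<and> fst c i \<le> snd c i \<and> snd c i \<le> 1)"

abbreviation root_cell :: cell where
  "root_cell \<equiv> ((\<lambda>_. 0), (\<lambda>_. 1))"

lemma valid_root: "valid_cell d root_cell"
  by (simp add: valid_cell_def)

lemma bprf_cell_Suc:
  "bprf_cell \<omega> (Suc m) j = split_cell (even j) (bprf_cell \<omega> m (j div 2)) (\<omega> (m, j div 2))"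
  by (simp add: split_cell_def Let_def split: prod.splits)

lemma mem_cell_box:
  "x \<in> cell_box d c \<longleftrightarrow> x \<in> extensional {..<d} \<and> (\<forall>i<d. fst c i \<le> x i \<and> x i < snd c i)"
  by (auto simp: cell_box_def box_set_def PiE_def Pi_def)

lemma cut_bounds:
  fixes a b z :: real
  assumes "a \<le> b" "0 \<le> z" "z \<le> 1"
  shows "a \<le> (1 - z) * a + z * b" "(1 - z) * a + z * b \<le> b"
proof -
  have "0 \<le> z * (b - a)" "0 \<le> (1 - z) * (b - a)" using assms by auto
  then show "a \<le> (1 - z) * a + z * b" "(1 - z) * a + z * b \<le> b" by (auto simp: algebra_simps)
qed

lemma valid_split_cell:
  assumes "valid_cell d c" "fst y < d" "0 \<le> snd y" "snd y \<le> 1"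
  shows "valid_cell d (split_cell b c y)"
proof -
  let ?l = "fst y"
  have l: "0 \<le> fst c ?l" "fst c ?l \<le> snd c ?l" "snd c ?l \<le> 1"
    using assms by (auto simp: valid_cell_def)
  note cb = cut_bounds[OF l(2) assms(3,4)]
  show ?thesis
    using assms(1) cb l unfolding valid_cell_def split_cell_def Let_def by auto
qed

text \<open>
  The children partition the parent. Stated with indicators, this carries over to the whole partition by
  summation.
\<close>

lemma indicator_split_cell:
  assumes "valid_cell d c" "fst y < d" "0 \<le> snd y" "snd y \<le> 1"
  shows "indicator (cell_box d (split_cell True c y)) x + indicator (cell_box d (split_cell False c y)) x
           = (indicator (cell_box d c) x :: real)"
proof -
  let ?l = "fst y" let ?cut = "(1 - snd y) * fst c ?l + snd y * snd c ?l"
  have l: "fst c ?l \<le> snd c ?l" using assms by (auto simp: valid_cell_def)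
  note cb = cut_bounds[OF l assms(3,4)]
  have T: "x \<in> cell_box d (split_cell True c y) \<longleftrightarrow> x \<in> cell_box d c \<and> x ?l < ?cut"
    using cb(2) assms(2) unfolding mem_cell_box split_cell_def Let_def
    by (simp add: fun_upd_apply) (metis less_le_trans)
  have F: "x \<in> cell_box d (split_cell False c y) \<longleftrightarrow> x \<in> cell_box d c \<and> ?cut \<le> x ?l"
    using cb(1) assms(2) unfolding mem_cell_box split_cell_def Let_def
    by (simp add: fun_upd_apply) (metis order_trans)
  show ?thesis using T F by (auto simp: indicator_def)
qed

text \<open>
  The law of one draw \<open>(L, Z)\<close>.
\<close>

definition draw_law :: "nat \<Rightarrow> (nat \<times> real) measure" where
  "draw_law d = uniform_count_measure {..<d} \<Otimes>\<^sub>M restrict_space lborel {0..1}"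

text \<open>
  The indices of the draws of the levels before \<open>p\<close>.
\<close>

definition draw_index :: "nat \<Rightarrow> (nat \<times> nat) set" where
  "draw_index p = {(m, j). m < p \<and> j < 2 ^ m}"

lemma bprf_draws_eq: "bprf_draws d p = PiM (draw_index p) (\<lambda>_. draw_law d)"
  by (simp add: bprf_draws_def draw_law_def draw_index_def)

lemma finite_draw_index: "finite (draw_index p)"
proof (rule finite_subset)
  show "draw_index p \<subseteq> {..<p} \<times> {..<2^p}"
    by (auto simp: draw_index_def intro: less_le_trans)
qed auto

lemma space_draw_law: "space (draw_law d) = {..<d} \<times> {0..1}"
  by (simp add: draw_law_def space_pair_measure space_uniform_count_measure space_restrict_space)

lemma prob_space_restrict_unit: "prob_space (restrict_space lborel {0..1::real})"
  by (rule prob_spaceI) (simp add: emeasure_restrict_space space_restrict_space)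

lemma prob_space_draw_law:
  assumes "1 \<le> d" shows "prob_space (draw_law d)"
proof -
  interpret A: prob_space "uniform_count_measure {..<d}"
    using assms by (intro prob_space_uniform_count_measure) (auto simp: lessThan_empty_iff)
  interpret B: prob_space "restrict_space lborel {0..1::real}" by (rule prob_space_restrict_unit)
  interpret pair_prob_space "uniform_count_measure {..<d}" "restrict_space lborel {0..1::real}" ..
  show ?thesis unfolding draw_law_def by (rule prob_space_axioms)
qed

lemma prob_space_bprf_draws:
  assumes "1 \<le> d" shows "prob_space (bprf_draws d p)"
  unfolding bprf_draws_eq by (rule prob_space_PiM) (rule prob_space_draw_law[OF assms])

lemma draw_in_space:
  assumes "\<omega> \<in> space (bprf_draws d p)" "m < p" "j < 2 ^ m"
  shows "fst (\<omega> (m, j)) < d" "0 \<le> snd (\<omega> (m, j))" "snd (\<omega> (m, j)) \<le> 1"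
proof -
  have "\<omega> (m, j) \<in> space (draw_law d)"
    using assms by (auto simp: bprf_draws_eq space_PiM draw_index_def PiE_def Pi_def)
  then show "fst (\<omega> (m, j)) < d" "0 \<le> snd (\<omega> (m, j))" "snd (\<omega> (m, j)) \<le> 1"
    by (auto simp: space_draw_law mem_Times_iff)
qed

lemma valid_bprf_cell:
  assumes "\<omega> \<in> space (bprf_draws d p)" "m \<le> p" "j < 2 ^ m"
  shows "valid_cell d (bprf_cell \<omega> m j)"
  using assms(2,3)
proof (induction m arbitrary: j)
  case 0 then show ?case by (simp add: valid_root)
next
  case (Suc m)
  have j: "j div 2 < 2 ^ m" using Suc.prems by auto
  show ?case unfolding bprf_cell_Suc
    using Suc j by (intro valid_split_cell draw_in_space[OF assms(1)]) auto
qed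

lemma sum_pairs: "(\<Sum>j<2 ^ Suc p. g j) = (\<Sum>j<2 ^ p. g (2 * j) + g (2 * j + 1))"
  for g :: "nat \<Rightarrow> 'a::comm_monoid_add"
proof -
  have "(\<Sum>j<2 * n. g j) = (\<Sum>j<n. g (2 * j) + g (2 * j + 1))" for n
    by (induction n) (auto simp: algebra_simps)
  then show ?thesis by simp
qed

lemma sum_indicator_cells:
  assumes "\<omega> \<in> space (bprf_draws d p)" "m \<le> p"
  shows "(\<Sum>j<2 ^ m. indicator (cell_box d (bprf_cell \<omega> m j)) x) = (indicator (cube d) x :: real)"
  using assms(2)
proof (induction m)
  case 0 then show ?case by (simp add: cell_box_def)
next
  case (Suc m)
  have "(\<Sum>j<2 ^ Suc m. indicator (cell_box d (bprf_cell \<omega> (Suc m) j)) x)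
      = (\<Sum>j<2 ^ m. indicator (cell_box d (bprf_cell \<omega> m j)) x :: real)"
    unfolding sum_pairs
  proof (rule sum.cong[OF refl])
    fix j assume "j \<in> {..<2 ^ m::nat}"
    then have j: "j < 2 ^ m" by simp
    show "indicator (cell_box d (bprf_cell \<omega> (Suc m) (2 * j))) x +
          indicator (cell_box d (bprf_cell \<omega> (Suc m) (2 * j + 1))) x
        = (indicator (cell_box d (bprf_cell \<omega> m j)) x :: real)"
      unfolding bprf_cell_Suc
      using indicator_split_cell[OF valid_bprf_cell[OF assms(1) _ j]
        draw_in_space[OF assms(1) _ j]] Suc.prems by simp
  qed
  then show ?case using Suc by simp
qed

lemma bprf_cells_disjoint:
  assumes "\<omega> \<in> space (bprf_draws d p)" "i < 2 ^ p" "j < 2 ^ p"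
    "x \<in> cell_box d (bprf_cell \<omega> p i)" "x \<in> cell_box d (bprf_cell \<omega> p j)"
  shows "i = j"
proof (rule ccontr)
  assume "i \<noteq> j"
  let ?I = "\<lambda>k. indicator (cell_box d (bprf_cell \<omega> p k)) x :: real"
  have "(\<Sum>k\<in>{i, j}. ?I k) \<le> (\<Sum>k<2 ^ p. ?I k)"
    using assms by (intro sum_mono2) auto
  also have "\<dots> = indicator (cube d) x" by (rule sum_indicator_cells[OF assms(1)]) simp
  also have "\<dots> \<le> (1::real)" by (simp add: indicator_def)
  finally show False using \<open>i \<noteq> j\<close> assms(4,5) by simp
qed

text \<open>
  Exactly one index belongs to the cell that contains a given point, so that a sum over the cells weighted
  by their indicators picks one term.
\<close>

lemma bprf_cell_containing:
  assumes "\<omega> \<in> space (bprf_draws d p)" "x \<in> cube d"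
  obtains i where "i < 2 ^ p" "x \<in> cell_box d (bprf_cell \<omega> p i)"
    "\<And>F. (\<Sum>j<2 ^ p. indicator (cell_box d (bprf_cell \<omega> p j)) x * F j) = (F i :: real)"
proof -
  let ?I = "\<lambda>k. indicator (cell_box d (bprf_cell \<omega> p k)) x :: real"
  have "(\<Sum>k<2 ^ p. ?I k) = 1" using assms(2) by (simp add: sum_indicator_cells[OF assms(1)])
  then obtain i where i: "i < 2 ^ p" "?I i \<noteq> 0"
    by (metis (no_types, lifting) lessThan_iff sum.neutral zero_neq_one)
  then have x: "x \<in> cell_box d (bprf_cell \<omega> p i)" by (auto simp: indicator_def split: if_splits)
  have "(\<Sum>j<2 ^ p. ?I j * F j) = (F i :: real)" for F
  proof -
    have "(\<Sum>j<2 ^ p. ?I j * F j) = (\<Sum>j\<in>{i}. ?I j * F j)"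
      using bprf_cells_disjoint[OF assms(1) i(1)] i x
      by (intro sum.mono_neutral_right) (auto simp: indicator_def)
    then show ?thesis using x by simp
  qed
  with i(1) x show ?thesis by (rule that)
qed

text \<open>
  The value of the regressogram on the set \<open>S\<close>; it is 0 if \<open>S\<close> contains no sample point.
\<close>

definition cell_average :: "nat \<Rightarrow> (nat \<Rightarrow> (nat \<Rightarrow> real) \<times> real) \<Rightarrow> (nat \<Rightarrow> real) set \<Rightarrow> real" where
  "cell_average n D S = (\<Sum>i<n. snd (D i) * indicator S (fst (D i))) / (\<Sum>i<n. indicator S (fst (D i)))"

text \<open>
  The partition is a set of sets, the sum here runs over indices. Two equal cells with different indices
  are disjoint, hence empty, and contribute nothing.
\<close>

lemma tree_estimator_eq:
  assumes "\<omega> \<in> space (bprf_draws d p)"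
  shows "tree_estimator (bprf_partition d p \<omega>) n D x =
    (\<Sum>j<2 ^ p. indicator (cell_box d (bprf_cell \<omega> p j)) x * cell_average n D (cell_box d (bprf_cell \<omega> p j)))"
proof -
  let ?h = "\<lambda>j. cell_box d (bprf_cell \<omega> p j)"
  have card: "real (card {i. i < n \<and> fst (D i) \<in> c}) = (\<Sum>i<n. indicator c (fst (D i)))" for c
  proof -
    have "{i. i < n \<and> fst (D i) \<in> c} = {..<n} \<inter> {i. fst (D i) \<in> c}" by auto
    then show ?thesis by (simp add: indicator_def sum.If_cases flip: sum.inter_filter)
  qed
  have "bprf_partition d p \<omega> = ?h ` {..<2 ^ p}"
    by (simp add: bprf_partition_def cell_box_def case_prod_beta)
  then have "tree_estimator (bprf_partition d p \<omega>) n D x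
      = (\<Sum>c\<in>?h ` {..<2 ^ p}. indicator c x * cell_average n D c)"
    unfolding tree_estimator_def cell_average_def card by (simp add: mult.commute)
  also have "\<dots> = (\<Sum>j<2 ^ p. indicator (?h j) x * cell_average n D (?h j))"
  proof (subst sum.reindex_nontrivial)
    fix i j assume "i \<in> {..<2 ^ p}" "j \<in> {..<2 ^ p}" "i \<noteq> j" "?h i = ?h j"
    then have "?h i = {}" using bprf_cells_disjoint[OF assms, of i j] by auto
    then show "indicator (?h i) x * cell_average n D (?h i) = 0" by simp
  qed auto
  finally show ?thesis .
qed

text \<open>
  The measurable space of cells. All coordinates are kept, so that it does not depend on the dimension.
\<close>

abbreviation cell_space :: "cell measure" where
  "cell_space \<equiv> PiM UNIV (\<lambda>_. borel) \<Otimes>\<^sub>M PiM UNIV (\<lambda>_. borel)"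

lemma space_cell_space: "space cell_space = UNIV"
  by (simp add: space_pair_measure space_PiM)

lemma measurable_draw_fst [measurable]: "fst \<in> measurable (draw_law d) (count_space UNIV)"
proof -
  have "fst \<in> measurable (draw_law d) (uniform_count_measure {..<d})"
    unfolding draw_law_def by simp
  moreover have "(\<lambda>x. x) \<in> measurable (uniform_count_measure {..<d}) (count_space UNIV)"
    by (rule measurableI) (auto simp: sets_uniform_count_measure space_uniform_count_measure)
  ultimately show ?thesis by (rule measurable_compose)
qed

lemma measurable_draw_snd [measurable]: "snd \<in> borel_measurable (draw_law d)"
proof -
  have "snd \<in> measurable (draw_law d) (restrict_space lborel {0..1})"
    unfolding draw_law_def by simp
  moreover have "(\<lambda>x. x) \<in> measurable (restrict_space lborel {0..1::real}) borel"
    by (rule measurable_restrict_space1) simp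
  ultimately show ?thesis by (rule measurable_compose)
qed

lemma measurable_fst_comp [measurable]: "(\<lambda>c. fst c i) \<in> borel_measurable cell_space"
  by (rule measurable_compose[OF measurable_fst]) simp

lemma measurable_snd_comp [measurable]: "(\<lambda>c. snd c i) \<in> borel_measurable cell_space"
  by (rule measurable_compose[OF measurable_snd]) simp

lemma measurable_split_cell [measurable]:
  "(\<lambda>(c, y). split_cell b c y) \<in> measurable (cell_space \<Otimes>\<^sub>M draw_law d) cell_space"
proof -
  let ?M = "cell_space \<Otimes>\<^sub>M draw_law d"
  have l: "(\<lambda>u. fst (snd u)) \<in> measurable ?M (count_space UNIV)"
    by (rule measurable_compose[OF measurable_snd]) simp
  have z: "(\<lambda>u. snd (snd u)) \<in> borel_measurable ?M"
    by (rule measurable_compose[OF measurable_snd]) simp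
  have A: "(\<lambda>u. fst (fst u) i) \<in> borel_measurable ?M" for i
    by (rule measurable_compose[OF measurable_fst]) simp
  have B: "(\<lambda>u. snd (fst u) i) \<in> borel_measurable ?M" for i
    by (rule measurable_compose[OF measurable_fst]) simp
  have Al: "(\<lambda>u. fst (fst u) (fst (snd u))) \<in> borel_measurable ?M"
    by (rule measurable_compose_countable[OF A l])
  have Bl: "(\<lambda>u. snd (fst u) (fst (snd u))) \<in> borel_measurable ?M"
    by (rule measurable_compose_countable[OF B l])
  have cut: "(\<lambda>u. (1 - snd (snd u)) * fst (fst u) (fst (snd u)) + snd (snd u) * snd (fst u) (fst (snd u)))
      \<in> borel_measurable ?M" (is "?cut \<in> _")
    using z Al Bl by simp
  have p: "Measurable.pred ?M (\<lambda>u. i = fst (snd u))" for i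
    using measurable_compose[OF l, of "\<lambda>l. i = l" "count_space UNIV"] by simp
  have 1: "(\<lambda>u. (fst (fst u), (snd (fst u))(fst (snd u) := ?cut u))) \<in> measurable ?M cell_space"
    unfolding fun_upd_def
    by (intro measurable_Pair measurable_abs_UNIV measurable_If cut B)
       (auto intro: p measurable_compose[OF measurable_fst measurable_fst_comp])
  have 2: "(\<lambda>u. ((fst (fst u))(fst (snd u) := ?cut u), snd (fst u))) \<in> measurable ?M cell_space"
    unfolding fun_upd_def
    by (intro measurable_Pair measurable_abs_UNIV measurable_If cut A)
       (auto intro: p measurable_compose[OF measurable_fst measurable_snd_comp])
  have "(\<lambda>(c, y). split_cell b c y) =
     (if b then (\<lambda>u. (fst (fst u), (snd (fst u))(fst (snd u) := ?cut u)))
      else (\<lambda>u. ((fst (fst u))(fst (snd u) := ?cut u), snd (fst u))))"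
    by (simp add: fun_eq_iff split_cell_def Let_def)
  with 1 2 show ?thesis by (cases b) simp_all
qed

lemma measurable_bprf_cell:
  assumes "m \<le> p" "j < 2 ^ m"
  shows "(\<lambda>\<omega>. bprf_cell \<omega> m j) \<in> measurable (bprf_draws d p) cell_space"
  using assms
proof (induction m arbitrary: j)
  case 0 then show ?case by (simp add: space_pair_measure space_PiM)
next
  case (Suc m)
  have j: "j div 2 < 2 ^ m" using Suc.prems by auto
  have "(m, j div 2) \<in> draw_index p" using Suc.prems j by (auto simp: draw_index_def)
  then have 1: "(\<lambda>\<omega>. \<omega> (m, j div 2)) \<in> measurable (bprf_draws d p) (draw_law d)"
    unfolding bprf_draws_eq by (rule measurable_component_singleton)
  have 2: "(\<lambda>\<omega>. bprf_cell \<omega> m (j div 2)) \<in> measurable (bprf_draws d p) cell_space"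
    using Suc j by auto
  show ?case unfolding bprf_cell_Suc
    using measurable_compose[OF measurable_Pair[OF 2 1] measurable_split_cell[of "even j" d]]
    by simp
qed

text \<open>
  The cells of level \<open>m\<close> depend only on the draws of the earlier levels.
\<close>

lemma bprf_cell_restrict:
  assumes "m \<le> p" "j < 2 ^ m"
  shows "bprf_cell (restrict \<omega> (draw_index p)) m j = bprf_cell \<omega> m j"
  using assms
proof (induction m arbitrary: j)
  case 0 then show ?case by simp
next
  case (Suc m)
  have j: "j div 2 < 2 ^ m" using Suc.prems by auto
  then have "(m, j div 2) \<in> draw_index p" using Suc.prems by (auto simp: draw_index_def)
  then have "restrict \<omega> (draw_index p) (m, j div 2) = \<omega> (m, j div 2)" by simp
  moreover have "bprf_cell (restrict \<omega> (draw_index p)) m (j div 2) = bprf_cell \<omega> m (j div 2)"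
    by (rule Suc.IH) (use Suc.prems j in simp_all)
  ultimately show ?case unfolding bprf_cell_Suc by simp
qed

text \<open>
  The draw that splits a cell of level \<open>p\<close> is independent of the draws that produced this cell.
\<close>

lemma distr_draw:
  assumes "1 \<le> d" "j < 2 ^ p"
  shows "distr (bprf_draws d (Suc p)) (bprf_draws d p \<Otimes>\<^sub>M draw_law d)
           (\<lambda>\<omega>. (restrict \<omega> (draw_index p), \<omega> (p, j))) = bprf_draws d p \<Otimes>\<^sub>M draw_law d"
proof -
  let ?I = "draw_index p" let ?J = "insert (p, j) ?I" let ?K = "\<lambda>_::nat\<times>nat. draw_law d"
  interpret K: prob_space "draw_law d" by (rule prob_space_draw_law[OF assms(1)])
  interpret PK: product_prob_space ?K UNIV ..
  interpret W: prob_space "PiM ?I ?K" by (rule prob_space_PiM) (rule K.prob_space_axioms)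
  interpret WK: pair_sigma_finite "PiM ?I ?K" "draw_law d" ..
  interpret P2: product_prob_space ?K "draw_index (Suc p)" ..
  have sub: "?J \<subseteq> draw_index (Suc p)" and nin: "(p, j) \<notin> ?I"
    using assms(2) by (auto simp: draw_index_def)
  have fin: "finite ?J" using finite_draw_index by simp
  have m1: "(\<lambda>\<omega>. restrict \<omega> ?J) \<in> measurable (PiM (draw_index (Suc p)) ?K) (PiM ?J ?K)"
    by (rule measurable_restrict_subset[OF sub])
  have m2: "(\<lambda>\<omega>. (restrict \<omega> ?I, \<omega> (p, j))) \<in> measurable (PiM ?J ?K) (PiM ?I ?K \<Otimes>\<^sub>M draw_law d)"
    by (intro measurable_Pair measurable_restrict_subset measurable_component_singleton) auto
  have m3: "(\<lambda>(x, X). X((p, j) := x)) \<in> measurable (draw_law d \<Otimes>\<^sub>M PiM ?I ?K) (PiM ?J ?K)"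
    by measurable
  have "distr (PiM (draw_index (Suc p)) ?K) (PiM ?I ?K \<Otimes>\<^sub>M draw_law d)
           (\<lambda>\<omega>. (restrict \<omega> ?I, \<omega> (p, j)))
      = distr (distr (PiM (draw_index (Suc p)) ?K) (PiM ?J ?K) (\<lambda>\<omega>. restrict \<omega> ?J))
          (PiM ?I ?K \<Otimes>\<^sub>M draw_law d) (\<lambda>\<omega>. (restrict \<omega> ?I, \<omega> (p, j)))"
    by (subst distr_distr[OF m2 m1]) (simp add: comp_def Int_absorb1 subset_insertI)
  also have "\<dots> = distr (PiM ?J ?K) (PiM ?I ?K \<Otimes>\<^sub>M draw_law d) (\<lambda>\<omega>. (restrict \<omega> ?I, \<omega> (p, j)))"
    by (subst P2.distr_PiM_restrict_finite[OF fin sub]) simp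
  also have "PiM ?J ?K = distr (draw_law d \<Otimes>\<^sub>M PiM ?I ?K) (PiM ?J ?K) (\<lambda>(x, X). X((p, j) := x))"
    by (rule distr_pair_PiM_eq_PiM[symmetric]) (rule K.prob_space_axioms)+
  also have "distr \<dots> (PiM ?I ?K \<Otimes>\<^sub>M draw_law d) (\<lambda>\<omega>. (restrict \<omega> ?I, \<omega> (p, j)))
      = distr (draw_law d \<Otimes>\<^sub>M PiM ?I ?K) (PiM ?I ?K \<Otimes>\<^sub>M draw_law d) (\<lambda>(x, y). (y, x))"
    unfolding distr_distr[OF m2 m3]
  proof (rule distr_cong[OF refl refl], clarsimp simp: space_pair_measure space_PiM)
    fix X assume "X \<in> ?I \<rightarrow>\<^sub>E space (draw_law d)"
    then show "restrict (X((p, j) := (a, b))) ?I = X" for a b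
      using nin by (auto simp: restrict_def PiE_def extensional_def fun_eq_iff)
  qed
  also have "\<dots> = PiM ?I ?K \<Otimes>\<^sub>M draw_law d"
    by (rule WK.distr_pair_swap[symmetric]) 
  finally show ?thesis unfolding bprf_draws_eq .
qed

section \<open>Recursion over the depth of the tree\<close>


text \<open>
  The expected sum of \<open>f\<close> over the cells of depth \<open>p\<close>.
\<close>

definition cell_mean :: "nat \<Rightarrow> nat \<Rightarrow> (cell \<Rightarrow> real) \<Rightarrow> real" where
  "cell_mean d p f = (\<integral>\<omega>. (\<Sum>j<2 ^ p. f (bprf_cell \<omega> p j)) \<partial>bprf_draws d p)"

text \<open>
  The expected sum of \<open>f\<close> over the two children of the cell \<open>c\<close>.
\<close>

definition split_mean :: "nat \<Rightarrow> (cell \<Rightarrow> real) \<Rightarrow> cell \<Rightarrow> real" where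
  "split_mean d f c = (\<integral>y. f (split_cell True c y) + f (split_cell False c y) \<partial>draw_law d)"

text \<open>
  Measurable functions of a cell that are bounded on valid cells; their sums over the cells of a random
  partition are integrable.
\<close>

definition bounded_cell_fun :: "nat \<Rightarrow> (cell \<Rightarrow> real) \<Rightarrow> bool" where
  "bounded_cell_fun d f \<longleftrightarrow> f \<in> borel_measurable cell_space \<and> (\<exists>K. \<forall>c. valid_cell d c \<longrightarrow> \<bar>f c\<bar> \<le> K)"

lemma bounded_cell_funI:
  assumes "f \<in> borel_measurable cell_space" "\<And>c. valid_cell d c \<Longrightarrow> \<bar>f c\<bar> \<le> K"
  shows "bounded_cell_fun d f"
  using assms unfolding bounded_cell_fun_def by blast

lemma bounded_cell_fun_cmult:
  assumes "bounded_cell_fun d f" shows "bounded_cell_fun d (\<lambda>c. a * f c)"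
proof -
  obtain K where "\<And>c. valid_cell d c \<Longrightarrow> \<bar>f c\<bar> \<le> K" using assms by (auto simp: bounded_cell_fun_def)
  then show ?thesis
    using assms by (intro bounded_cell_funI[where K = "\<bar>a\<bar> * K"])
      (auto simp: bounded_cell_fun_def abs_mult intro!: mult_left_mono)
qed

lemma measurable_cell_fun:
  assumes "f \<in> borel_measurable cell_space" "j < 2 ^ p"
  shows "(\<lambda>\<omega>. f (bprf_cell \<omega> p j)) \<in> borel_measurable (bprf_draws d p)"
  using measurable_compose[OF measurable_bprf_cell assms(1)] assms(2) by simp

lemma integrable_cell_fun:
  assumes "1 \<le> d" "bounded_cell_fun d f" "j < 2 ^ p"
  shows "integrable (bprf_draws d p) (\<lambda>\<omega>. f (bprf_cell \<omega> p j))"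
proof -
  interpret prob_space "bprf_draws d p" by (rule prob_space_bprf_draws[OF assms(1)])
  obtain K where K: "\<And>c. valid_cell d c \<Longrightarrow> \<bar>f c\<bar> \<le> K" and f: "f \<in> borel_measurable cell_space"
    using assms(2) by (auto simp: bounded_cell_fun_def)
  show ?thesis
  proof (rule integrable_const_bound[where B = K])
    show "AE \<omega> in bprf_draws d p. norm (f (bprf_cell \<omega> p j)) \<le> K"
      using K[OF valid_bprf_cell[OF _ order_refl assms(3)]] by (intro AE_I2) simp
  qed (rule measurable_cell_fun[OF f assms(3)])
qed

lemma measurable_split_fun:
  fixes f :: "cell \<Rightarrow> real"
  assumes f: "f \<in> borel_measurable cell_space"
  shows "(\<lambda>(c, y). f (split_cell True c y) + f (split_cell False c y))
           \<in> borel_measurable (cell_space \<Otimes>\<^sub>M draw_law d)"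
proof -
  have "(\<lambda>u. f (split_cell b (fst u) (snd u))) \<in> borel_measurable (cell_space \<Otimes>\<^sub>M draw_law d)" for b
    using measurable_compose[OF measurable_split_cell f] by (simp add: case_prod_beta')
  from borel_measurable_add[OF this[of True] this[of False]] show ?thesis
    by (simp only: case_prod_beta')
qed

lemma measurable_split_fun_draw:
  fixes f :: "cell \<Rightarrow> real"
  assumes "f \<in> borel_measurable cell_space"
  shows "(\<lambda>y. f (split_cell True c y) + f (split_cell False c y)) \<in> borel_measurable (draw_law d)"
  using measurable_compose[OF measurable_Pair1'[of c] measurable_split_fun[OF assms]]
  by (simp add: space_cell_space)

lemma split_fun_bound:
  assumes "\<And>c. valid_cell d c \<Longrightarrow> \<bar>f c\<bar> \<le> K" "valid_cell d c" "y \<in> space (draw_law d)"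
  shows "norm (f (split_cell True c y) + f (split_cell False c y)) \<le> 2 * (K::real)"
proof -
  have "valid_cell d (split_cell b c y)" for b
    using assms(2,3) by (intro valid_split_cell) (auto simp: space_draw_law)
  then have "\<bar>f (split_cell b c y)\<bar> \<le> K" for b using assms(1) by blast
  from this[of True] this[of False] show ?thesis by (simp add: abs_le_iff)
qed

lemma bounded_cell_fun_split_mean:
  assumes "1 \<le> d" "bounded_cell_fun d f"
  shows "bounded_cell_fun d (split_mean d f)"
proof -
  interpret K: prob_space "draw_law d" by (rule prob_space_draw_law[OF assms(1)])
  obtain K where K: "\<And>c. valid_cell d c \<Longrightarrow> \<bar>f c\<bar> \<le> K" and f: "f \<in> borel_measurable cell_space"
    using assms(2) by (auto simp: bounded_cell_fun_def)
  show ?thesis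
  proof (rule bounded_cell_funI[where K = "2 * K"])
    show "split_mean d f \<in> borel_measurable cell_space"
      unfolding split_mean_def
      by (rule K.borel_measurable_lebesgue_integral[OF measurable_split_fun[OF f]])
    fix c assume c: "valid_cell d c"
    let ?G = "\<lambda>y. f (split_cell True c y) + f (split_cell False c y)"
    have bd: "norm (?G y) \<le> 2 * K" if "y \<in> space (draw_law d)" for y
      by (rule split_fun_bound[OF K c that])
    have int: "integrable (draw_law d) ?G"
      using bd by (intro K.integrable_const_bound[where B = "2 * K"] AE_I2 measurable_split_fun_draw f)
    have "split_mean d f c \<le> 2 * K" "- (2 * K) \<le> split_mean d f c"
      unfolding split_mean_def using bd
      by (intro K.integral_le_const K.integral_ge_const int AE_I2; fastforce simp: abs_le_iff)+
    then show "\<bar>split_mean d f c\<bar> \<le> 2 * K" by (simp add: abs_le_iff)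
  qed
qed

text \<open>
  The fundamental recursion: the expectation over the last level of draws is taken first.
\<close>

lemma cell_mean_Suc:
  assumes d: "1 \<le> d" and "bounded_cell_fun d f"
  shows "cell_mean d (Suc p) f = cell_mean d p (split_mean d f)"
proof -
  let ?W = "bprf_draws d p" let ?K = "draw_law d"
  let ?G = "\<lambda>c y. f (split_cell True c y) + f (split_cell False c y)"
  interpret K: prob_space ?K by (rule prob_space_draw_law[OF d])
  interpret W: prob_space ?W by (rule prob_space_bprf_draws[OF d])
  interpret WK: pair_prob_space ?W ?K ..
  obtain K where K: "\<And>c. valid_cell d c \<Longrightarrow> \<bar>f c\<bar> \<le> K" and f: "f \<in> borel_measurable cell_space"
    using assms(2) by (auto simp: bounded_cell_fun_def)
  have mG: "(\<lambda>(\<omega>, y). ?G (bprf_cell \<omega> p j) y) \<in> borel_measurable (?W \<Otimes>\<^sub>M ?K)" if j: "j < 2 ^ p" for j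
  proof -
    have "(\<lambda>u. (bprf_cell (fst u) p j, snd u)) \<in> measurable (?W \<Otimes>\<^sub>M ?K) (cell_space \<Otimes>\<^sub>M ?K)"
      by (intro measurable_Pair measurable_snd measurable_compose[OF measurable_fst]
          measurable_bprf_cell order_refl j)
    from measurable_compose[OF this measurable_split_fun[OF f]] show ?thesis
      by (simp add: case_prod_beta')
  qed
  have mr: "(\<lambda>\<omega>. (restrict \<omega> (draw_index p), \<omega> (p, j))) \<in> measurable (bprf_draws d (Suc p)) (?W \<Otimes>\<^sub>M ?K)"
    if j: "j < 2 ^ p" for j
    unfolding bprf_draws_eq using j
    by (intro measurable_Pair measurable_restrict_subset measurable_component_singleton)
       (auto simp: draw_index_def)
  have step: "(\<integral>\<omega>. ?G (bprf_cell \<omega> p j) (\<omega> (p, j)) \<partial>bprf_draws d (Suc p))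
      = (\<integral>\<omega>. split_mean d f (bprf_cell \<omega> p j) \<partial>?W)" if j: "j < 2 ^ p" for j
  proof -
    have "(\<integral>\<omega>. ?G (bprf_cell \<omega> p j) (\<omega> (p, j)) \<partial>bprf_draws d (Suc p))
       = (\<integral>\<omega>. (case (restrict \<omega> (draw_index p), \<omega> (p, j)) of (\<omega>', y) \<Rightarrow> ?G (bprf_cell \<omega>' p j) y)
            \<partial>bprf_draws d (Suc p))"
      by (simp add: bprf_cell_restrict[OF order_refl j])
    also have "\<dots> = (\<integral>u. (case u of (\<omega>', y) \<Rightarrow> ?G (bprf_cell \<omega>' p j) y)
        \<partial>distr (bprf_draws d (Suc p)) (?W \<Otimes>\<^sub>M ?K) (\<lambda>\<omega>. (restrict \<omega> (draw_index p), \<omega> (p, j))))"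
      by (rule integral_distr[symmetric, OF mr[OF j] mG[OF j]])
    also have "\<dots> = (\<integral>u. (case u of (\<omega>', y) \<Rightarrow> ?G (bprf_cell \<omega>' p j) y) \<partial>(?W \<Otimes>\<^sub>M ?K))"
      by (simp only: distr_draw[OF d j])
    also have "\<dots> = (\<integral>\<omega>. (\<integral>y. ?G (bprf_cell \<omega> p j) y \<partial>?K) \<partial>?W)"
    proof (rule WK.integral_fst'[symmetric, where f = "\<lambda>(\<omega>', y). ?G (bprf_cell \<omega>' p j) y", simplified])
      show "integrable (?W \<Otimes>\<^sub>M ?K) (\<lambda>(\<omega>', y). ?G (bprf_cell \<omega>' p j) y)"
      proof (rule WK.integrable_const_bound[where B = "2 * K", OF AE_I2 mG[OF j]])
        fix u assume "u \<in> space (?W \<Otimes>\<^sub>M ?K)"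
        then show "norm (case u of (\<omega>', y) \<Rightarrow> ?G (bprf_cell \<omega>' p j) y) \<le> 2 * K"
          using split_fun_bound[of d f K, OF K valid_bprf_cell[OF _ order_refl j]]
          by (auto simp: space_pair_measure)
      qed
    qed
    finally show ?thesis by (simp add: split_mean_def)
  qed
  have int: "integrable (bprf_draws d (Suc p)) (\<lambda>\<omega>. f (split_cell b (bprf_cell \<omega> p j) (\<omega> (p, j))))"
    if "j < 2 ^ p" for j b
    using integrable_cell_fun[OF d assms(2), of "2 * j + (if b then 0 else 1)" "Suc p"] that
    unfolding bprf_cell_Suc by (cases b) simp_all
  have "cell_mean d (Suc p) f = (\<integral>\<omega>. (\<Sum>j<2 ^ p. ?G (bprf_cell \<omega> p j) (\<omega> (p, j))) \<partial>bprf_draws d (Suc p))"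
    unfolding cell_mean_def sum_pairs bprf_cell_Suc by simp
  also have "\<dots> = (\<Sum>j<2 ^ p. \<integral>\<omega>. ?G (bprf_cell \<omega> p j) (\<omega> (p, j)) \<partial>bprf_draws d (Suc p))"
    by (rule Bochner_Integration.integral_sum) (auto intro!: int)
  also have "\<dots> = (\<Sum>j<2 ^ p. \<integral>\<omega>. split_mean d f (bprf_cell \<omega> p j) \<partial>?W)"
    by (intro sum.cong refl step) simp
  also have "\<dots> = cell_mean d p (split_mean d f)"
    unfolding cell_mean_def
    by (rule Bochner_Integration.integral_sum[symmetric])
       (auto intro!: integrable_cell_fun[OF d bounded_cell_fun_split_mean[OF d assms(2)]])
  finally show ?thesis .
qed

lemma cell_mean_0: "1 \<le> d \<Longrightarrow> cell_mean d 0 f = f root_cell"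
  using prob_space.prob_space[OF prob_space_bprf_draws[of d 0]] by (simp add: cell_mean_def)

lemma cell_mean_mono:
  assumes "1 \<le> d" "bounded_cell_fun d f" "bounded_cell_fun d g" "\<And>c. valid_cell d c \<Longrightarrow> f c \<le> g c"
  shows "cell_mean d p f \<le> cell_mean d p g"
  unfolding cell_mean_def
  by (intro integral_mono Bochner_Integration.integrable_sum integrable_cell_fun assms sum_mono valid_bprf_cell) auto

lemma cell_mean_cmult: "cell_mean d p (\<lambda>c. a * f c) = a * cell_mean d p f"
  unfolding cell_mean_def sum_distrib_left[symmetric] by simp

lemma cell_mean_add:
  assumes "1 \<le> d" "bounded_cell_fun d f" "bounded_cell_fun d g"
  shows "cell_mean d p (\<lambda>c. f c + g c) = cell_mean d p f + cell_mean d p g"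
  unfolding cell_mean_def sum.distrib
  by (intro Bochner_Integration.integral_add Bochner_Integration.integrable_sum integrable_cell_fun assms) auto

lemma cell_mean_const:
  assumes "1 \<le> d" shows "cell_mean d p (\<lambda>_. a) = 2 ^ p * a"
  using prob_space.prob_space[OF prob_space_bprf_draws[OF assms, of p]] by (simp add: cell_mean_def)

lemma cell_mean_le:
  assumes d: "1 \<le> d" and f: "bounded_cell_fun d f" and "0 \<le> r"
    and le: "\<And>c. valid_cell d c \<Longrightarrow> split_mean d f c \<le> r * f c"
  shows "cell_mean d p f \<le> r ^ p * f root_cell"
proof (induction p)
  case 0 then show ?case by (simp add: cell_mean_0[OF d])
next
  case (Suc p)
  have "cell_mean d (Suc p) f = cell_mean d p (split_mean d f)" by (rule cell_mean_Suc[OF d f])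
  also have "\<dots> \<le> cell_mean d p (\<lambda>c. r * f c)"
    by (intro cell_mean_mono d bounded_cell_fun_split_mean bounded_cell_fun_cmult f le)
  also have "\<dots> = r * cell_mean d p f" by (rule cell_mean_cmult)
  also have "\<dots> \<le> r * (r ^ p * f root_cell)" using Suc \<open>0 \<le> r\<close> by (rule mult_left_mono)
  finally show ?case by (simp add: mult.assoc)
qed

lemma cell_mean_eigen:
  assumes d: "1 \<le> d" and f: "bounded_cell_fun d f" and r: "0 \<le> r"
    and eq: "\<And>c. valid_cell d c \<Longrightarrow> split_mean d f c = r * f c"
  shows "cell_mean d p f = r ^ p * f root_cell"
proof (rule antisym)
  show "cell_mean d p f \<le> r ^ p * f root_cell" by (rule cell_mean_le[OF d f r]) (simp add: eq)
  have "cell_mean d p (\<lambda>c. - 1 * f c) \<le> r ^ p * (- 1 * f root_cell)"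
  proof (rule cell_mean_le[OF d bounded_cell_fun_cmult[OF f] r])
    fix c assume "valid_cell d c"
    have "split_mean d (\<lambda>c. - 1 * f c) c = - split_mean d f c"
      unfolding split_mean_def
      by (subst integral_minus[symmetric]) (rule Bochner_Integration.integral_cong, auto)
    then show "split_mean d (\<lambda>c. - 1 * f c) c \<le> r * (- 1 * f c)" by (simp add: eq[OF \<open>valid_cell d c\<close>])
  qed
  then show "r ^ p * f root_cell \<le> cell_mean d p f" unfolding cell_mean_cmult by simp
qed

lemma integral_draw_law:
  assumes d: "1 \<le> d" and G: "G \<in> borel_measurable (draw_law d)"
    and bd: "\<And>y. y \<in> space (draw_law d) \<Longrightarrow> norm (G y) \<le> (K::real)"
  shows "(\<integral>y. G y \<partial>draw_law d) = (\<Sum>l<d. \<integral>z. G (l, z) * indicator {0..1} z \<partial>lborel) / real d"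
proof -
  interpret K: prob_space "draw_law d" by (rule prob_space_draw_law[OF d])
  interpret A: prob_space "uniform_count_measure {..<d}"
    using d by (intro prob_space_uniform_count_measure) (auto simp: lessThan_empty_iff)
  interpret B: prob_space "restrict_space lborel {0..1::real}" by (rule prob_space_restrict_unit)
  interpret AB: pair_prob_space "uniform_count_measure {..<d}" "restrict_space lborel {0..1::real}" ..
  have "integrable (draw_law d) G"
    by (rule K.integrable_const_bound[where B = K]) (use G bd in auto)
  then have "(\<integral>y. G y \<partial>draw_law d) = (\<integral>l. (\<integral>z. G (l, z) \<partial>restrict_space lborel {0..1}) \<partial>uniform_count_measure {..<d})"
    unfolding draw_law_def by (rule AB.integral_fst'[symmetric])
  also have "\<dots> = (\<Sum>l<d. (\<integral>z. G (l, z) \<partial>restrict_space lborel {0..1})) / real d"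
    by (subst integral_uniform_count_measure) auto
  finally show ?thesis by (simp add: integral_restrict_space mult.commute)
qed

lemma split_mean_eq:
  assumes d: "1 \<le> d" and f: "bounded_cell_fun d f" and c: "valid_cell d c"
  shows "split_mean d f c =
    (\<Sum>l<d. \<integral>z. (f (split_cell True c (l, z)) + f (split_cell False c (l, z))) * indicator {0..1} z \<partial>lborel) / real d"
proof -
  obtain K where K: "\<And>c. valid_cell d c \<Longrightarrow> \<bar>f c\<bar> \<le> K" and fm: "f \<in> borel_measurable cell_space"
    using f by (auto simp: bounded_cell_fun_def)
  show ?thesis unfolding split_mean_def
    by (rule integral_draw_law[OF d measurable_split_fun_draw[OF fm]]) (rule split_fun_bound[OF K c])
qed

text \<open>
  The case in which the sum over the children does not depend on the draw as long as a coordinate other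
  than \<open>i\<close> is split, which happens with probability \<open>(d - 1) / d\<close>.
\<close>

lemma split_mean_coord:
  assumes d: "1 \<le> d" and f: "bounded_cell_fun d f" and c: "valid_cell d c" and i: "i < d"
    and other: "\<And>l z. l < d \<Longrightarrow> l \<noteq> i \<Longrightarrow> 0 \<le> z \<Longrightarrow> z \<le> 1 \<Longrightarrow>
      f (split_cell True c (l, z)) + f (split_cell False c (l, z)) = a"
    and own: "(\<integral>z. (f (split_cell True c (i, z)) + f (split_cell False c (i, z))) * indicator {0..1} z \<partial>lborel) = b"
  shows "split_mean d f c = ((real d - 1) * a + b) / real d"
proof -
  let ?I = "\<lambda>l. \<integral>z. (f (split_cell True c (l, z)) + f (split_cell False c (l, z))) * indicator {0..1} z \<partial>lborel"
  have "?I l = a" if "l < d" "l \<noteq> i" for l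
  proof -
    have "?I l = (\<integral>z. a * indicator {0..1::real} z \<partial>lborel)"
      by (rule Bochner_Integration.integral_cong) (auto simp: indicator_def other[OF that])
    then show ?thesis by simp
  qed
  then have "(\<Sum>l<d. ?I l) = (\<Sum>l<d. if l = i then b else a)" using own by (intro sum.cong) auto
  also have "\<dots> = b + (\<Sum>l\<in>{..<d} - {i}. a)" using i by (simp add: sum.remove)
  also have "\<dots> = (real d - 1) * a + b" using i d by (simp add: of_nat_diff)
  finally show ?thesis by (simp add: split_mean_eq[OF d f c])
qed

section \<open>Eigenfunctions of the splitting operator\<close>


text \<open>
  The length of the side \<open>i\<close>.
\<close>

definition width :: "cell \<Rightarrow> nat \<Rightarrow> real" where
  "width c i = snd c i - fst c i"

text \<open>
  The volume of a cell.
\<close>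

definition cell_vol :: "nat \<Rightarrow> cell \<Rightarrow> real" where
  "cell_vol d c = (\<Prod>i<d. width c i)"

lemma measurable_width [measurable]: "(\<lambda>c. width c i) \<in> borel_measurable cell_space"
  unfolding width_def by measurable

lemma measurable_cell_vol [measurable]: "cell_vol d \<in> borel_measurable cell_space"
  unfolding cell_vol_def by measurable

lemma width_bounds: "valid_cell d c \<Longrightarrow> i < d \<Longrightarrow> 0 \<le> width c i \<and> width c i \<le> 1"
  unfolding valid_cell_def width_def by (smt (verit))

lemma cell_vol_bounds: assumes "valid_cell d c" shows "0 \<le> cell_vol d c" "cell_vol d c \<le> 1"
  unfolding cell_vol_def using width_bounds[OF assms] by (auto intro!: prod_nonneg prod_le_1)

lemma width_split_other: "l \<noteq> i \<Longrightarrow> width (split_cell b c (l, z)) i = width c i"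
  by (simp add: width_def split_cell_def Let_def)

lemma width_split_True: "width (split_cell True c (i, z)) i = z * width c i"
  by (simp add: width_def split_cell_def Let_def algebra_simps)

lemma width_split_False: "width (split_cell False c (i, z)) i = (1 - z) * width c i"
  by (simp add: width_def split_cell_def Let_def algebra_simps)

lemma cell_vol_split:
  assumes "l < d"
  shows "cell_vol d (split_cell True c (l, z)) = z * cell_vol d c"
    and "cell_vol d (split_cell False c (l, z)) = (1 - z) * cell_vol d c"
proof -
  have *: "cell_vol d e = width e l * (\<Prod>i\<in>{..<d} - {l}. width e i)" for e
    unfolding cell_vol_def using assms by (simp add: prod.remove)
  have "(\<Prod>i\<in>{..<d} - {l}. width (split_cell b c (l, z)) i) = (\<Prod>i\<in>{..<d} - {l}. width c i)" for b
    by (intro prod.cong refl width_split_other) auto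
  then show "cell_vol d (split_cell True c (l, z)) = z * cell_vol d c"
    and "cell_vol d (split_cell False c (l, z)) = (1 - z) * cell_vol d c"
    unfolding * by (simp_all add: width_split_True width_split_False)
qed

lemma cell_vol_root: "cell_vol d root_cell = 1"
  by (simp add: cell_vol_def width_def)

lemma bounded_width_sq: "i < d \<Longrightarrow> bounded_cell_fun d (\<lambda>c. (width c i)\<^sup>2)"
  by (rule bounded_cell_funI[where K = 1]) (use width_bounds in \<open>auto simp: power_le_one_iff\<close>)

lemma bounded_vol_width4: "i < d \<Longrightarrow> bounded_cell_fun d (\<lambda>c. cell_vol d c * width c i ^ 4)"
proof (rule bounded_cell_funI[where K = 1])
  fix c assume i: "i < d" and c: "valid_cell d c"
  have "width c i ^ 4 \<le> 1" using width_bounds[OF c i] by (simp add: power_le_one)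
  then have "cell_vol d c * width c i ^ 4 \<le> 1 * 1"
    using cell_vol_bounds[OF c] width_bounds[OF c i] by (intro mult_mono) auto
  then show "\<bar>cell_vol d c * width c i ^ 4\<bar> \<le> 1" using cell_vol_bounds[OF c] width_bounds[OF c i] by simp
qed measurable

lemma cell_mean_width_sq:
  assumes d: "1 \<le> d" and i: "i < d"
  shows "cell_mean d p (\<lambda>c. (width c i)\<^sup>2) = (2 * (rho d)) ^ p"
proof -
  let ?f = "\<lambda>c. (width c i)\<^sup>2"
  have f: "bounded_cell_fun d ?f" by (rule bounded_width_sq[OF i])
  have "split_mean d ?f c = 2 * (rho d) * ?f c" if c: "valid_cell d c" for c
  proof -
    have "split_mean d ?f c = ((real d - 1) * (2 * ?f c) + 2 / 3 * ?f c) / real d"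
    proof (rule split_mean_coord[OF d f c i])
      have "(\<integral>z. ((z * width c i)\<^sup>2 + ((1 - z) * width c i)\<^sup>2) * indicator {0..1} z \<partial>lborel)
          = (\<lambda>z. (z ^ 3 / 3 - (1 - z) ^ 3 / 3) * ?f c) 1 - (\<lambda>z. (z ^ 3 / 3 - (1 - z) ^ 3 / 3) * ?f c) 0"
        by (rule integral_FTC_Icc_real)
           (auto intro!: derivative_eq_intros continuous_intros simp: field_simps power2_eq_square)
      then show "(\<integral>z. (?f (split_cell True c (i, z)) + ?f (split_cell False c (i, z))) * indicator {0..1} z \<partial>lborel)
          = 2 / 3 * ?f c"
        by (simp add: width_split_True width_split_False)
    qed (simp add: width_split_other)
    also have "\<dots> = 2 * (rho d) * ?f c" using d by (simp add: field_simps)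
    finally show ?thesis .
  qed
  moreover have "0 \<le> 2 * (rho d)" using d by (simp add: field_simps)
  ultimately show ?thesis
    by (subst cell_mean_eigen[OF d f]) (auto simp: width_def)
qed

lemma cell_mean_vol_width4:
  assumes d: "1 \<le> d" and i: "i < d"
  shows "cell_mean d p (\<lambda>c. cell_vol d c * width c i ^ 4) = rho d ^ p"
proof -
  let ?f = "\<lambda>c. cell_vol d c * width c i ^ 4"
  have f: "bounded_cell_fun d ?f" by (rule bounded_vol_width4[OF i])
  have "split_mean d ?f c = (rho d) * ?f c" if c: "valid_cell d c" for c
  proof -
    have "split_mean d ?f c = ((real d - 1) * (?f c) + 1 / 3 * ?f c) / real d"
    proof (rule split_mean_coord[OF d f c i])
      have "(\<integral>z. (z * cell_vol d c * (z * width c i) ^ 4 + (1 - z) * cell_vol d c * ((1 - z) * width c i) ^ 4)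
              * indicator {0..1} z \<partial>lborel)
          = (\<lambda>z. (z ^ 6 / 6 - (1 - z) ^ 6 / 6) * ?f c) 1 - (\<lambda>z. (z ^ 6 / 6 - (1 - z) ^ 6 / 6) * ?f c) 0"
        by (rule integral_FTC_Icc_real)
           (auto intro!: derivative_eq_intros continuous_intros simp: power_mult_distrib field_simps eval_nat_numeral)
      then show "(\<integral>z. (?f (split_cell True c (i, z)) + ?f (split_cell False c (i, z))) * indicator {0..1} z \<partial>lborel)
          = 1 / 3 * ?f c"
        using i by (simp add: width_split_True width_split_False cell_vol_split)
    qed (simp add: width_split_other cell_vol_split algebra_simps)
    also have "\<dots> = (rho d) * ?f c" using d by (simp add: field_simps)
    finally show ?thesis .
  qed
  moreover have "0 \<le> rho d" using d by (simp add: field_simps)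
  ultimately show ?thesis
    by (subst cell_mean_eigen[OF d f]) (auto simp: width_def cell_vol_root)
qed

text \<open>
  The positive shift \<open>e\<close> keeps the function bounded; negative powers of the volume itself would not be.
  The inequality needs no correction for the shift because \<open>e * (v + e) powr (- k) \<le> e powr (1 - k)\<close>.
\<close>

lemma integral_powr_shift_le:
  fixes v k e :: real
  assumes "0 \<le> v" "0 < e" "0 \<le> k" "k < 1"
  shows "(\<integral>z. ((z * v + e) powr - k + ((1 - z) * v + e) powr - k) * indicator {0..1} z \<partial>lborel)
    \<le> 2 / (1 - k) * (v + e) powr - k"
proof (cases "v = 0")
  case True
  have "1 \<le> 1 / (1 - k)" using assms by simp
  from mult_right_mono[OF this, of "e powr - k"] show ?thesis using True by simp
next
  case False
  then have v: "0 < v" using assms by simp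
  have pos: "0 < z * v + e" "0 < (1 - z) * v + e" if "0 \<le> z" "z \<le> 1" for z
    using that assms by (auto intro: add_nonneg_pos)
  let ?F = "\<lambda>z. ((z * v + e) powr (1 - k) - ((1 - z) * v + e) powr (1 - k)) / ((1 - k) * v)"
  have "(\<integral>z. ((z * v + e) powr - k + ((1 - z) * v + e) powr - k) * indicator {0..1} z \<partial>lborel) = ?F 1 - ?F 0"
  proof (rule integral_FTC_Icc_real)
    fix z :: real assume z: "0 \<le> z" "z \<le> 1"
    note p = pos[OF z]
    show "DERIV ?F z :> (z * v + e) powr - k + ((1 - z) * v + e) powr - k"
    proof -
      have 1: "((\<lambda>z. (z * v + e) powr (1 - k)) has_real_derivative (1 - k) * v * (z * v + e) powr - k) (at z)"
        using p by (auto intro!: derivative_eq_intros)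
      have 2: "((\<lambda>z. ((1 - z) * v + e) powr (1 - k)) has_real_derivative - ((1 - k) * v * ((1 - z) * v + e) powr - k)) (at z)"
        using p by (auto intro!: derivative_eq_intros)
      have "(1 - k) * v \<noteq> 0" using v assms by simp
      then show ?thesis using DERIV_cdivide[OF DERIV_diff[OF 1 2], of "(1 - k) * v"]
        by (simp add: add_divide_distrib)
    qed
    show "isCont (\<lambda>z. (z * v + e) powr - k + ((1 - z) * v + e) powr - k) z"
      using p by (intro continuous_intros) auto
  qed simp
  also have "\<dots> = 2 * ((v + e) powr (1 - k) - e powr (1 - k)) / ((1 - k) * v)"
    unfolding diff_divide_distrib[symmetric] by (simp add: algebra_simps)
  also have "\<dots> \<le> 2 * (v * (v + e) powr - k) / ((1 - k) * v)"
  proof -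
    have 1: "(v + e) powr (1 - k) = (v + e) * (v + e) powr - k"
      using v assms by (simp add: powr_mult_base)
    have "e * (v + e) powr - k \<le> e * e powr - k"
      using v assms by (intro mult_left_mono powr_mono2') auto
    also have "\<dots> = e powr (1 - k)" using assms by (simp add: powr_mult_base)
    finally have "(v + e) powr (1 - k) - e powr (1 - k) \<le> v * (v + e) powr - k"
      unfolding 1 by (simp add: algebra_simps)
    then show ?thesis using v assms by (intro divide_right_mono mult_left_mono) auto
  qed
  also have "\<dots> = 2 / (1 - k) * (v + e) powr - k" using v by simp
  finally show ?thesis .
qed

lemma bounded_cell_fun_vol_powr:
  assumes "0 < e" "0 \<le> k"
  shows "bounded_cell_fun d (\<lambda>c. (cell_vol d c + e) powr - k)"
proof (rule bounded_cell_funI[where K = "e powr - k"])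
  fix c assume c: "valid_cell d c"
  then show "\<bar>(cell_vol d c + e) powr - k\<bar> \<le> e powr - k"
    using assms cell_vol_bounds[OF c] by (auto intro!: powr_mono2')
qed measurable

lemma cell_mean_vol_powr:
  assumes d: "1 \<le> d" and e: "0 < e" and k: "0 \<le> k" "k < 1"
  shows "cell_mean d p (\<lambda>c. (cell_vol d c + e) powr - k) \<le> (2 / (1 - k)) ^ p"
proof -
  let ?f = "\<lambda>c. (cell_vol d c + e) powr - k"
  have f: "bounded_cell_fun d ?f" by (rule bounded_cell_fun_vol_powr[OF e k(1)])
  have "cell_mean d p ?f \<le> (2 / (1 - k)) ^ p * ?f root_cell"
  proof (rule cell_mean_le[OF d f])
    fix c assume c: "valid_cell d c"
    have "split_mean d ?f c \<le> (\<Sum>l<d. 2 / (1 - k) * ?f c) / real d"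
      unfolding split_mean_eq[OF d f c]
    proof (intro divide_right_mono sum_mono)
      fix l assume "l \<in> {..<d}"
      then show "(\<integral>z. (?f (split_cell True c (l, z)) + ?f (split_cell False c (l, z))) * indicator {0..1} z \<partial>lborel)
          \<le> 2 / (1 - k) * ?f c"
        using integral_powr_shift_le[OF cell_vol_bounds(1)[OF c] e k] by (simp only: cell_vol_split lessThan_iff)
    qed simp
    also have "\<dots> = 2 / (1 - k) * ?f c" using d by simp
    finally show "split_mean d ?f c \<le> 2 / (1 - k) * ?f c" .
  qed (use k in simp)
  also have "\<dots> \<le> (2 / (1 - k)) ^ p * 1"
  proof (rule mult_left_mono)
    show "?f root_cell \<le> 1" using powr_mono2'[of "- k" 1 "1 + e"] e k by (simp add: cell_vol_root)
  qed (use k in simp)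
  finally show ?thesis by simp
qed

text \<open>
  A uniform cut of \<open>[A, B)\<close>: the piece that contains \<open>x\<close> keeps its left end if the cut falls to the right of
  \<open>x\<close>, and its right end otherwise.
\<close>

lemma integral_cut:
  fixes A B x :: real
  assumes x: "A \<le> x" "x < B"
    and D1: "\<And>u. (\<Phi> has_real_derivative \<phi> u) (at u)" and D2: "\<And>u. (\<Psi> has_real_derivative \<psi> u) (at u)"
    and C1: "\<And>u. isCont \<phi> u" and C2: "\<And>u. isCont \<psi> u"
  shows "(\<integral>z. (if x < (1 - z) * A + z * B then \<phi> ((1 - z) * A + z * B) else \<psi> ((1 - z) * A + z * B))
       * indicator {0..1} z \<partial>lborel) = (\<Phi> B - \<Phi> x + \<Psi> x - \<Psi> A) / (B - A)"
proof -
  let ?c = "\<lambda>z. (1 - z) * A + z * B" define t where "t = (x - A) / (B - A)"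
  have w: "0 < B - A" using x by simp
  have t: "0 \<le> t" "t \<le> 1" using x by (auto simp: t_def)
  have "t * (B - A) = x - A" using w by (simp add: t_def)
  then have ct: "?c t = x" by (simp add: algebra_simps)
  have lt: "x < ?c z \<longleftrightarrow> t < z" for z
  proof -
    have "?c z = ?c t + (z - t) * (B - A)" by (simp add: algebra_simps)
    then have "x < ?c z \<longleftrightarrow> 0 < (z - t) * (B - A)" unfolding ct by simp
    also have "\<dots> \<longleftrightarrow> t < z" using w by (simp add: zero_less_mult_iff)
    finally show ?thesis .
  qed
  have ftc: "has_bochner_integral lborel (\<lambda>z. f (?c z) * indicator {a..b} z) (F (?c b) / (B - A) - F (?c a) / (B - A))"
    if "a \<le> b" and D: "\<And>u. (F has_real_derivative f u) (at u)" and C: "\<And>u. isCont f u" for F f a b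
  proof (rule has_bochner_integral_FTC_Icc_real)
    show "a \<le> b" by fact
  next
    fix z
    have "(?c has_real_derivative (B - A)) (at z)" by (auto intro!: derivative_eq_intros)
    from DERIV_cdivide[OF DERIV_chain2[OF D this], of "B - A"] show "((\<lambda>z. F (?c z) / (B - A)) has_real_derivative f (?c z)) (at z)"
      using w by simp
    show "isCont (\<lambda>z. f (?c z)) z"
      by (rule isCont_o2[of z ?c f]) (auto intro!: continuous_intros C)
  qed
  note I1 = ftc[OF t(1) D2 C2] and I2 = ftc[OF t(2) D1 C1]
  have "(\<integral>z. (if x < ?c z then \<phi> (?c z) else \<psi> (?c z)) * indicator {0..1} z \<partial>lborel)
     = (\<integral>z. \<psi> (?c z) * indicator {0..t} z + \<phi> (?c z) * indicator {t..1} z \<partial>lborel)"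
  proof (rule integral_cong_AE)
    have "continuous_on UNIV (\<lambda>z. \<phi> (?c z))" "continuous_on UNIV (\<lambda>z. \<psi> (?c z))"
      by (auto intro!: continuous_at_imp_continuous_on isCont_o2[of _ ?c] continuous_intros C1 C2)
    then have m: "(\<lambda>z. \<phi> (?c z)) \<in> borel_measurable borel" "(\<lambda>z. \<psi> (?c z)) \<in> borel_measurable borel"
      by (auto intro: borel_measurable_continuous_onI)
    show "(\<lambda>z. (if x < ?c z then \<phi> (?c z) else \<psi> (?c z)) * indicator {0..1} z) \<in> borel_measurable lborel"
      "(\<lambda>z. \<psi> (?c z) * indicator {0..t} z + \<phi> (?c z) * indicator {t..1} z) \<in> borel_measurable lborel"
      using m by measurable
    show "AE z in lborel. (if x < ?c z then \<phi> (?c z) else \<psi> (?c z)) * indicator {0..1} z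
        = \<psi> (?c z) * indicator {0..t} z + \<phi> (?c z) * indicator {t..1} z"
      using AE_lborel_singleton[of t]
      by eventually_elim (use t in \<open>auto simp: lt indicator_def\<close>)
  qed
  also have "\<dots> = (\<Psi> (?c t) / (B - A) - \<Psi> (?c 0) / (B - A)) + (\<Phi> (?c 1) / (B - A) - \<Phi> (?c t) / (B - A))"
    by (rule has_bochner_integral_integral_eq[OF has_bochner_integral_add[OF I1 I2]])
  also have "\<dots> = (\<Phi> B - \<Phi> x + \<Psi> x - \<Psi> A) / (B - A)" unfolding ct by (simp add: diff_divide_distrib add_divide_distrib)
  finally show ?thesis .
qed

lemma measurable_indicator_cell_box:
  "(\<lambda>c. indicator (cell_box d c) x :: real) \<in> borel_measurable cell_space"
proof -
  have "(\<lambda>c. indicator (cell_box d c) x :: real) =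
      (\<lambda>c. if x \<in> extensional {..<d} \<and> (\<forall>i\<in>{..<d}. fst c i \<le> x i \<and> x i < snd c i) then 1 else 0)"
    by (auto simp: mem_cell_box indicator_def fun_eq_iff)
  then show ?thesis by simp
qed

text \<open>
  The splitting operator on functions of the side \<open>i\<close> of the cell that contains the point \<open>x\<close>, in terms of
  antiderivatives \<open>\<Phi>\<close> and \<open>\<Psi>\<close> of \<open>h\<close> in its two arguments.
\<close>

lemma split_mean_at_point:
  fixes h :: "real \<Rightarrow> real \<Rightarrow> real"
  assumes d: "1 \<le> d" and i: "i < d" and c: "valid_cell d c"
    and f: "bounded_cell_fun d (\<lambda>c. indicator (cell_box d c) x * h (fst c i) (snd c i))"
    and D1: "\<And>u. (\<Phi> has_real_derivative h (fst c i) u) (at u)"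
    and D2: "\<And>u. (\<Psi> has_real_derivative h u (snd c i)) (at u)"
    and C1: "\<And>u. isCont (h (fst c i)) u" and C2: "\<And>u. isCont (\<lambda>u. h u (snd c i)) u"
  shows "split_mean d (\<lambda>c. indicator (cell_box d c) x * h (fst c i) (snd c i)) c
    = indicator (cell_box d c) x * (((real d - 1) * h (fst c i) (snd c i)
        + (\<Phi> (snd c i) - \<Phi> (x i) + \<Psi> (x i) - \<Psi> (fst c i)) / width c i) / real d)"
proof -
  let ?f = "\<lambda>c. indicator (cell_box d c) x * h (fst c i) (snd c i)"
  let ?I = "\<lambda>c. indicator (cell_box d c) x :: real"
  let ?b = "(\<Phi> (snd c i) - \<Phi> (x i) + \<Psi> (x i) - \<Psi> (fst c i)) / width c i"
  have ind: "?I (split_cell True c (l, z)) + ?I (split_cell False c (l, z)) = ?I c"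
    if "l < d" "0 \<le> z" "z \<le> 1" for l z
    by (rule indicator_split_cell[OF c]) (use that in auto)
  have "split_mean d ?f c = ((real d - 1) * ?f c + ?I c * ?b) / real d"
  proof (rule split_mean_coord[OF d f c i])
    fix l z :: real and l' :: nat
    assume l: "l' < d" "l' \<noteq> i" "0 \<le> z" "z \<le> 1"
    have "fst (split_cell b c (l', z)) i = fst c i" "snd (split_cell b c (l', z)) i = snd c i" for b
      using l(2) by (auto simp: split_cell_def Let_def)
    then show "?f (split_cell True c (l', z)) + ?f (split_cell False c (l', z)) = ?f c"
      using ind[OF l(1,3,4)] by (simp flip: distrib_right)
  next
    show "(\<integral>z. (?f (split_cell True c (i, z)) + ?f (split_cell False c (i, z))) * indicator {0..1} z \<partial>lborel) = ?I c * ?b"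
    proof (cases "x \<in> cell_box d c")
      case False
      have "?I (split_cell b c (i, z)) = 0" if "0 \<le> z" "z \<le> 1" for b z
        using ind[OF i that] False by (cases b) (auto simp: indicator_def of_bool_def split: if_splits)
      then have "(\<lambda>z. (?f (split_cell True c (i, z)) + ?f (split_cell False c (i, z))) * indicator {0..1} z) = (\<lambda>z. 0)"
        by (auto simp: fun_eq_iff indicator_def)
      then show ?thesis using False by simp
    next
      case True
      have x: "fst c i \<le> x i" "x i < snd c i" using True i by (auto simp: mem_cell_box)
      let ?cut = "\<lambda>z. (1 - z) * fst c i + z * snd c i"
      have *: "(?f (split_cell True c (i, z)) + ?f (split_cell False c (i, z))) * indicator {0..1} z
         = (if x i < ?cut z then h (fst c i) (?cut z) else h (?cut z) (snd c i)) * indicator {0..1} z" for z :: real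
      proof (cases "0 \<le> z \<and> z \<le> 1")
        case z: True
        have "x \<in> cell_box d (split_cell False c (i, z)) \<longleftrightarrow> \<not> x \<in> cell_box d (split_cell True c (i, z))"
          using ind[OF i, of z] z True by (auto simp: indicator_def split: if_splits)
        moreover have "x \<in> cell_box d (split_cell True c (i, z)) \<longleftrightarrow> x i < ?cut z"
          using True i by (auto simp: mem_cell_box split_cell_def Let_def)
        moreover have "snd (split_cell True c (i, z)) i = ?cut z" "fst (split_cell True c (i, z)) i = fst c i"
           "fst (split_cell False c (i, z)) i = ?cut z" "snd (split_cell False c (i, z)) i = snd c i"
          by (auto simp: split_cell_def Let_def)
        ultimately show ?thesis by (simp add: indicator_def)
      qed (auto simp: indicator_def)
      show ?thesis unfolding *
        using integral_cut[OF x D1 D2 C1 C2] True by (simp add: width_def)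
    qed
  qed
  then show ?thesis by (simp add: algebra_simps)
qed

lemma bounded_cell_fun_at_point:
  assumes "(\<lambda>c. h (fst c i) (snd c i)) \<in> borel_measurable cell_space" "i < d"
    "\<And>a b. 0 \<le> a \<Longrightarrow> a \<le> x i \<Longrightarrow> x i < b \<Longrightarrow> b \<le> 1 \<Longrightarrow> \<bar>h a b\<bar> \<le> K" "0 \<le> K"
  shows "bounded_cell_fun d (\<lambda>c. indicator (cell_box d c) x * h (fst c i) (snd c i))"
proof (rule bounded_cell_funI[where K = K])
  fix c assume "valid_cell d c"
  then show "\<bar>indicator (cell_box d c) x * h (fst c i) (snd c i)\<bar> \<le> K"
    using assms(2-4) by (auto simp: indicator_def valid_cell_def mem_cell_box)
qed (intro borel_measurable_times measurable_indicator_cell_box assms(1))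

lemma indicator_root: "x \<in> cube d \<Longrightarrow> indicator (cell_box d root_cell) x = (1::real)"
  by (simp add: cell_box_def)

text \<open>
  Twice the expected offset of the centre of the cell of \<open>x\<close> from \<open>x\<close>: it is exactly geometric in the depth.
\<close>

lemma cell_mean_offset:
  assumes d: "1 \<le> d" and i: "i < d" and x: "x \<in> cube d"
  shows "cell_mean d p (\<lambda>c. indicator (cell_box d c) x * (fst c i + snd c i - 2 * x i))
    = kappa d ^ p * (1 - 2 * x i)"
proof -
  define h where "h = (\<lambda>a b. a + b - 2 * x i)"
  let ?f = "\<lambda>c. indicator (cell_box d c) x * h (fst c i) (snd c i)"
  have f: "bounded_cell_fun d ?f"
    by (rule bounded_cell_fun_at_point[where K = 1]) (auto simp: h_def i)
  have "split_mean d ?f c = (kappa d) * ?f c" if c: "valid_cell d c" for c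
  proof -
    let ?A = "fst c i" let ?B = "snd c i" let ?x = "x i"
    let ?P = "\<lambda>u. (?A - 2 * ?x) * u + u\<^sup>2 / 2" let ?Q = "\<lambda>u. (?B - 2 * ?x) * u + u\<^sup>2 / 2"
    have eq: "split_mean d ?f c = indicator (cell_box d c) x * (((real d - 1) * h ?A ?B
        + (?P ?B - ?P ?x + ?Q ?x - ?Q ?A) / width c i) / real d)"
      by (rule split_mean_at_point[OF d i c f])
         (auto intro!: derivative_eq_intros continuous_intros simp: h_def)
    show ?thesis
    proof (cases "x \<in> cell_box d c")
      case True
      then have w: "0 < width c i" using i by (force simp: mem_cell_box width_def)
      have "?P ?B - ?P ?x + ?Q ?x - ?Q ?A = h ?A ?B / 2 * width c i"
        by (simp add: h_def width_def power2_eq_square field_simps)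
      then have *: "(?P ?B - ?P ?x + ?Q ?x - ?Q ?A) / width c i = h ?A ?B / 2" using w by simp
      show ?thesis unfolding eq * using d by (simp add: field_simps)
    qed (simp add: eq)
  qed
  moreover have "0 \<le> kappa d" using d by simp
  ultimately have "cell_mean d p ?f = kappa d ^ p * ?f root_cell"
    by (intro cell_mean_eigen[OF d f]) auto
  then show ?thesis using indicator_root[OF x] by (simp add: h_def)
qed

text \<open>
  The product of the distances from \<open>x\<close> to the two faces orthogonal to the coordinate \<open>i\<close>.
\<close>

lemma cell_mean_product:
  assumes d: "1 \<le> d" and i: "i < d" and x: "x \<in> cube d"
  shows "cell_mean d p (\<lambda>c. indicator (cell_box d c) x * ((x i - fst c i) * (snd c i - x i)))
    = kappa d ^ p * (x i * (1 - x i))"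
proof -
  define h where "h = (\<lambda>a b. (x i - a) * (b - x i))"
  let ?f = "\<lambda>c. indicator (cell_box d c) x * h (fst c i) (snd c i)"
  have f: "bounded_cell_fun d ?f"
    by (rule bounded_cell_fun_at_point[where K = 1]) (auto simp: h_def i abs_mult intro!: mult_le_one)
  have "split_mean d ?f c = (kappa d) * ?f c" if c: "valid_cell d c" for c
  proof -
    let ?A = "fst c i" let ?B = "snd c i" let ?x = "x i"
    let ?P = "\<lambda>u. (?x - ?A) * (u - ?x)\<^sup>2 / 2" let ?Q = "\<lambda>u. - ((?x - u)\<^sup>2 * (?B - ?x) / 2)"
    have eq: "split_mean d ?f c = indicator (cell_box d c) x * (((real d - 1) * h ?A ?B
        + (?P ?B - ?P ?x + ?Q ?x - ?Q ?A) / width c i) / real d)"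
      by (rule split_mean_at_point[OF d i c f])
         (auto intro!: derivative_eq_intros continuous_intros simp: h_def field_simps)
    show ?thesis
    proof (cases "x \<in> cell_box d c")
      case True
      then have w: "0 < width c i" using i by (force simp: mem_cell_box width_def)
      have "?P ?B - ?P ?x + ?Q ?x - ?Q ?A = h ?A ?B / 2 * width c i"
        by (simp add: h_def width_def power2_eq_square field_simps)
      then have *: "(?P ?B - ?P ?x + ?Q ?x - ?Q ?A) / width c i = h ?A ?B / 2" using w by simp
      show ?thesis unfolding eq * using d by (simp add: field_simps)
    qed (simp add: eq)
  qed
  moreover have "0 \<le> kappa d" using d by simp
  ultimately have "cell_mean d p ?f = kappa d ^ p * ?f root_cell"
    by (intro cell_mean_eigen[OF d f]) auto
  then show ?thesis using indicator_root[OF x] by (simp add: h_def)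
qed

text \<open>
  The squared width is the sum of the \<open>rho\<close>-eigenfunction \<open>w^2 - 6 (x - A) (B - x)\<close> and of a
  \<open>kappa\<close>-eigenfunction; the second one dominates.
\<close>

lemma cell_mean_width_sq_at_point:
  assumes d: "1 \<le> d" and i: "i < d" and x: "x \<in> cube d"
  shows "cell_mean d p (\<lambda>c. indicator (cell_box d c) x * (width c i)\<^sup>2)
    = 6 * kappa d ^ p * (x i * (1 - x i))
      + rho d ^ p * (1 - 6 * (x i * (1 - x i)))"
proof -
  define h where "h = (\<lambda>a b. (b - a)\<^sup>2 - 6 * ((x i - a) * (b - x i)))"
  let ?f = "\<lambda>c. indicator (cell_box d c) x * h (fst c i) (snd c i)"
  let ?g = "\<lambda>c. indicator (cell_box d c) x * ((x i - fst c i) * (snd c i - x i))"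
  have g: "bounded_cell_fun d ?g"
    by (rule bounded_cell_fun_at_point[where K = 1]) (auto simp: i abs_mult intro!: mult_le_one)
  have f: "bounded_cell_fun d ?f"
  proof (rule bounded_cell_fun_at_point[where K = 7, OF _ i])
    fix a b assume *: "0 \<le> a" "a \<le> x i" "x i < b" "b \<le> 1"
    have "(b - a)\<^sup>2 \<le> 1" using * by (simp add: power_le_one)
    moreover have "(x i - a) * (b - x i) \<le> 1" "0 \<le> (x i - a) * (b - x i)"
      using * by (auto intro!: mult_le_one)
    ultimately show "\<bar>h a b\<bar> \<le> 7" unfolding h_def abs_le_iff using zero_le_power2[of "b - a"] by linarith
  qed (auto simp: h_def)
  have "split_mean d ?f c = (rho d) * ?f c" if c: "valid_cell d c" for c
  proof -
    let ?A = "fst c i" let ?B = "snd c i" let ?x = "x i"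
    let ?P = "\<lambda>u. (u - ?A) ^ 3 / 3 - 3 * (?x - ?A) * (u - ?x)\<^sup>2"
    let ?Q = "\<lambda>u. - ((?B - u) ^ 3 / 3) + 3 * (?x - u)\<^sup>2 * (?B - ?x)"
    have eq: "split_mean d ?f c = indicator (cell_box d c) x * (((real d - 1) * h ?A ?B
        + (?P ?B - ?P ?x + ?Q ?x - ?Q ?A) / width c i) / real d)"
      by (rule split_mean_at_point[OF d i c f])
         (auto intro!: derivative_eq_intros continuous_intros simp: h_def field_simps power2_eq_square)
    show ?thesis
    proof (cases "x \<in> cell_box d c")
      case True
      then have w: "0 < width c i" using i by (force simp: mem_cell_box width_def)
      have "?P ?B - ?P ?x + ?Q ?x - ?Q ?A = h ?A ?B / 3 * width c i"
        by (simp add: h_def width_def power2_eq_square power3_eq_cube field_simps)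
      then have *: "(?P ?B - ?P ?x + ?Q ?x - ?Q ?A) / width c i = h ?A ?B / 3" using w by simp
      show ?thesis unfolding eq * using d by (simp add: field_simps)
    qed (simp add: eq)
  qed
  moreover have "0 \<le> rho d" using d by (simp add: field_simps)
  ultimately have 1: "cell_mean d p ?f = rho d ^ p * ?f root_cell"
    by (intro cell_mean_eigen[OF d f]) auto
  have "cell_mean d p (\<lambda>c. indicator (cell_box d c) x * (width c i)\<^sup>2)
      = cell_mean d p (\<lambda>c. ?f c + 6 * ?g c)"
    by (intro arg_cong[where f = "cell_mean d p"]) (auto simp: h_def width_def fun_eq_iff algebra_simps)
  also have "\<dots> = cell_mean d p ?f + 6 * cell_mean d p ?g"
    by (simp add: cell_mean_add[OF d f bounded_cell_fun_cmult[OF g]] cell_mean_cmult)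
  finally show ?thesis unfolding 1 cell_mean_product[OF d i x] using indicator_root[OF x]
    by (simp add: h_def)
qed

section \<open>The uniform law on the cube\<close>


text \<open>
  The uniform law on \<open>[0, 1)\<close>, the factor of the uniform law on the cube.
\<close>

abbreviation unit_law :: "real measure" where
  "unit_law \<equiv> restrict_space lborel {0..<1}"

lemma prob_space_unit_law: "prob_space unit_law"
  by (rule prob_spaceI) (simp add: emeasure_restrict_space space_restrict_space)

lemma space_unit_law: "space unit_law = {0..<1}"
  by (simp add: space_restrict_space)

lemma prob_space_unif_cube: "prob_space (unif_cube d)"
  unfolding unif_cube_def by (rule prob_space_PiM) (rule prob_space_unit_law)

lemma space_unif_cube: "space (unif_cube d) = cube d"
  by (simp add: unif_cube_def space_PiM space_unit_law box_set_def)

lemma cell_box_subset_cube: "valid_cell d c \<Longrightarrow> cell_box d c \<subseteq> cube d"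
  unfolding cell_box_def box_set_def valid_cell_def
  by (intro PiE_mono) (auto intro: order_trans less_le_trans)

lemma interval_in_unit_law: "0 \<le> a \<Longrightarrow> b \<le> 1 \<Longrightarrow> {a..<b} \<in> sets unit_law"
  by (auto simp: sets_restrict_space_iff)

lemma measure_interval_unit_law: "0 \<le> a \<Longrightarrow> a \<le> b \<Longrightarrow> b \<le> 1 \<Longrightarrow> measure unit_law {a..<b} = b - a"
  by (subst measure_restrict_space) auto

lemma cell_box_PiE: "cell_box d c = (\<Pi>\<^sub>E i\<in>{..<d}. {fst c i..<snd c i})"
  by (simp add: cell_box_def box_set_def)

lemma sets_cell_box:
  assumes "valid_cell d c" shows "cell_box d c \<in> sets (unif_cube d)"
  unfolding cell_box_PiE unif_cube_def
  using assms by (intro sets_PiM_I_finite interval_in_unit_law) (auto simp: valid_cell_def)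

lemma measure_cell_box:
  assumes "valid_cell d c" shows "measure (unif_cube d) (cell_box d c) = cell_vol d c"
proof -
  interpret P: product_prob_space "\<lambda>_::nat. unit_law" "{..<d}"
    by (intro product_prob_spaceI prob_space_unit_law)
  interpret finite_product_prob_space "\<lambda>_::nat. unit_law" "{..<d}"
    by standard simp
  have "measure (unif_cube d) (cell_box d c) = (\<Prod>i<d. measure unit_law {fst c i..<snd c i})"
    unfolding cell_box_PiE unif_cube_def
    using assms by (intro finite_measure_PiM_emb interval_in_unit_law) (auto simp: valid_cell_def)
  also have "\<dots> = cell_vol d c" unfolding cell_vol_def width_def
    using assms by (intro prod.cong measure_interval_unit_law) (auto simp: valid_cell_def)
  finally show ?thesis .
qed

lemma emeasure_cell_box:
  assumes "valid_cell d c" shows "emeasure (unif_cube d) (cell_box d c) = ennreal (cell_vol d c)"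
proof -
  interpret prob_space "unif_cube d" by (rule prob_space_unif_cube)
  show ?thesis by (simp add: emeasure_eq_measure measure_cell_box[OF assms])
qed

lemma measurable_coord_unif_cube:
  assumes "i < d" shows "(\<lambda>x. x i) \<in> borel_measurable (unif_cube d)"
proof -
  have "(\<lambda>x. x i) \<in> measurable (unif_cube d) unit_law"
    unfolding unif_cube_def using assms by (intro measurable_component_singleton) simp
  moreover have "(\<lambda>t. t) \<in> measurable unit_law borel"
    by (rule measurable_restrict_space1) simp
  ultimately show ?thesis by (rule measurable_compose)
qed

lemma indicator_cell_box_prod:
  assumes "x \<in> extensional {..<d}"
  shows "(indicator (cell_box d c) x :: real) = (\<Prod>i<d. if fst c i \<le> x i \<and> x i < snd c i then 1 else 0)"
proof (cases "\<forall>i<d. fst c i \<le> x i \<and> x i < snd c i")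
  case True
  then show ?thesis using assms by (simp add: mem_cell_box)
next
  case False
  then obtain i where i: "i < d" "\<not> (fst c i \<le> x i \<and> x i < snd c i)" by blast
  then have "x \<notin> cell_box d c" by (auto simp: mem_cell_box)
  moreover have "(\<Prod>i<d. if fst c i \<le> x i \<and> x i < snd c i then 1 else 0) = (0::real)"
    using i by (intro prod_zero) auto
  ultimately show ?thesis by simp
qed

lemma measurable_indicator_cell_box_joint:
  "(\<lambda>(x, c). indicator (cell_box d c) x :: real) \<in> borel_measurable (unif_cube d \<Otimes>\<^sub>M cell_space)"
proof -
  have 1: "(\<lambda>u. fst u i) \<in> borel_measurable (unif_cube d \<Otimes>\<^sub>M cell_space)" if "i < d" for i
    using measurable_compose[OF measurable_fst measurable_coord_unif_cube[OF that]] .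
  have 2: "(\<lambda>u. fst (snd u) i) \<in> borel_measurable (unif_cube d \<Otimes>\<^sub>M cell_space)"
     "(\<lambda>u. snd (snd u) i) \<in> borel_measurable (unif_cube d \<Otimes>\<^sub>M cell_space)" for i
    by (rule measurable_compose[OF measurable_snd], simp)+
  have "(\<lambda>u. \<Prod>i<d. if fst (snd u) i \<le> fst u i \<and> fst u i < snd (snd u) i then 1 else 0 :: real)
      \<in> borel_measurable (unif_cube d \<Otimes>\<^sub>M cell_space)"
  proof (rule borel_measurable_prod)
    fix i assume "i \<in> {..<d}"
    then have [measurable]: "(\<lambda>u. fst u i) \<in> borel_measurable (unif_cube d \<Otimes>\<^sub>M cell_space)" using 1 by simp
    note 2[of i, measurable]
    show "(\<lambda>u. if fst (snd u) i \<le> fst u i \<and> fst u i < snd (snd u) i then 1 else 0 :: real)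
        \<in> borel_measurable (unif_cube d \<Otimes>\<^sub>M cell_space)" by measurable
  qed
  moreover have "indicator (cell_box d (snd u)) (fst u)
      = (\<Prod>i<d. if fst (snd u) i \<le> fst u i \<and> fst u i < snd (snd u) i then 1 else 0 :: real)"
    if "u \<in> space (unif_cube d \<Otimes>\<^sub>M cell_space)" for u :: "(nat \<Rightarrow> real) \<times> cell"
  proof -
    have "fst u \<in> cube d" using that by (simp add: space_pair_measure space_unif_cube mem_Times_iff)
    then have "fst u \<in> extensional {..<d}" unfolding box_set_def by (rule PiE_iff[THEN iffD1, THEN conjunct2])
    then show ?thesis by (rule indicator_cell_box_prod)
  qed
  ultimately show ?thesis unfolding case_prod_beta' by (subst measurable_cong) auto
qed

lemma unif_cube_insert: "i < d \<Longrightarrow> unif_cube d = PiM (insert i ({..<d} - {i})) (\<lambda>_. unit_law)"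
  unfolding unif_cube_def by (intro arg_cong2[where f = PiM]) auto

text \<open>
  The projection of a cell along the coordinate \<open>i\<close>.
\<close>

definition cell_face :: "nat \<Rightarrow> cell \<Rightarrow> nat \<Rightarrow> (nat \<Rightarrow> real) set" where
  "cell_face d c i = (\<Pi>\<^sub>E k\<in>{..<d} - {i}. {fst c k..<snd c k})"

lemma upd_mem_cell_box:
  assumes "i < d" "x \<in> space (PiM ({..<d} - {i}) (\<lambda>_. unit_law))"
  shows "x(i := t) \<in> cell_box d c \<longleftrightarrow> x \<in> cell_face d c i \<and> t \<in> {fst c i..<snd c i}"
proof -
  have "x \<in> extensional ({..<d} - {i})" using assms(2) unfolding space_PiM PiE_iff by blast
  then have face: "x \<in> cell_face d c i \<longleftrightarrow> (\<forall>k\<in>{..<d} - {i}. x k \<in> {fst c k..<snd c k})"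
    by (simp add: cell_face_def PiE_iff)
  have "x(i := t) \<in> extensional {..<d}"
    using \<open>x \<in> extensional ({..<d} - {i})\<close> assms(1) unfolding extensional_def by auto
  then have box: "x(i := t) \<in> cell_box d c \<longleftrightarrow> (\<forall>k\<in>{..<d}. (x(i := t)) k \<in> {fst c k..<snd c k})"
    by (simp add: cell_box_PiE PiE_iff)
  have "(\<forall>k\<in>{..<d}. Q k) \<longleftrightarrow> Q i \<and> (\<forall>k\<in>{..<d} - {i}. Q k)" for Q using assms(1) by auto
  from this[of "\<lambda>k. (x(i := t)) k \<in> {fst c k..<snd c k}"]
  have "(\<forall>k\<in>{..<d}. (x(i := t)) k \<in> {fst c k..<snd c k}) \<longleftrightarrow>
      t \<in> {fst c i..<snd c i} \<and> (\<forall>k\<in>{..<d} - {i}. (x(i := t)) k \<in> {fst c k..<snd c k})"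
    by (simp only: fun_upd_same)
  also have "(\<forall>k\<in>{..<d} - {i}. (x(i := t)) k \<in> {fst c k..<snd c k})
      \<longleftrightarrow> (\<forall>k\<in>{..<d} - {i}. x k \<in> {fst c k..<snd c k})"
    by (intro ball_cong) auto
  finally show ?thesis unfolding box face by blast
qed

lemma emeasure_cell_face:
  assumes "valid_cell d c" "i < d"
  shows "cell_face d c i \<in> sets (PiM ({..<d} - {i}) (\<lambda>_. unit_law))"
    "ennreal (width c i) * emeasure (PiM ({..<d} - {i}) (\<lambda>_. unit_law)) (cell_face d c i) = ennreal (cell_vol d c)"
proof -
  interpret P: product_prob_space "\<lambda>_::nat. unit_law" "{..<d} - {i}"
    by (intro product_prob_spaceI prob_space_unit_law)
  interpret finite_product_prob_space "\<lambda>_::nat. unit_law" "{..<d} - {i}"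
    by standard simp
  show "cell_face d c i \<in> sets (PiM ({..<d} - {i}) (\<lambda>_. unit_law))"
    unfolding cell_face_def
    using assms by (intro sets_PiM_I_finite interval_in_unit_law) (auto simp: valid_cell_def)
  have "measure (PiM ({..<d} - {i}) (\<lambda>_. unit_law)) (cell_face d c i)
     = (\<Prod>k\<in>{..<d} - {i}. measure unit_law {fst c k..<snd c k})"
    unfolding cell_face_def
    using assms by (intro finite_measure_PiM_emb interval_in_unit_law) (auto simp: valid_cell_def)
  also have "\<dots> = (\<Prod>k\<in>{..<d} - {i}. width c k)" unfolding width_def
    using assms by (intro prod.cong measure_interval_unit_law) (auto simp: valid_cell_def)
  finally have "width c i * measure (PiM ({..<d} - {i}) (\<lambda>_. unit_law)) (cell_face d c i) = cell_vol d c"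
    unfolding cell_vol_def using assms(2) by (simp add: prod.remove)
  then show "ennreal (width c i) * emeasure (PiM ({..<d} - {i}) (\<lambda>_. unit_law)) (cell_face d c i) = ennreal (cell_vol d c)"
    using width_bounds[OF assms] by (simp add: P.P.emeasure_eq_measure flip: ennreal_mult)
qed

lemma nn_integral_unif_cube_coord:
  assumes "i < d" "F \<in> borel_measurable (unif_cube d)"
  shows "(\<integral>\<^sup>+x. F x \<partial>unif_cube d)
    = (\<integral>\<^sup>+x. (\<integral>\<^sup>+t. F (x(i := t)) \<partial>unit_law) \<partial>PiM ({..<d} - {i}) (\<lambda>_. unit_law))"
proof -
  interpret P: product_prob_space "\<lambda>_::nat. unit_law" "{..<d} - {i}"
    by (intro product_prob_spaceI prob_space_unit_law)
  interpret finite_product_prob_space "\<lambda>_::nat. unit_law" "{..<d} - {i}"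
    by standard simp
  show ?thesis
    using assms unfolding unif_cube_insert[OF assms(1)]
    by (intro P.product_nn_integral_insert) auto
qed

lemma measurable_coord_section:
  assumes "i < d" "F \<in> borel_measurable (unif_cube d)" "x \<in> space (PiM ({..<d} - {i}) (\<lambda>_. unit_law))"
  shows "(\<lambda>t. F (x(i := t)) :: ennreal) \<in> borel_measurable unit_law"
proof -
  have "(\<lambda>t. x(i := t)) \<in> measurable unit_law (unif_cube d)"
    unfolding unif_cube_insert[OF assms(1)]
    using assms(3) by (intro measurable_fun_upd[of _ "{..<d} - {i}"]) auto
  then show ?thesis using assms(2) by (rule measurable_compose)
qed

lemma integral_coord_cell_box:
  assumes c: "valid_cell d c" and i: "i < d"
  shows "(\<integral>x. x i * indicator (cell_box d c) x \<partial>unif_cube d) = cell_vol d c * ((fst c i + snd c i) / 2)"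
proof -
  let ?A = "fst c i" let ?B = "snd c i" let ?R = "PiM ({..<d} - {i}) (\<lambda>_::nat. unit_law)"
  interpret prob_space "unif_cube d" by (rule prob_space_unif_cube)
  have AB: "0 \<le> ?A" "?A \<le> ?B" "?B \<le> 1" using c i by (auto simp: valid_cell_def)
  have pos: "0 \<le> x i * indicator (cell_box d c) x" for x
    using AB i by (auto simp: indicator_def mem_cell_box)
  have meas: "(\<lambda>x. x i * indicator (cell_box d c) x) \<in> borel_measurable (unif_cube d)"
    by (intro borel_measurable_times measurable_coord_unif_cube i borel_measurable_indicator sets_cell_box c)
  have 1: "(\<integral>\<^sup>+t. ennreal t * indicator {?A..<?B} t \<partial>unit_law) = ennreal ((?B\<^sup>2 - ?A\<^sup>2) / 2)"
  proof -
    have "(\<integral>\<^sup>+t. ennreal t * indicator {?A..<?B} t \<partial>unit_law)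
        = (\<integral>\<^sup>+t. ennreal t * indicator {?A..<?B} t * indicator {0..<1} t \<partial>lborel)"
      by (rule nn_integral_restrict_space) simp
    also have "\<dots> = (\<integral>\<^sup>+t. ennreal t * indicator {?A..?B} t \<partial>lborel)"
      using AE_lborel_singleton[of ?B] by (intro nn_integral_cong_AE; eventually_elim)
        (use AB in \<open>auto simp: indicator_def\<close>)
    also have "\<dots> = ennreal (?B\<^sup>2 / 2 - ?A\<^sup>2 / 2)"
      using AB by (intro nn_integral_FTC_Icc) (auto intro!: derivative_eq_intros)
    finally show ?thesis by (simp add: diff_divide_distrib)
  qed
  have "(\<integral>\<^sup>+x. ennreal (x i * indicator (cell_box d c) x) \<partial>unif_cube d)
     = (\<integral>\<^sup>+x. (\<integral>\<^sup>+t. ennreal ((x(i := t)) i * indicator (cell_box d c) (x(i := t))) \<partial>unit_law) \<partial>?R)"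
    by (rule nn_integral_unif_cube_coord[OF i]) (use meas in simp)
  also have "\<dots> = (\<integral>\<^sup>+x. ennreal ((?B\<^sup>2 - ?A\<^sup>2) / 2) * indicator (cell_face d c i) x \<partial>?R)"
  proof (rule nn_integral_cong)
    fix x assume x: "x \<in> space ?R"
    have "(\<integral>\<^sup>+t. ennreal ((x(i := t)) i * indicator (cell_box d c) (x(i := t))) \<partial>unit_law)
        = (\<integral>\<^sup>+t. (ennreal t * indicator {?A..<?B} t) * indicator (cell_face d c i) x \<partial>unit_law)"
      by (rule nn_integral_cong) (auto simp: indicator_def upd_mem_cell_box[OF i x])
    also have "\<dots> = (\<integral>\<^sup>+t. ennreal t * indicator {?A..<?B} t \<partial>unit_law) * indicator (cell_face d c i) x"
      using AB by (intro nn_integral_multc borel_measurable_times_ennreal borel_measurable_indicator interval_in_unit_law)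
        (auto intro!: measurable_restrict_space1)
    finally show "(\<integral>\<^sup>+t. ennreal ((x(i := t)) i * indicator (cell_box d c) (x(i := t))) \<partial>unit_law)
        = ennreal ((?B\<^sup>2 - ?A\<^sup>2) / 2) * indicator (cell_face d c i) x" unfolding 1 .
  qed
  also have "\<dots> = ennreal ((?B\<^sup>2 - ?A\<^sup>2) / 2) * emeasure ?R (cell_face d c i)"
    by (rule nn_integral_cmult_indicator[OF emeasure_cell_face(1)[OF c i]])
  also have "(?B\<^sup>2 - ?A\<^sup>2) / 2 = (?A + ?B) / 2 * width c i"
    by (simp add: width_def power2_eq_square field_simps)
  also have "ennreal ((?A + ?B) / 2 * width c i) * emeasure ?R (cell_face d c i)
      = ennreal ((?A + ?B) / 2) * (ennreal (width c i) * emeasure ?R (cell_face d c i))"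
    using AB width_bounds[OF c i] by (subst ennreal_mult) (auto simp: mult.assoc)
  also have "\<dots> = ennreal (cell_vol d c * ((?A + ?B) / 2))"
    unfolding emeasure_cell_face(2)[OF c i]
    using AB cell_vol_bounds[OF c] by (subst ennreal_mult[symmetric]) (auto simp: mult.commute)
  finally show ?thesis
    using pos AB cell_vol_bounds[OF c]
    by (intro integral_eq_nn_integral[THEN trans] meas) auto
qed

text \<open>
  The points \<open>t\<close> and \<open>t + (B - A) / 2\<close> of the two halves of the interval are paired: no constant \<open>M\<close> is close to
  both values of a function that is nearly affine with slope \<open>g\<close>.
\<close>

lemma interval_variation_lower:
  fixes h :: "real \<Rightarrow> real"
  assumes AB: "0 \<le> A" "A \<le> B" "B \<le> 1"
    and meas: "(\<lambda>t. ennreal ((M - h t)\<^sup>2)) \<in> borel_measurable unit_law"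
    and lin: "\<And>t u. t \<in> {A..<B} \<Longrightarrow> u \<in> {A..<B} \<Longrightarrow> \<bar>h t - h u - g * (t - u)\<bar> \<le> r"
  shows "ennreal ((B - A) * (g\<^sup>2 * (B - A)\<^sup>2 / 32 - r\<^sup>2 / 4))
    \<le> (\<integral>\<^sup>+t. ennreal ((M - h t)\<^sup>2) * indicator {A..<B} t \<partial>unit_law)"
proof -
  define e where "e = (B - A) / 2"
  define \<phi> where "\<phi> = (\<lambda>t. ennreal ((M - h t)\<^sup>2) * indicator {0..<1} t)"
  define K where "K = (g\<^sup>2 * e\<^sup>2 / 2 - r\<^sup>2) / 2"
  have e: "0 \<le> e" "A + e + e = B" using AB by (auto simp: e_def)
  have \<phi>: "\<phi> \<in> borel_measurable lborel"
    using meas unfolding \<phi>_def by (subst (asm) borel_measurable_restrict_space_iff_ennreal) auto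
  have K: "K \<le> (M - h t)\<^sup>2 + (M - h (t + e))\<^sup>2" if t: "t \<in> {A..<A + e}" for t
  proof -
    define q where "q = h (t + e) - h t - g * e"
    have "\<bar>q\<bar> \<le> r" using lin[of "t + e" t] t e by (auto simp: q_def)
    then have q: "q\<^sup>2 \<le> r\<^sup>2" using abs_le_square_iff[of q r] by (smt (verit) abs_ge_self)
    \<comment> \<open>\<open>(a + q)^2 \<ge> a^2 / 2 - q^2\<close>\<close>
    have "K \<le> (g * e + q)\<^sup>2 / 2"
    proof -
      have "0 \<le> (g * e + 2 * q)\<^sup>2" by simp
      then show ?thesis using q by (simp add: K_def power2_eq_square algebra_simps)
    qed
    also have "g * e + q = (M - h t) - (M - h (t + e))" by (simp add: q_def)
    also have "(\<dots>)\<^sup>2 / 2 \<le> (M - h t)\<^sup>2 + (M - h (t + e))\<^sup>2"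
    proof -
      have "(a - b)\<^sup>2 / 2 \<le> a\<^sup>2 + b\<^sup>2" for a b :: real
        using zero_le_power2[of "a + b"] by (simp add: power2_eq_square algebra_simps)
      then show ?thesis .
    qed
    finally show ?thesis .
  qed
  have shift: "(\<integral>\<^sup>+t. \<phi> t * indicator {A + e..<B} t \<partial>lborel) = (\<integral>\<^sup>+t. \<phi> (t + e) * indicator {A..<A + e} t \<partial>lborel)"
  proof -
    have "(\<integral>\<^sup>+t. \<phi> t * indicator {A + e..<B} t \<partial>lborel)
        = ennreal \<bar>1\<bar> * (\<integral>\<^sup>+t. \<phi> (e + 1 * t) * indicator {A + e..<B} (e + 1 * t) \<partial>lborel)"
      using \<phi> by (intro nn_integral_real_affine) auto
    also have "\<dots> = (\<integral>\<^sup>+t. \<phi> (t + e) * indicator {A..<A + e} t \<partial>lborel)"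
      using e by (simp, intro nn_integral_cong) (auto simp: indicator_def add.commute)
    finally show ?thesis .
  qed
  have me: "(\<lambda>t. \<phi> (t + e)) \<in> borel_measurable lborel"
    using measurable_compose[of "\<lambda>t. t + e" lborel borel \<phi> borel] \<phi> by simp
  have "(B - A) * (g\<^sup>2 * (B - A)\<^sup>2 / 32 - r\<^sup>2 / 4) = e * K"
    by (simp add: e_def K_def power2_eq_square field_simps)
  then have "ennreal ((B - A) * (g\<^sup>2 * (B - A)\<^sup>2 / 32 - r\<^sup>2 / 4)) = ennreal (e * K)"
    by simp
  also have "\<dots> = (\<integral>\<^sup>+t. ennreal K * indicator {A..<A + e} t \<partial>lborel)"
    using e ennreal_mult'[OF e(1), of K] by (subst nn_integral_cmult_indicator) (auto simp: mult.commute)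
  also have "\<dots> \<le> (\<integral>\<^sup>+t. \<phi> t * indicator {A..<A + e} t + \<phi> (t + e) * indicator {A..<A + e} t \<partial>lborel)"
  proof (rule nn_integral_mono)
    fix t :: real
    have "t \<in> {0..<1} \<and> t + e \<in> {0..<1}" if "t \<in> {A..<A + e}" using that AB e by auto
    then show "ennreal K * indicator {A..<A + e} t
       \<le> \<phi> t * indicator {A..<A + e} t + \<phi> (t + e) * indicator {A..<A + e} t"
      using K[of t] by (cases "t \<in> {A..<A + e}") (auto simp: \<phi>_def ennreal_leI simp flip: ennreal_plus)
  qed
  also have "\<dots> = (\<integral>\<^sup>+t. \<phi> t * indicator {A..<A + e} t \<partial>lborel) + (\<integral>\<^sup>+t. \<phi> t * indicator {A + e..<B} t \<partial>lborel)"
    unfolding shift using \<phi> me by (intro nn_integral_add) auto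
  also have "\<dots> = (\<integral>\<^sup>+t. \<phi> t * indicator {A..<A + e} t + \<phi> t * indicator {A + e..<B} t \<partial>lborel)"
    using \<phi> by (intro nn_integral_add[symmetric]) auto
  also have "\<dots> = (\<integral>\<^sup>+t. ennreal ((M - h t)\<^sup>2) * indicator {A..<B} t * indicator {0..<1} t \<partial>lborel)"
    using e by (intro nn_integral_cong) (auto simp: \<phi>_def indicator_def)
  also have "\<dots> = (\<integral>\<^sup>+t. ennreal ((M - h t)\<^sup>2) * indicator {A..<B} t \<partial>unit_law)"
    by (rule nn_integral_restrict_space[symmetric]) simp
  finally show ?thesis .
qed

lemma cell_variation_lower:
  assumes c: "valid_cell d c" and i: "i < d" and s: "s \<in> borel_measurable (unif_cube d)"
    and lin: "\<And>x t. x \<in> cell_box d c \<Longrightarrow> x(i := t) \<in> cell_box d c \<Longrightarrow> \<bar>s (x(i := t)) - s x - g * (t - x i)\<bar> \<le> r"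
  shows "ennreal (cell_vol d c * (g\<^sup>2 * (width c i)\<^sup>2 / 32 - r\<^sup>2 / 4))
    \<le> (\<integral>\<^sup>+x. ennreal ((M - s x)\<^sup>2) * indicator (cell_box d c) x \<partial>unif_cube d)"
proof -
  let ?A = "fst c i" let ?B = "snd c i" let ?R = "PiM ({..<d} - {i}) (\<lambda>_::nat. unit_law)"
  let ?K = "g\<^sup>2 * (width c i)\<^sup>2 / 32 - r\<^sup>2 / 4"
  have AB: "0 \<le> ?A" "?A \<le> ?B" "?B \<le> 1" using c i by (auto simp: valid_cell_def)
  have F: "(\<lambda>x. ennreal ((M - s x)\<^sup>2)) \<in> borel_measurable (unif_cube d)"
    using s by simp
  have "ennreal (cell_vol d c * ?K) = ennreal ?K * (ennreal (width c i) * emeasure ?R (cell_face d c i))"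
    unfolding emeasure_cell_face(2)[OF c i] using cell_vol_bounds[OF c]
    by (simp add: ennreal_mult' mult.commute)
  also have "\<dots> = (\<integral>\<^sup>+x. ennreal (width c i * ?K) * indicator (cell_face d c i) x \<partial>?R)"
    using width_bounds[OF c i]
    by (subst nn_integral_cmult_indicator[OF emeasure_cell_face(1)[OF c i]])
       (simp add: ennreal_mult' ac_simps)
  also have "\<dots> \<le> (\<integral>\<^sup>+x. (\<integral>\<^sup>+t. ennreal ((M - s (x(i := t)))\<^sup>2) * indicator (cell_box d c) (x(i := t)) \<partial>unit_law) \<partial>?R)"
  proof (rule nn_integral_mono)
    fix x assume x: "x \<in> space ?R"
    show "ennreal (width c i * ?K) * indicator (cell_face d c i) x
      \<le> (\<integral>\<^sup>+t. ennreal ((M - s (x(i := t)))\<^sup>2) * indicator (cell_box d c) (x(i := t)) \<partial>unit_law)"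
    proof (cases "x \<in> cell_face d c i")
      case True
      have "ennreal (width c i * ?K)
        \<le> (\<integral>\<^sup>+t. ennreal ((M - s (x(i := t)))\<^sup>2) * indicator {?A..<?B} t \<partial>unit_law)"
        unfolding width_def
      proof (rule interval_variation_lower[OF AB])
        show "(\<lambda>t. ennreal ((M - s (x(i := t)))\<^sup>2)) \<in> borel_measurable unit_law"
          by (rule measurable_coord_section[OF i F x])
        fix t u assume "t \<in> {?A..<?B}" "u \<in> {?A..<?B}"
        then show "\<bar>s (x(i := t)) - s (x(i := u)) - g * (t - u)\<bar> \<le> r"
          using lin[of "x(i := u)" t] upd_mem_cell_box[OF i x] True by simp
      qed
      also have "\<dots> = (\<integral>\<^sup>+t. ennreal ((M - s (x(i := t)))\<^sup>2) * indicator (cell_box d c) (x(i := t)) \<partial>unit_law)"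
        by (rule nn_integral_cong) (auto simp: indicator_def upd_mem_cell_box[OF i x] True)
      finally show ?thesis using True by simp
    qed simp
  qed
  also have "\<dots> = (\<integral>\<^sup>+x. ennreal ((M - s x)\<^sup>2) * indicator (cell_box d c) x \<partial>unif_cube d)"
    by (rule nn_integral_unif_cube_coord[OF i, symmetric])
       (intro borel_measurable_times_ennreal F borel_measurable_indicator sets_cell_box c)
  finally show ?thesis .
qed

section \<open>Smooth regression functions\<close>


lemma edist_sq: "(edist d x t)\<^sup>2 = (\<Sum>i<d. (t i - x i)\<^sup>2)"
  by (simp add: edist_def L2_set_def sum_nonneg)

lemma cube_mem: "x \<in> cube d \<longleftrightarrow> x \<in> extensional {..<d} \<and> (\<forall>i<d. 0 \<le> x i \<and> x i < 1)"
  using mem_cell_box[of x d root_cell] by (simp add: cell_box_def)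

lemma cube_diff: "x \<in> cube d \<Longrightarrow> t \<in> cube d \<Longrightarrow> i < d \<Longrightarrow> \<bar>t i - x i\<bar> \<le> 1"
  unfolding cube_mem by (smt (verit))

lemma cube_upd: "x \<in> cube d \<Longrightarrow> i < d \<Longrightarrow> 0 \<le> a \<Longrightarrow> a < 1 \<Longrightarrow> x(i := a) \<in> cube d"
  unfolding cube_mem extensional_def by auto

text \<open>
  From each point of the cube one can move by up to one half in one of the two directions of an axis.
\<close>

lemma cube_step:
  assumes "x \<in> cube d" "i < d" "0 \<le> h" "h \<le> 1 / 2"
  obtains e where "\<bar>e\<bar> = h" "x(i := x i + e) \<in> cube d"
proof (cases "x i < 1 / 2")
  case True
  then have "x(i := x i + h) \<in> cube d" using assms by (intro cube_upd) (auto simp: cube_mem)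
  then show ?thesis using that[of h] assms by simp
next
  case False
  then have "x(i := x i + (- h)) \<in> cube d" using assms by (intro cube_upd) (auto simp: cube_mem intro: le_less_trans)
  then show ?thesis using that[of "- h"] assms by simp
qed

lemma sum_upd_diff: "i < d \<Longrightarrow> (\<Sum>k<d. f k * ((x(i := x i + e)) k - x k)) = f i * e" for f x :: "nat \<Rightarrow> real"
proof -
  assume i: "i < d"
  have "(\<Sum>k<d. f k * ((x(i := x i + e)) k - x k)) = (\<Sum>k<d. if k = i then f i * e else 0)"
    by (intro sum.cong) auto
  then show ?thesis using i by simp
qed

lemma sum_upd_sq: "i < d \<Longrightarrow> (\<Sum>k<d. ((x(i := x i + e)) k - x k)\<^sup>2) = (e::real)\<^sup>2" for x :: "nat \<Rightarrow> real"
  using sum_upd_diff[of i d "\<lambda>k. (x(i := x i + e)) k - x k" x e] by (simp add: power2_eq_square)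

text \<open>
  A gradient field with a uniform quadratic Taylor remainder. Differentiability enters only through this
  bound.
\<close>

definition taylor_bound :: "nat \<Rightarrow> ((nat \<Rightarrow> real) \<Rightarrow> real) \<Rightarrow> ((nat \<Rightarrow> real) \<Rightarrow> nat \<Rightarrow> real) \<Rightarrow> real \<Rightarrow> bool" where
  "taylor_bound d s grad C \<longleftrightarrow> 0 < C \<and> (\<forall>t\<in>cube d. \<forall>x\<in>cube d.
     \<bar>s t - s x - (\<Sum>i<d. grad x i * (t i - x i))\<bar> \<le> C * (\<Sum>i<d. (t i - x i)\<^sup>2))"

lemma taylor_boundD:
  assumes "taylor_bound d s grad C" "t \<in> cube d" "x \<in> cube d"
  shows "\<bar>s t - s x - (\<Sum>i<d. grad x i * (t i - x i))\<bar> \<le> C * (\<Sum>i<d. (t i - x i)\<^sup>2)"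
  using assms unfolding taylor_bound_def by blast

lemma smooth_taylor:
  assumes "0 < C2" "smooth_regression_function d s C2"
  obtains grad where "taylor_bound d s grad C2"
  using assms unfolding smooth_regression_function_def taylor_bound_def edist_sq by blast

lemma taylor_bounded:
  assumes T: "taylor_bound d s grad C"
  obtains K where "0 \<le> K" "\<And>x. x \<in> cube d \<Longrightarrow> \<bar>s x\<bar> \<le> K"
proof
  define x0 :: "nat \<Rightarrow> real" where "x0 = (\<lambda>i\<in>{..<d}. 1 / 2)"
  have x0: "x0 \<in> cube d" by (auto simp: cube_mem x0_def)
  have C: "0 < C" using T by (simp add: taylor_bound_def)
  let ?K = "\<bar>s x0\<bar> + (\<Sum>i<d. \<bar>grad x0 i\<bar>) + C * real d"
  show "0 \<le> ?K" using C by (auto intro!: add_nonneg_nonneg sum_nonneg)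
  fix x assume x: "x \<in> cube d"
  have "\<bar>\<Sum>i<d. grad x0 i * (x i - x0 i)\<bar> \<le> (\<Sum>i<d. \<bar>grad x0 i\<bar> * 1)"
  proof (intro order_trans[OF sum_abs] sum_mono)
    fix i assume "i \<in> {..<d}"
    then show "\<bar>grad x0 i * (x i - x0 i)\<bar> \<le> \<bar>grad x0 i\<bar> * 1"
      unfolding abs_mult by (intro mult_left_mono cube_diff[OF x0 x]) auto
  qed
  moreover have "(\<Sum>i<d. (x i - x0 i)\<^sup>2) \<le> (\<Sum>i<d. 1)"
    using cube_diff[OF x0 x] by (intro sum_mono) (auto simp: abs_square_le_1)
  then have "C * (\<Sum>i<d. (x i - x0 i)\<^sup>2) \<le> C * real d" using C by (intro mult_left_mono) auto
  ultimately show "\<bar>s x\<bar> \<le> ?K" using taylor_boundD[OF T x x0] by simp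
qed

text \<open>
  A bounded function with bounded Taylor remainders has a bounded gradient: otherwise a step of length one
  half would change it too much.
\<close>

lemma taylor_gradient_bounded:
  assumes T: "taylor_bound d s grad C"
  obtains G where "0 \<le> G" "\<And>x i. x \<in> cube d \<Longrightarrow> i < d \<Longrightarrow> \<bar>grad x i\<bar> \<le> G"
proof -
  have C: "0 < C" using T by (simp add: taylor_bound_def)
  obtain K where K: "0 \<le> K" "\<And>x. x \<in> cube d \<Longrightarrow> \<bar>s x\<bar> \<le> K" using taylor_bounded[OF T] by blast
  show ?thesis
  proof (rule that)
    show "0 \<le> 2 * (2 * K + C / 4)" using C K by simp
    fix x i assume x: "x \<in> cube d" and i: "i < d"
    obtain e where e: "\<bar>e\<bar> = 1 / 2" "x(i := x i + e) \<in> cube d"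
      using cube_step[OF x i, of "1/2"] by auto
    have "e\<^sup>2 = (1 / 2)\<^sup>2" unfolding e(1)[symmetric] by simp
    then have e2: "e\<^sup>2 = 1 / 4" by (simp add: power_divide)
    then have "\<bar>s (x(i := x i + e)) - s x - grad x i * e\<bar> \<le> C / 4"
      using taylor_boundD[OF T e(2) x] unfolding sum_upd_diff[OF i] sum_upd_sq[OF i] e2
      by simp
    then have "\<bar>grad x i * e\<bar> \<le> 2 * K + C / 4" using K(2)[OF x] K(2)[OF e(2)] by linarith
    then show "\<bar>grad x i\<bar> \<le> 2 * (2 * K + C / 4)" using e(1) by (simp add: abs_mult)
  qed
qed

lemma taylor_lipschitz:
  assumes T: "taylor_bound d s grad C"
  obtains L where "0 \<le> L" "\<And>x t. x \<in> cube d \<Longrightarrow> t \<in> cube d \<Longrightarrow> \<bar>s t - s x\<bar> \<le> L * (\<Sum>i<d. \<bar>t i - x i\<bar>)"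
proof -
  have C: "0 < C" using T by (simp add: taylor_bound_def)
  obtain G where G: "0 \<le> G" "\<And>x i. x \<in> cube d \<Longrightarrow> i < d \<Longrightarrow> \<bar>grad x i\<bar> \<le> G"
    using taylor_gradient_bounded[OF T] by blast
  show ?thesis
  proof (rule that)
    show "0 \<le> G + C" using G C by simp
    fix x t assume x: "x \<in> cube d" and t: "t \<in> cube d"
    have "\<bar>\<Sum>i<d. grad x i * (t i - x i)\<bar> \<le> (\<Sum>i<d. G * \<bar>t i - x i\<bar>)"
      using G(2)[OF x] by (intro order_trans[OF sum_abs] sum_mono) (auto simp: abs_mult intro!: mult_right_mono)
    moreover have "(\<Sum>i<d. (t i - x i)\<^sup>2) \<le> (\<Sum>i<d. \<bar>t i - x i\<bar>)"
    proof (rule sum_mono)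
      fix i assume "i \<in> {..<d}"
      then have "\<bar>t i - x i\<bar> \<le> 1" using cube_diff[OF x t] by simp
      then have "\<bar>t i - x i\<bar> * \<bar>t i - x i\<bar> \<le> 1 * \<bar>t i - x i\<bar>" by (intro mult_right_mono) auto
      then show "(t i - x i)\<^sup>2 \<le> \<bar>t i - x i\<bar>" by (simp add: power2_eq_square)
    qed
    then have "C * (\<Sum>i<d. (t i - x i)\<^sup>2) \<le> C * (\<Sum>i<d. \<bar>t i - x i\<bar>)" using C by simp
    ultimately show "\<bar>s t - s x\<bar> \<le> (G + C) * (\<Sum>i<d. \<bar>t i - x i\<bar>)"
      using taylor_boundD[OF T t x] by (simp add: distrib_right flip: sum_distrib_left)
  qed
qed

text \<open>
  The function is the limit of its discretisations, which are constant on the cells of a regular grid.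
\<close>

lemma lipschitz_measurable_unif_cube:
  assumes L: "\<And>x t. x \<in> cube d \<Longrightarrow> t \<in> cube d \<Longrightarrow> \<bar>s t - s x\<bar> \<le> L * (\<Sum>i<d. \<bar>t i - x i\<bar>)" and "0 \<le> L"
  shows "s \<in> borel_measurable (unif_cube d)"
proof (rule borel_measurable_LIMSEQ_real)
  define pt :: "nat \<Rightarrow> (nat \<Rightarrow> nat) \<Rightarrow> nat \<Rightarrow> real" where "pt k a = (\<lambda>i\<in>{..<d}. real (a i) / real (Suc k))" for k a
  define c :: "nat \<Rightarrow> (nat \<Rightarrow> nat) \<Rightarrow> cell" where
    "c k a = ((\<lambda>i. real (a i) / real (Suc k)), (\<lambda>i. (real (a i) + 1) / real (Suc k)))" for k a
  define A where "A k = (\<Pi>\<^sub>E i\<in>{..<d}. {..k})" for k :: nat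
  define S where "S k x = (\<Sum>a\<in>A k. s (pt k a) * indicator (cell_box d (c k a)) x)" for k x
  have valid: "valid_cell d (c k a)" if "a \<in> A k" for k a
  proof -
    have "a i \<le> k" if "i < d" for i using \<open>a \<in> A k\<close> that by (auto simp: A_def)
    then show ?thesis by (auto simp: valid_cell_def c_def divide_simps)
  qed
  show "S k \<in> borel_measurable (unif_cube d)" for k
    unfolding S_def using valid sets_cell_box
    by (intro borel_measurable_sum borel_measurable_times borel_measurable_const borel_measurable_indicator) blast
  fix x assume "x \<in> space (unif_cube d)"
  then have x: "x \<in> cube d" by (simp add: space_unif_cube)
  have bd: "\<bar>S k x - s x\<bar> \<le> L * real d * (1 / real (Suc k))" for k
  proof -
    define b where "b = (\<lambda>i\<in>{..<d}. nat \<lfloor>real (Suc k) * x i\<rfloor>)"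
    have b: "real (b i) \<le> real (Suc k) * x i" "real (Suc k) * x i < real (b i) + 1" "b i \<le> k" if "i < d" for i
    proof -
      have x01: "0 \<le> x i" "x i < 1" using x that by (auto simp: cube_mem)
      then have *: "0 \<le> \<lfloor>real (Suc k) * x i\<rfloor>" by simp
      then have bi: "real (b i) = of_int \<lfloor>real (Suc k) * x i\<rfloor>" using that by (simp add: b_def)
      show 1: "real (b i) \<le> real (Suc k) * x i" "real (Suc k) * x i < real (b i) + 1"
        unfolding bi by linarith+
      have "real (Suc k) * x i < real (Suc k) * 1" using x01 by (intro mult_strict_left_mono) auto
      with 1(1) have "real (b i) < real (Suc k)" by (simp only: mult_1_right)
      then show "b i \<le> k" by linarith
    qed
    have bA: "b \<in> A k" using b(3) by (auto simp: A_def b_def)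
    have box: "x \<in> cell_box d (c k b)"
      unfolding mem_cell_box c_def using x b by (auto simp: cube_mem divide_simps mult.commute)
    have uniq: "a = b" if "a \<in> A k" "x \<in> cell_box d (c k a)" for a
    proof (rule PiE_ext[OF that(1)[unfolded A_def] bA[unfolded A_def]])
      fix i assume "i \<in> {..<d}"
      then have i: "i < d" by simp
      then have "real (a i) \<le> real (Suc k) * x i" "real (Suc k) * x i < real (a i) + 1"
        using that(2) by (auto simp: mem_cell_box c_def divide_simps mult.commute)
      with b(1,2)[OF i] show "a i = b i" by linarith
    qed
    have "indicator (cell_box d (c k a)) x = (if a = b then 1 else 0 :: real)" if "a \<in> A k" for a
    proof (cases "a = b")
      case False
      then have "x \<notin> cell_box d (c k a)" using uniq[OF that] by blast
      then show ?thesis using False by simp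
    qed (simp add: box)
    then have "S k x = (\<Sum>a\<in>A k. if a = b then s (pt k a) else 0)"
      unfolding S_def by (intro sum.cong) simp_all
    also have "\<dots> = s (pt k b)" using bA sum.delta[of "A k" b "\<lambda>a. s (pt k a)"] by (simp add: A_def finite_PiE)
    finally have S: "S k x = s (pt k b)" .
    have p: "pt k b \<in> cube d" unfolding cube_mem pt_def using b(3) by (auto simp: divide_simps) force
    have "\<bar>s (pt k b) - s x\<bar> \<le> L * (\<Sum>i<d. \<bar>pt k b i - x i\<bar>)" by (rule L[OF x p])
    also have "\<dots> \<le> L * (\<Sum>i<d. 1 / real (Suc k))"
    proof (intro mult_left_mono sum_mono \<open>0 \<le> L\<close>)
      fix i assume "i \<in> {..<d}"
      then have i: "i < d" by simp
      have "real (b i) / real (Suc k) \<le> x i" "x i < (real (b i) + 1) / real (Suc k)"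
        using b(1,2)[OF i] by (auto simp: divide_simps mult.commute)
      then show "\<bar>pt k b i - x i\<bar> \<le> 1 / real (Suc k)" using i by (auto simp: pt_def add_divide_distrib)
    qed
    finally show ?thesis by (simp add: S)
  qed
  have "(\<lambda>k. L * real d * (1 / real (Suc k))) \<longlonglongrightarrow> L * real d * 0"
    by (intro tendsto_intros LIMSEQ_inverse_real_of_nat[unfolded inverse_eq_divide])
  then have lim: "(\<lambda>k. L * real d * (1 / real (Suc k))) \<longlonglongrightarrow> 0" by (simp only: mult_zero_right)
  have "(\<lambda>k. S k x - s x) \<longlonglongrightarrow> 0"
  proof (rule Lim_null_comparison[OF always_eventually lim], rule allI)
    show "norm (S k x - s x) \<le> L * real d * (1 / real (Suc k))" for k
      using bd[of k] by (simp only: real_norm_def)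
  qed
  then show "(\<lambda>k. S k x) \<longlonglongrightarrow> s x" by (simp add: LIM_zero_iff)
qed

lemma taylor_measurable:
  assumes "taylor_bound d s grad C" shows "s \<in> borel_measurable (unif_cube d)"
  by (rule taylor_lipschitz[OF assms], rule lipschitz_measurable_unif_cube) blast+

text \<open>
  With a vanishing gradient, the increments are quadratically small; adding up \<open>N\<close> of them along a segment
  shows that the function is constant.
\<close>

lemma taylor_gradient_nonzero:
  assumes T: "taylor_bound d s grad C" and nc: "\<not> s constant_on cube d"
  obtains x i where "x \<in> cube d" "i < d" "grad x i \<noteq> 0"
proof -
  have C: "0 < C" using T by (simp add: taylor_bound_def)
  have False if z: "\<And>x i. x \<in> cube d \<Longrightarrow> i < d \<Longrightarrow> grad x i = 0"
  proof -
    have sq: "\<bar>s t - s x\<bar> \<le> C * (\<Sum>i<d. (t i - x i)\<^sup>2)" if "x \<in> cube d" "t \<in> cube d" for x t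
      using taylor_boundD[OF T that(2,1)] z[OF that(1)] by simp
    have "s t = s x" if x: "x \<in> cube d" and t: "t \<in> cube d" for x t
    proof -
      let ?Q = "C * (\<Sum>i<d. (t i - x i)\<^sup>2)"
      have "\<bar>s t - s x\<bar> \<le> ?Q * (1 / real (Suc n))" for n
      proof -
        let ?N = "real (Suc n)"
        define y where "y k = (\<lambda>i\<in>{..<d}. (1 - real k / ?N) * x i + real k / ?N * t i)" for k
        have y: "y k \<in> cube d" if "k \<le> Suc n" for k
          unfolding cube_mem
        proof (intro conjI allI impI)
          show "y k \<in> extensional {..<d}" by (simp add: y_def)
          fix i assume i: "i < d"
          have l: "0 \<le> real k / ?N" "real k / ?N \<le> 1" using that by auto
          have "0 \<le> x i" "x i < 1" "0 \<le> t i" "t i < 1" using x t i by (auto simp: cube_mem)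
          then show "0 \<le> y k i" using i l by (simp add: y_def)
          show "y k i < 1"
            using convex_bound_lt[of "x i" 1 "t i" "1 - real k / ?N" "real k / ?N"] i l \<open>x i < 1\<close> \<open>t i < 1\<close>
            by (simp add: y_def)
        qed
        have "\<bar>s (y m) - s (y 0)\<bar> \<le> real m * (?Q / ?N\<^sup>2)" if "m \<le> Suc n" for m
          using that
        proof (induction m)
          case (Suc m)
          have "(\<Sum>i<d. (y (Suc m) i - y m i)\<^sup>2) = (\<Sum>i<d. (t i - x i)\<^sup>2 / ?N\<^sup>2)"
          proof (rule sum.cong[OF refl])
            fix i assume "i \<in> {..<d}"
            moreover have "real (Suc m) / ?N = real m / ?N + 1 / ?N" by (simp add: add_divide_distrib)
            moreover have "(1 - (a + b)) * x i + (a + b) * t i - ((1 - a) * x i + a * t i) = b * (t i - x i)" for a b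
              by (simp add: algebra_simps)
            ultimately have "y (Suc m) i - y m i = (t i - x i) / ?N"
              by (simp only: y_def lessThan_iff restrict_apply' if_True) simp
            then show "(y (Suc m) i - y m i)\<^sup>2 = (t i - x i)\<^sup>2 / ?N\<^sup>2" by (simp only: power_divide)
          qed
          then have "\<bar>s (y (Suc m)) - s (y m)\<bar> \<le> ?Q / ?N\<^sup>2"
            using sq[OF y y, of m "Suc m"] Suc.prems by (simp flip: sum_divide_distrib)
          moreover have "\<bar>s (y m) - s (y 0)\<bar> \<le> real m * (?Q / ?N\<^sup>2)" using Suc by simp
          ultimately have "\<bar>s (y (Suc m)) - s (y 0)\<bar> \<le> real m * (?Q / ?N\<^sup>2) + ?Q / ?N\<^sup>2" by linarith
          also have "\<dots> = real (Suc m) * (?Q / ?N\<^sup>2)" by (simp only: of_nat_Suc distrib_right mult_1_left add.commute)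
          finally show ?case .
        qed simp
        from this[of "Suc n"] have "\<bar>s (y (Suc n)) - s (y 0)\<bar> \<le> ?N * (?Q / ?N\<^sup>2)" by simp
        also have "?N * (?Q / ?N\<^sup>2) = ?Q * (1 / ?N)" by (simp add: power2_eq_square del: of_nat_Suc)
        also have "y (Suc n) = t" using t by (auto simp: y_def cube_mem fun_eq_iff extensional_def simp del: of_nat_Suc)
        also have "y 0 = x" using x by (auto simp: y_def cube_mem fun_eq_iff extensional_def)
        finally show ?thesis .
      qed
      moreover have "(\<lambda>n. ?Q * (1 / real (Suc n))) \<longlonglongrightarrow> ?Q * 0"
        by (intro tendsto_intros LIMSEQ_inverse_real_of_nat[unfolded inverse_eq_divide])
      ultimately have "\<bar>s t - s x\<bar> \<le> ?Q * 0" by (intro LIMSEQ_le_const) auto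
      then show ?thesis by simp
    qed
    then show False using nc unfolding constant_on_def by blast
  qed
  then show ?thesis using that by blast
qed

text \<open>
  Expanding \<open>s\<close> at \<open>x\<close> and at \<open>y\<close> and evaluating at a common third point \<open>y + q e_i\<close> compares the gradients.
\<close>

lemma taylor_gradient_continuous:
  assumes T: "taylor_bound d s grad C" and x: "x \<in> cube d" and i: "i < d" and e: "0 < e"
  obtains r where "0 < r" "\<And>y. y \<in> cube d \<Longrightarrow> (\<And>k. k < d \<Longrightarrow> \<bar>y k - x k\<bar> \<le> r) \<Longrightarrow> \<bar>grad y i - grad x i\<bar> \<le> e"
proof -
  have C: "0 < C" using T by (simp add: taylor_bound_def)
  define h where "h = min (1 / 2) (e / (6 * C))"
  have h: "0 < h" "h \<le> 1 / 2" "6 * C * h \<le> e" using e C by (auto simp: h_def min_def field_simps)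
  have d: "0 < real d" using i by simp
  show ?thesis
  proof (rule that)
    show "0 < h / real d" using h d by simp
    fix y assume y: "y \<in> cube d" and close: "\<And>k. k < d \<Longrightarrow> \<bar>y k - x k\<bar> \<le> h / real d"
    let ?S = "\<lambda>u v. \<Sum>k<d. (u k - v k)\<^sup>2 :: real"
    obtain q where q: "\<bar>q\<bar> = h" and t: "y(i := y i + q) \<in> cube d" using cube_step[OF y i, of h] h by auto
    let ?t = "y(i := y i + q)"
    have "q\<^sup>2 = h\<^sup>2" using q by (metis power2_abs)
    have hd: "h / real d \<le> h" using h i by (simp add: divide_le_eq)
    have Syx: "?S y x \<le> h\<^sup>2"
    proof -
      have "?S y x \<le> (\<Sum>k<d. h * (h / real d))"
      proof (rule sum_mono)
        fix k assume "k \<in> {..<d}"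
        then have "\<bar>y k - x k\<bar> \<le> h / real d" using close by simp
        then have "\<bar>y k - x k\<bar> * \<bar>y k - x k\<bar> \<le> h * (h / real d)" using hd h by (intro mult_mono) auto
        then show "(y k - x k)\<^sup>2 \<le> h * (h / real d)" by (simp add: power2_eq_square)
      qed
      then show ?thesis using d by (simp add: power2_eq_square)
    qed
    have Sty: "?S ?t y = h\<^sup>2" unfolding sum_upd_sq[OF i] by fact
    have Stx: "?S ?t x \<le> 2 * ?S ?t y + 2 * ?S y x"
    proof -
      have "(a - c)\<^sup>2 \<le> 2 * (a - b)\<^sup>2 + 2 * (b - c)\<^sup>2" for a b c :: real
        using zero_le_power2[of "(a - b) - (b - c)"] by (simp add: power2_eq_square algebra_simps)
      then have "?S ?t x \<le> (\<Sum>k<d. 2 * (?t k - y k)\<^sup>2 + 2 * (y k - x k)\<^sup>2)" by (intro sum_mono) blast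
      then show ?thesis by (simp add: sum.distrib sum_distrib_left)
    qed
    have lin: "(\<Sum>k<d. grad x k * (?t k - x k)) = (\<Sum>k<d. grad x k * (y k - x k)) + grad x i * q"
    proof -
      have "(\<Sum>k<d. grad x k * (?t k - x k)) = (\<Sum>k<d. grad x k * (y k - x k) + grad x k * (?t k - y k))"
        by (intro sum.cong) (auto simp: algebra_simps)
      then show ?thesis by (simp only: sum.distrib sum_upd_diff[OF i])
    qed
    have 1: "\<bar>s ?t - s x - (\<Sum>k<d. grad x k * (?t k - x k))\<bar> \<le> C * ?S ?t x" by (rule taylor_boundD[OF T t x])
    have 2: "\<bar>s ?t - s y - grad y i * q\<bar> \<le> C * ?S ?t y"
      using taylor_boundD[OF T t y] unfolding sum_upd_diff[OF i] .
    have 3: "\<bar>s y - s x - (\<Sum>k<d. grad x k * (y k - x k))\<bar> \<le> C * ?S y x" by (rule taylor_boundD[OF T y x])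
    have "\<bar>grad y i * q - grad x i * q\<bar> \<le> C * ?S ?t x + C * ?S ?t y + C * ?S y x"
      using 1 2 3 unfolding lin by linarith
    also have "\<dots> = C * (?S ?t x + ?S ?t y + ?S y x)" by (simp add: distrib_left)
    also have "\<dots> \<le> C * (6 * h\<^sup>2)" using Stx Sty Syx C by (intro mult_left_mono) auto
    also have "\<dots> = (6 * C * h) * h" by (simp add: power2_eq_square)
    also have "\<dots> \<le> e * h" using h by (intro mult_right_mono) auto
    finally have "\<bar>grad y i - grad x i\<bar> * h \<le> e * h"
      using q by (simp flip: left_diff_distrib add: abs_mult)
    then show "\<bar>grad y i - grad x i\<bar> \<le> e" using h by simp
  qed
qed

text \<open>
  A box on which one partial derivative is bounded away from 0, and so is the coefficient of \<open>kappa ^ p\<close> in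
  the expected squared width.
\<close>

lemma taylor_gradient_region:
  assumes T: "taylor_bound d s grad C" and nc: "\<not> s constant_on cube d"
  obtains i b g \<eta> where "i < d" "valid_cell d b" "0 < cell_vol d b" "0 < g" "0 < \<eta>"
    "\<And>x. x \<in> cell_box d b \<Longrightarrow> g \<le> \<bar>grad x i\<bar>" "\<And>x. x \<in> cell_box d b \<Longrightarrow> \<eta> \<le> x i * (1 - x i)"
proof -
  obtain x i where x: "x \<in> cube d" and i: "i < d" and g0: "grad x i \<noteq> 0"
    using taylor_gradient_nonzero[OF T nc] by blast
  define g where "g = \<bar>grad x i\<bar> / 2"
  have g: "0 < g" using g0 by (simp add: g_def)
  obtain r where r: "0 < r"
    "\<And>y. y \<in> cube d \<Longrightarrow> (\<And>k. k < d \<Longrightarrow> \<bar>y k - x k\<bar> \<le> r) \<Longrightarrow> \<bar>grad y i - grad x i\<bar> \<le> g"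
    using taylor_gradient_continuous[OF T x i g] by blast
  define u where "u k = min r ((1 - x k) / 2)" for k
  have xk: "0 \<le> x k" "x k < 1" if "k < d" for k using x that by (auto simp: cube_mem)
  have u: "0 < u k" "u k \<le> r" "x k + u k \<le> (1 + x k) / 2" if "k < d" for k
    using r xk[OF that] by (auto simp: u_def min_def field_simps)
  define b :: cell where "b = ((\<lambda>k. x k + u k / 2), (\<lambda>k. x k + u k))"
  have v: "valid_cell d b" unfolding valid_cell_def b_def fst_conv snd_conv
  proof (intro allI impI)
    fix k assume "k < d"
    with u[of k] xk[of k] show "0 \<le> x k + u k / 2 \<and> x k + u k / 2 \<le> x k + u k \<and> x k + u k \<le> 1" by auto
  qed
  have 1: "0 < cell_vol d b" unfolding cell_vol_def width_def b_def
    by (rule prod_pos) (use u in auto)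
  have 2: "g \<le> \<bar>grad y i\<bar>" if "y \<in> cell_box d b" for y
  proof -
    have "\<bar>grad y i - grad x i\<bar> \<le> g"
    proof (rule r(2))
      show "y \<in> cube d" using cell_box_subset_cube[OF v] that by blast
      fix k assume "k < d"
      with that u[OF this] show "\<bar>y k - x k\<bar> \<le> r" by (auto simp: mem_cell_box b_def abs_le_iff) 
    qed
    then show ?thesis using abs_triangle_ineq2[of "grad x i" "grad y i"] abs_minus_commute[of "grad x i" "grad y i"]
      unfolding g_def by linarith
  qed
  have 3: "u i / 2 * ((1 - x i) / 2) \<le> y i * (1 - y i)" if "y \<in> cell_box d b" for y
  proof -
    have "x i + u i / 2 \<le> y i" "y i < x i + u i" using that i by (auto simp: mem_cell_box b_def)
    with u[OF i] xk[OF i] have "u i / 2 \<le> y i" "(1 - x i) / 2 \<le> 1 - y i" by auto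
    then show ?thesis using u[OF i] xk[OF i] by (intro mult_mono) auto
  qed
  have 4: "0 < u i / 2 * ((1 - x i) / 2)" using u[OF i] xk[OF i] by simp
  show ?thesis by (rule that[of i b g "u i / 2 * ((1 - x i) / 2)"]) (fact i v 1 g 4 2 3)+
qed

section \<open>Moments of the regression law and of the binomial law\<close>


lemma regression_law_sets:
  assumes "regression_law d s \<sigma> P"
  shows "prob_space P" "sets P = sets (unif_cube d \<Otimes>\<^sub>M borel)" "distr P (unif_cube d) fst = unif_cube d"
    "fst \<in> measurable P (unif_cube d)" "snd \<in> borel_measurable P" "integrable P snd"
    "integrable P (\<lambda>z. (snd z - s (fst z))\<^sup>2)"
proof -
  show 1: "sets P = sets (unif_cube d \<Otimes>\<^sub>M borel)"
    using assms by (simp add: regression_law_def)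
  show "fst \<in> measurable P (unif_cube d)" "snd \<in> borel_measurable P"
    by (simp_all add: measurable_cong_sets[OF 1 refl])
qed (use assms in \<open>simp_all add: regression_law_def\<close>)

lemma integral_fst_regression:
  assumes "regression_law d s \<sigma> P" "g \<in> borel_measurable (unif_cube d)"
  shows "(\<integral>z. g (fst z) \<partial>P) = (\<integral>x. (g x :: real) \<partial>unif_cube d)"
proof -
  have "(\<integral>x. g x \<partial>unif_cube d) = (\<integral>x. g x \<partial>distr P (unif_cube d) fst)"
    by (simp add: regression_law_sets(3)[OF assms(1)])
  also have "\<dots> = (\<integral>z. g (fst z) \<partial>P)"
    by (rule integral_distr[OF regression_law_sets(4)[OF assms(1)] assms(2)])
  finally show ?thesis by simp
qed

text \<open>
  The two conditional expectations of the model, tested against bounded functions of the design point.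
\<close>

lemma regression_conditional_moments:
  fixes h :: "(nat \<Rightarrow> real) \<Rightarrow> real"
  assumes R: "regression_law d s \<sigma> P" and s: "s \<in> borel_measurable (unif_cube d)"
    and h: "h \<in> borel_measurable (unif_cube d)" and bd: "\<And>x. x \<in> cube d \<Longrightarrow> \<bar>h x\<bar> \<le> B"
  shows "integrable P (\<lambda>z. h (fst z) * snd z)"
    "(\<integral>z. h (fst z) * snd z \<partial>P) = (\<integral>z. h (fst z) * s (fst z) \<partial>P)"
    "integrable P (\<lambda>z. h (fst z) * (snd z - s (fst z))\<^sup>2)"
    "(\<integral>z. h (fst z) * (snd z - s (fst z))\<^sup>2 \<partial>P) = \<sigma>\<^sup>2 * (\<integral>z. h (fst z) \<partial>P)"
proof -
  note facts = regression_law_sets[OF R]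
  interpret P: prob_space P by (rule facts(1))
  let ?F = "vimage_algebra (space P) fst (unif_cube d)"
  have sub: "subalgebra P ?F"
    unfolding subalgebra_def using facts(4) by (auto simp: sets_vimage_algebra2 measurable_space measurable_sets Pi_iff)
  interpret F: finite_measure_subalgebra P ?F by unfold_locales (rule sub)
  have hF: "(\<lambda>z. h (fst z)) \<in> borel_measurable ?F"
    by (rule measurable_compose[OF measurable_vimage_algebra1 h]) (use facts(4) in \<open>auto simp: measurable_space\<close>)
  have hP: "(\<lambda>z. h (fst z)) \<in> borel_measurable P" by (rule measurable_compose[OF facts(4) h])
  have sP: "(\<lambda>z. s (fst z)) \<in> borel_measurable P" by (rule measurable_compose[OF facts(4) s])
  have bdP: "\<bar>h (fst z)\<bar> \<le> B" if "z \<in> space P" for z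
    using bd measurable_space[OF facts(4) that] by (simp add: space_unif_cube)
  have int: "integrable P (\<lambda>z. h (fst z) * f z)" if "integrable P f" for f :: "_ \<Rightarrow> real"
  proof (rule Bochner_Integration.integrable_bound)
    show "integrable P (\<lambda>z. B * f z)" using that by simp
    show "AE z in P. norm (h (fst z) * f z) \<le> norm (B * f z)"
      using bdP by (intro AE_I2) (force simp: abs_mult intro!: mult_right_mono)
  qed (use that hP in auto)
  have ce: "AE z in P. real_cond_exp P ?F snd z = s (fst z)"
    "AE z in P. real_cond_exp P ?F (\<lambda>z. (snd z - s (fst z))\<^sup>2) z = \<sigma>\<^sup>2"
    using R by (auto simp: regression_law_def Let_def)
  show i1: "integrable P (\<lambda>z. h (fst z) * snd z)" by (rule int[OF facts(6)])
  show i2: "integrable P (\<lambda>z. h (fst z) * (snd z - s (fst z))\<^sup>2)" by (rule int[OF facts(7)])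
  have "(\<integral>z. h (fst z) * snd z \<partial>P) = (\<integral>z. h (fst z) * real_cond_exp P ?F snd z \<partial>P)"
    by (rule F.real_cond_exp_intg(2)[OF i1 hF facts(5), symmetric])
  also have "\<dots> = (\<integral>z. h (fst z) * s (fst z) \<partial>P)"
    by (rule integral_cong_AE) (use ce(1) hP sP in auto)
  finally show "(\<integral>z. h (fst z) * snd z \<partial>P) = (\<integral>z. h (fst z) * s (fst z) \<partial>P)" .
  have "(\<integral>z. h (fst z) * (snd z - s (fst z))\<^sup>2 \<partial>P)
      = (\<integral>z. h (fst z) * real_cond_exp P ?F (\<lambda>z. (snd z - s (fst z))\<^sup>2) z \<partial>P)"
    by (rule F.real_cond_exp_intg(2)[OF i2 hF, symmetric]) (use facts(5) sP in simp)
  also have "\<dots> = (\<integral>z. h (fst z) * \<sigma>\<^sup>2 \<partial>P)"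
    by (rule integral_cong_AE) (use ce(2) hP in auto)
  finally show "(\<integral>z. h (fst z) * (snd z - s (fst z))\<^sup>2 \<partial>P) = \<sigma>\<^sup>2 * (\<integral>z. h (fst z) \<partial>P)"
    by (simp add: mult.commute)
qed

text \<open>
  The moments of \<open>(Y - m) 1[X \<in> S]\<close>, where \<open>m\<close> is the mean of \<open>s\<close> over \<open>S\<close>.
\<close>

lemma regression_centred_moments:
  fixes m :: real
  assumes R: "regression_law d s \<sigma> P" and s: "s \<in> borel_measurable (unif_cube d)"
    and bd: "\<And>x. x \<in> cube d \<Longrightarrow> \<bar>s x\<bar> \<le> K" and S: "S \<in> sets (unif_cube d)"
    and m: "(\<integral>x. s x * indicator S x \<partial>unif_cube d) = m * measure (unif_cube d) S"
  shows "integrable P (\<lambda>z. (snd z - m) * indicator S (fst z))"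
    "(\<integral>z. (snd z - m) * indicator S (fst z) \<partial>P) = 0"
    "integrable P (\<lambda>z. ((snd z - m) * indicator S (fst z))\<^sup>2)"
    "(\<integral>z. ((snd z - m) * indicator S (fst z))\<^sup>2 \<partial>P)
       = \<sigma>\<^sup>2 * measure (unif_cube d) S + (\<integral>x. (s x - m)\<^sup>2 * indicator S x \<partial>unif_cube d)"
    "(\<integral>z. indicator S (fst z) \<partial>P) = measure (unif_cube d) S"
proof -
  let ?U = "unif_cube d" let ?I = "\<lambda>x. indicator S x :: real"
  note facts = regression_law_sets[OF R]
  interpret P: prob_space P by (rule facts(1))
  have I: "?I \<in> borel_measurable ?U" using S by simp
  have IP: "(\<lambda>z. ?I (fst z)) \<in> borel_measurable P" by (rule measurable_compose[OF facts(4) I])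
  have sP: "(\<lambda>z. s (fst z)) \<in> borel_measurable P" by (rule measurable_compose[OF facts(4) s])
  have bdP: "\<bar>s (fst z)\<bar> \<le> K" if "z \<in> space P" for z
    using bd measurable_space[OF facts(4) that] by (simp add: space_unif_cube)
  have Ib: "\<bar>?I x\<bar> \<le> 1" for x by (simp add: indicator_def)
  have intI: "integrable P (\<lambda>z. ?I (fst z))"
    by (rule P.integrable_const_bound[where B = 1]) (use Ib IP in auto)
  have intsI: "integrable P (\<lambda>z. ?I (fst z) * s (fst z))"
  proof (rule P.integrable_const_bound[where B = K])
    show "AE z in P. norm (?I (fst z) * s (fst z)) \<le> K"
    proof (rule AE_I2)
      fix z assume "z \<in> space P"
      then show "norm (?I (fst z) * s (fst z)) \<le> K"
        using bdP[of z] abs_ge_zero[of "s (fst z)"] by (auto simp: indicator_def simp del: abs_ge_zero)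
    qed
  qed (use IP sP in simp)
  have intqI: "integrable P (\<lambda>z. (s (fst z) - m)\<^sup>2 * ?I (fst z))"
  proof (rule P.integrable_const_bound[where B = "(K + \<bar>m\<bar>)\<^sup>2"])
    show "AE z in P. norm ((s (fst z) - m)\<^sup>2 * ?I (fst z)) \<le> (K + \<bar>m\<bar>)\<^sup>2"
    proof (rule AE_I2)
      fix z assume "z \<in> space P"
      then have "\<bar>s (fst z) - m\<bar> \<le> K + \<bar>m\<bar>" using bdP[of z] by linarith
      then have "\<bar>s (fst z) - m\<bar>\<^sup>2 \<le> (K + \<bar>m\<bar>)\<^sup>2" by (intro power_mono) auto
      then show "norm ((s (fst z) - m)\<^sup>2 * ?I (fst z)) \<le> (K + \<bar>m\<bar>)\<^sup>2" by (simp add: indicator_def)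
    qed
  qed (use IP sP in simp)
  show qI: "(\<integral>z. ?I (fst z) \<partial>P) = measure ?U S"
    using integral_fst_regression[OF R I] S by simp
  have mI: "(\<integral>z. ?I (fst z) * s (fst z) \<partial>P) = m * measure ?U S"
    using integral_fst_regression[OF R, of "\<lambda>x. ?I x * s x"] m s I by (simp add: mult.commute)
  note cI = regression_conditional_moments[OF R s I Ib]
  have hm: "(\<lambda>x. (s x - m) * ?I x) \<in> borel_measurable ?U" using s I by simp
  have hb: "\<bar>(s x - m) * ?I x\<bar> \<le> K + \<bar>m\<bar>" if "x \<in> cube d" for x
    using bd[OF that] by (auto simp: indicator_def)
  note cs = regression_conditional_moments[OF R s hm hb]
  have e1: "(\<lambda>z. (snd z - m) * ?I (fst z)) = (\<lambda>z. ?I (fst z) * snd z - m * ?I (fst z))"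
    by (auto simp: algebra_simps)
  show "integrable P (\<lambda>z. (snd z - m) * ?I (fst z))"
    unfolding e1 using cI(1) intI by simp
  show "(\<integral>z. (snd z - m) * ?I (fst z) \<partial>P) = 0"
    unfolding e1 using cI(1,2) intI mI qI by simp
  have ints: "integrable P (\<lambda>z. (s (fst z) - m) * ?I (fst z) * s (fst z))"
  proof -
    have eq: "(\<lambda>z. (s (fst z) - m) * ?I (fst z) * s (fst z))
       = (\<lambda>z. (s (fst z) - m)\<^sup>2 * ?I (fst z) + m * (?I (fst z) * s (fst z)) - m * m * ?I (fst z))"
      by (auto simp: algebra_simps power2_eq_square)
    show ?thesis unfolding eq
      by (intro Bochner_Integration.integrable_diff Bochner_Integration.integrable_add
          integrable_mult_right intqI intsI intI)
  qed
  have e2: "(\<lambda>z. ((snd z - m) * ?I (fst z))\<^sup>2) = (\<lambda>z. ?I (fst z) * (snd z - s (fst z))\<^sup>2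
      + 2 * ((s (fst z) - m) * ?I (fst z) * snd z - (s (fst z) - m) * ?I (fst z) * s (fst z))
      + (s (fst z) - m)\<^sup>2 * ?I (fst z))"
    by (auto simp: indicator_def algebra_simps power2_eq_square)
  show "integrable P (\<lambda>z. ((snd z - m) * ?I (fst z))\<^sup>2)"
    unfolding e2 using cI(3) cs(1) ints intqI by simp
  show "(\<integral>z. ((snd z - m) * ?I (fst z))\<^sup>2 \<partial>P)
     = \<sigma>\<^sup>2 * measure ?U S + (\<integral>x. (s x - m)\<^sup>2 * ?I x \<partial>?U)"
    unfolding e2 using cI(3,4) cs(1,2) ints intqI qI integral_fst_regression[OF R, of "\<lambda>x. (s x - m)\<^sup>2 * ?I x"] s I
    by simp
qed

text \<open>
  The expectation of \<open>g\<close> under the binomial law with parameters \<open>n\<close> and \<open>q\<close>, by conditioning on the last trial.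
\<close>

primrec bin_mean :: "nat \<Rightarrow> real \<Rightarrow> (nat \<Rightarrow> real) \<Rightarrow> real" where
  "bin_mean 0 q g = g 0"
| "bin_mean (Suc n) q g = q * bin_mean n q (\<lambda>k. g (Suc k)) + (1 - q) * bin_mean n q g"

lemma bin_mean_mono:
  "0 \<le> q \<Longrightarrow> q \<le> 1 \<Longrightarrow> (\<And>k. f k \<le> g k) \<Longrightarrow> bin_mean n q f \<le> bin_mean n q g"
  by (induction n arbitrary: f g) (auto intro!: add_mono mult_left_mono)

lemma bin_mean_add: "bin_mean n q (\<lambda>k. f k + g k) = bin_mean n q f + bin_mean n q g"
  by (induction n arbitrary: f g) (auto simp: algebra_simps)

lemma bin_mean_cmult: "bin_mean n q (\<lambda>k. a * f k) = a * bin_mean n q f"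
  by (induction n arbitrary: f) (auto simp: algebra_simps)

lemma bin_mean_const: "bin_mean n q (\<lambda>_. a) = a"
  by (induction n) (auto simp: algebra_simps)

lemma bin_mean_zero: "bin_mean n q (\<lambda>k. if k = 0 then 1 else 0) = (1 - q) ^ n"
  by (induction n) (auto simp: bin_mean_const)

text \<open>
  The size-biasing identity \<open>E[N h(N)] = n q E[h(N' + 1)]\<close>, with \<open>N'\<close> binomial with one trial less.
\<close>

lemma bin_mean_Stein: "bin_mean (Suc n) q (\<lambda>k. real k * h k) = real (Suc n) * q * bin_mean n q (\<lambda>k. h (Suc k))"
proof (induction n arbitrary: h)
  case 0 then show ?case by simp
next
  case (Suc n)
  have "(\<lambda>k. real (Suc k) * h (Suc k)) = (\<lambda>k. h (Suc k) + real k * h (Suc k))"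
    by (auto simp: algebra_simps)
  then have 1: "bin_mean (Suc n) q (\<lambda>k. real (Suc k) * h (Suc k))
      = bin_mean (Suc n) q (\<lambda>k. h (Suc k)) + real (Suc n) * q * bin_mean n q (\<lambda>k. h (Suc (Suc k)))"
    by (simp only: bin_mean_add Suc.IH)
  have "bin_mean (Suc (Suc n)) q (\<lambda>k. real k * h k)
      = q * bin_mean (Suc n) q (\<lambda>k. real (Suc k) * h (Suc k)) + (1 - q) * bin_mean (Suc n) q (\<lambda>k. real k * h k)"
    by (rule bin_mean.simps(2))
  also have "\<dots> = q * bin_mean (Suc n) q (\<lambda>k. h (Suc k))
      + real (Suc n) * q * (q * bin_mean n q (\<lambda>k. h (Suc (Suc k))) + (1 - q) * bin_mean n q (\<lambda>k. h (Suc k)))"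
    unfolding 1 Suc.IH by (simp only: algebra_simps)
  also have "q * bin_mean n q (\<lambda>k. h (Suc (Suc k))) + (1 - q) * bin_mean n q (\<lambda>k. h (Suc k))
      = bin_mean (Suc n) q (\<lambda>k. h (Suc k))" by simp
  finally show ?case by (simp only: of_nat_Suc algebra_simps)
qed

lemma bin_mean_id: "bin_mean n q real = real n * q"
  using bin_mean_Stein[of "n - 1" q "\<lambda>_. 1"] by (cases n) (simp_all only: bin_mean_const mult_1_right diff_Suc_1, simp)

text \<open>
  For \<open>k \<ge> 1\<close> one has \<open>1 / k \<le> 2 / (k + 1)\<close>, and the expectation of \<open>1 / (N + 1)\<close> follows from size-biasing.
\<close>

lemma bin_mean_inverse_le:
  assumes "0 \<le> q" "q \<le> 1"
  shows "q * bin_mean n q (\<lambda>k. inverse (real k)) \<le> 2 / real (Suc n)"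
proof -
  have "bin_mean n q (\<lambda>k. inverse (real k)) \<le> bin_mean n q (\<lambda>k. 2 * inverse (real (Suc k)))"
  proof (rule bin_mean_mono[OF assms])
    show "inverse (real k) \<le> 2 * inverse (real (Suc k))" for k
      by (cases "k = 0") (auto simp: field_simps)
  qed
  then have "q * bin_mean n q (\<lambda>k. inverse (real k)) \<le> q * (2 * bin_mean n q (\<lambda>k. inverse (real (Suc k))))"
    unfolding bin_mean_cmult by (intro mult_left_mono assms)
  moreover have "real (Suc n) * q * bin_mean n q (\<lambda>k. inverse (real (Suc k))) \<le> 1"
  proof -
    have "real (Suc n) * q * bin_mean n q (\<lambda>k. inverse (real (Suc k))) = bin_mean (Suc n) q (\<lambda>k. real k * inverse (real k))"
      by (rule bin_mean_Stein[symmetric])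
    also have "\<dots> \<le> bin_mean (Suc n) q (\<lambda>_. 1)"
      by (rule bin_mean_mono[OF assms]) (simp add: divide_simps flip: divide_inverse)
    finally show ?thesis by (simp only: bin_mean_const)
  qed
  then have "q * bin_mean n q (\<lambda>k. inverse (real (Suc k))) \<le> 1 / real (Suc n)"
    by (subst pos_le_divide_eq) (simp_all only: of_nat_0_less_iff zero_less_Suc ac_simps)
  ultimately show ?thesis by linarith
qed

text \<open>
  A Cauchy-Schwarz inequality, in the form \<open>1 / k \<ge> 2 t - t^2 k\<close> with the optimal \<open>t\<close>.
\<close>

lemma bin_mean_inverse_ge:
  assumes "0 < q" "q \<le> 1" "1 \<le> n"
  shows "(1 - (1 - q) ^ n)\<^sup>2 / real n \<le> q * bin_mean n q (\<lambda>k. inverse (real k))"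
proof -
  define b where "b = 1 - (1 - q) ^ n"
  define t where "t = b / (real n * q)"
  have nq: "0 < real n * q" using assms by simp
  have "(\<lambda>k. 2 * t * (1 - (if k = 0 then 1 else 0)) - t\<^sup>2 * real k)
      = (\<lambda>k. 2 * t + ((- 2 * t) * (if k = 0 then 1 else 0) + (- t\<^sup>2) * real k))" by auto
  then have "bin_mean n q (\<lambda>k. 2 * t * (1 - (if k = 0 then 1 else 0)) - t\<^sup>2 * real k)
      = 2 * t + ((- 2 * t) * (1 - q) ^ n + (- t\<^sup>2) * (real n * q))"
    by (simp only: bin_mean_add bin_mean_cmult bin_mean_const bin_mean_zero bin_mean_id)
  also have "\<dots> = 2 * t * b - t * (t * (real n * q))"
    by (simp add: b_def algebra_simps power2_eq_square)
  also have "t * (real n * q) = b" using assms by (simp add: t_def)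
  finally have eq: "bin_mean n q (\<lambda>k. 2 * t * (1 - (if k = 0 then 1 else 0)) - t\<^sup>2 * real k) = t * b" by simp
  have "bin_mean n q (\<lambda>k. 2 * t * (1 - (if k = 0 then 1 else 0)) - t\<^sup>2 * real k)
      \<le> bin_mean n q (\<lambda>k. inverse (real k))"
  proof (rule bin_mean_mono)
    fix k show "2 * t * (1 - (if k = 0 then 1 else 0)) - t\<^sup>2 * real k \<le> inverse (real k)"
    proof (cases "k = 0")
      case False
      then have k: "0 < real k" by simp
      have "0 \<le> (1 - t * real k)\<^sup>2" by simp
      then have "(2 * t - t\<^sup>2 * real k) * real k \<le> 1" by (simp add: power2_eq_square algebra_simps)
      then have "2 * t - t\<^sup>2 * real k \<le> 1 / real k" using k by (simp add: pos_le_divide_eq)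
      then show ?thesis using False by (simp add: inverse_eq_divide)
    qed simp
  qed (use assms in auto)
  then have "q * (t * b) \<le> q * bin_mean n q (\<lambda>k. inverse (real k))"
    unfolding eq using assms by (intro mult_left_mono) auto
  also have "q * (t * b) = b\<^sup>2 / real n" using assms by (simp add: t_def power2_eq_square)
  finally show ?thesis by (simp add: b_def)
qed

section \<open>Risk of the average over a cell\<close>


text \<open>
  The number of sample points with index in \<open>I\<close> that lie in \<open>S\<close>.
\<close>

definition sample_count :: "nat set \<Rightarrow> (nat \<Rightarrow> real) set \<Rightarrow> (nat \<Rightarrow> (nat \<Rightarrow> real) \<times> real) \<Rightarrow> nat" where
  "sample_count I S D = (\<Sum>i\<in>I. if fst (D i) \<in> S then 1 else 0)"

lemma real_sample_count: "real (sample_count I S D) = (\<Sum>i\<in>I. indicator S (fst (D i)))"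
  unfolding sample_count_def of_nat_sum by (intro sum.cong) auto

lemma sample_count_le: "finite I \<Longrightarrow> sample_count I S D \<le> card I"
  unfolding sample_count_def using sum_bounded_above[of I "\<lambda>i. if fst (D i) \<in> S then 1 else 0" "1::nat"] by auto

lemma measurable_sample_point:
  assumes R: "regression_law d s \<sigma> P" and "i \<in> I" and S: "S \<in> sets (unif_cube d)"
  shows "Measurable.pred (PiM I (\<lambda>_. P)) (\<lambda>D. fst (D i) \<in> S)"
proof -
  have "(\<lambda>D. fst (D i)) \<in> measurable (PiM I (\<lambda>_. P)) (unif_cube d)"
    using measurable_compose[OF measurable_component_singleton[OF assms(2)] regression_law_sets(4)[OF R]] .
  then show ?thesis using S by measurable
qed

lemma measurable_sample_count:
  assumes R: "regression_law d s \<sigma> P" and I: "finite I" and S: "S \<in> sets (unif_cube d)"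
  shows "(\<lambda>D. f (sample_count I S D) :: real) \<in> borel_measurable (PiM I (\<lambda>_. P))"
proof -
  have "(\<lambda>D. \<Sum>i\<in>I. if fst (D i) \<in> S then 1 else 0 :: nat) \<in> measurable (PiM I (\<lambda>_. P)) (count_space UNIV)"
    by (intro measurable_sum_nat measurable_If measurable_const measurable_sample_point[OF R _ S, unfolded pred_def]) auto
  then show ?thesis unfolding sample_count_def by (rule measurable_compose) simp
qed

lemma product_prob_space_regression:
  assumes "regression_law d s \<sigma> P" shows "product_prob_space (\<lambda>_. P)"
  by (intro product_prob_spaceI regression_law_sets(1)[OF assms])

lemma sample_count_insert:
  "finite I \<Longrightarrow> i \<notin> I \<Longrightarrow> sample_count (insert i I) S (D(i := z))
    = (if fst z \<in> S then Suc (sample_count I S D) else sample_count I S D)"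
  unfolding sample_count_def by (subst sum.insert) (auto intro!: sum.cong)

lemma integrable_sample_count:
  assumes R: "regression_law d s \<sigma> P" and I: "finite I" and S: "S \<in> sets (unif_cube d)"
  shows "integrable (PiM I (\<lambda>_. P)) (\<lambda>D. f (sample_count I S D) :: real)"
proof -
  interpret prob_space "PiM I (\<lambda>_. P)" by (rule prob_space_PiM) (rule regression_law_sets(1)[OF R])
  show ?thesis
  proof (rule integrable_const_bound[where B = "Max ((\<lambda>k. \<bar>f k\<bar>) ` {..card I})"])
    show "AE D in PiM I (\<lambda>_. P). norm (f (sample_count I S D)) \<le> Max ((\<lambda>k. \<bar>f k\<bar>) ` {..card I})"
      using sample_count_le[OF I] by (intro AE_I2) auto
  qed (rule measurable_sample_count[OF R I S])
qed

lemma integral_sample_count: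
  assumes R: "regression_law d s \<sigma> P" and S: "S \<in> sets (unif_cube d)"
  shows "(\<integral>D. g (sample_count {..<n} S D) \<partial>PiM {..<n} (\<lambda>_. P)) = bin_mean n (measure (unif_cube d) S) g"
proof (induction n arbitrary: g)
  case 0
  interpret prob_space "PiM {..<0::nat} (\<lambda>_. P)" by (rule prob_space_PiM) (rule regression_law_sets(1)[OF R])
  show ?case using prob_space by (simp add: sample_count_def)
next
  case (Suc n)
  interpret p: prob_space P by (rule regression_law_sets(1)[OF R])
  interpret P: product_prob_space "\<lambda>_::nat. P" UNIV by (rule product_prob_space_regression[OF R])
  let ?q = "measure (unif_cube d) S" let ?N = "sample_count {..<n} S"
  have q: "(\<integral>z. indicator S (fst z) \<partial>P) = ?q"
    using integral_fst_regression[OF R, of "indicator S"] S by simp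
  have iI: "integrable P (\<lambda>z. indicator S (fst z) :: real)"
    by (rule p.integrable_const_bound[where B = 1, OF _ measurable_compose[OF regression_law_sets(4)[OF R]
          borel_measurable_indicator[OF S]]]) auto
  have "(\<integral>D. g (sample_count {..<Suc n} S D) \<partial>PiM {..<Suc n} (\<lambda>_. P))
     = (\<integral>D. (\<integral>z. g (sample_count {..<Suc n} S (D(n := z))) \<partial>P) \<partial>PiM {..<n} (\<lambda>_. P))"
    using integrable_sample_count[OF R _ S, of "{..<Suc n}" g] unfolding lessThan_Suc
    by (intro P.product_integral_insert) auto
  also have "\<dots> = (\<integral>D. ?q * g (Suc (?N D)) + (1 - ?q) * g (?N D) \<partial>PiM {..<n} (\<lambda>_. P))"
  proof (rule Bochner_Integration.integral_cong[OF refl])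
    fix D
    have "(\<integral>z. g (sample_count {..<Suc n} S (D(n := z))) \<partial>P)
       = (\<integral>z. (g (Suc (?N D)) - g (?N D)) * indicator S (fst z) + g (?N D) \<partial>P)"
      unfolding lessThan_Suc
      by (intro Bochner_Integration.integral_cong) (auto simp: sample_count_insert indicator_def)
    also have "\<dots> = (g (Suc (?N D)) - g (?N D)) * ?q + g (?N D)"
      using iI q by (simp add: p.prob_space)
    finally show "(\<integral>z. g (sample_count {..<Suc n} S (D(n := z))) \<partial>P) = ?q * g (Suc (?N D)) + (1 - ?q) * g (?N D)"
      by (simp add: algebra_simps)
  qed
  also have "\<dots> = ?q * bin_mean n ?q (\<lambda>k. g (Suc k)) + (1 - ?q) * bin_mean n ?q g"
    using integrable_sample_count[OF R finite_lessThan S, of n g] integrable_sample_count[OF R finite_lessThan S, of n "\<lambda>k. g (Suc k)"]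
      Suc.IH[of g] Suc.IH[of "\<lambda>k. g (Suc k)"] by simp
  finally show ?case by simp
qed

lemma integrable_sample_component:
  fixes I :: "nat set"
  assumes R: "regression_law d s \<sigma> P" and "i \<in> I" and f: "integrable P f"
  shows "integrable (PiM I (\<lambda>_. P)) (\<lambda>D. f (D i) :: real)"
proof -
  interpret P: product_prob_space "\<lambda>_::nat. P" I by (rule product_prob_space_regression[OF R])
  have "distr (PiM I (\<lambda>_. P)) P (\<lambda>D. D i) = P" by (rule P.PiM_component[OF assms(2)])
  then show ?thesis
    using integrable_distr[of "\<lambda>D. D i" "PiM I (\<lambda>_. P)" P f] f assms(2) by simp
qed

text \<open>
  If the \<open>i\<close>-th point lies in \<open>S\<close>, the count is one more than the count of the other points, which is
  independent of the \<open>i\<close>-th pair. A factor \<open>\<phi>\<close> that vanishes off \<open>S\<close> thus separates from the rest.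
\<close>

lemma leave_one_out:
  fixes \<phi> :: "(nat \<Rightarrow> real) \<times> real \<Rightarrow> real" and H :: "(nat \<Rightarrow> (nat \<Rightarrow> real) \<times> real) \<Rightarrow> real"
  assumes R: "regression_law d s \<sigma> P" and i: "i < n"
    and supp: "\<And>z. fst z \<notin> S \<Longrightarrow> \<phi> z = 0" and H: "\<And>D z. H (D(i := z)) = H D"
    and int: "integrable (PiM {..<n} (\<lambda>_. P)) (\<lambda>D. \<phi> (D i) * H D * (inverse (real (sample_count {..<n} S D)))\<^sup>2)"
  shows "(\<integral>D. \<phi> (D i) * H D * (inverse (real (sample_count {..<n} S D)))\<^sup>2 \<partial>PiM {..<n} (\<lambda>_. P))
    = (\<integral>z. \<phi> z \<partial>P) * (\<integral>D. H D * (inverse (real (Suc (sample_count ({..<n} - {i}) S D))))\<^sup>2 \<partial>PiM ({..<n} - {i}) (\<lambda>_. P))"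
proof -
  interpret P: product_prob_space "\<lambda>_::nat. P" UNIV by (rule product_prob_space_regression[OF R])
  let ?J = "{..<n} - {i}"
  have J: "{..<n} = insert i ?J" using i by auto
  have "(\<integral>D. \<phi> (D i) * H D * (inverse (real (sample_count {..<n} S D)))\<^sup>2 \<partial>PiM {..<n} (\<lambda>_. P))
    = (\<integral>D. (\<integral>z. \<phi> ((D(i := z)) i) * H (D(i := z)) * (inverse (real (sample_count (insert i ?J) S (D(i := z)))))\<^sup>2 \<partial>P) \<partial>PiM ?J (\<lambda>_. P))"
    using int by (subst (1 2) J, subst (asm) (1 2) J) (intro P.product_integral_insert, auto)
  also have "\<dots> = (\<integral>D. (\<integral>z. \<phi> z \<partial>P) * (H D * (inverse (real (Suc (sample_count ?J S D))))\<^sup>2) \<partial>PiM ?J (\<lambda>_. P))"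
  proof (rule Bochner_Integration.integral_cong[OF refl])
    fix D
    have "\<phi> ((D(i := z)) i) * H (D(i := z)) * (inverse (real (sample_count (insert i ?J) S (D(i := z)))))\<^sup>2
      = \<phi> z * (H D * (inverse (real (Suc (sample_count ?J S D))))\<^sup>2)" for z
    proof -
      have sc: "sample_count (insert i ?J) S (D(i := z))
          = (if fst z \<in> S then Suc (sample_count ?J S D) else sample_count ?J S D)"
        by (rule sample_count_insert) auto
      show ?thesis unfolding sc H fun_upd_same using supp[of z] by simp
    qed
    then show "(\<integral>z. \<phi> ((D(i := z)) i) * H (D(i := z)) * (inverse (real (sample_count (insert i ?J) S (D(i := z)))))\<^sup>2 \<partial>P)
      = (\<integral>z. \<phi> z \<partial>P) * (H D * (inverse (real (Suc (sample_count ?J S D))))\<^sup>2)"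
      by (simp only: integral_mult_left_zero)
  qed
  finally show ?thesis by simp
qed

lemma inverse_sq_le_1: "(inverse (real k))\<^sup>2 \<le> 1"
  by (cases "k = 0") (auto simp: power_le_one_iff inverse_le_1_iff)

text \<open>
  Up to the contribution of an empty \<open>S\<close>, the error is \<open>(\<Sum>i. \<xi>_i) / N\<close> with the centred variables
  \<open>\<xi>_i = (Y_i - m) 1[X_i \<in> S]\<close>. By the leave-one-out factorisation the cross terms vanish, and the diagonal
  terms add up to \<open>(\<sigma>^2 + V) E[1 / N]\<close>.
\<close>

lemma cell_average_risk:
  fixes m :: real
  assumes R: "regression_law d s \<sigma> P" and s: "s \<in> borel_measurable (unif_cube d)"
    and bd: "\<And>x. x \<in> cube d \<Longrightarrow> \<bar>s x\<bar> \<le> K" and S: "S \<in> sets (unif_cube d)"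
    and q: "q = measure (unif_cube d) S" and q0: "0 < q"
    and m: "(\<integral>x. s x * indicator S x \<partial>unif_cube d) = m * q"
    and V: "V * q = (\<integral>x. (s x - m)\<^sup>2 * indicator S x \<partial>unif_cube d)"
  shows "(\<integral>\<^sup>+D. ennreal ((cell_average n D S - m)\<^sup>2) \<partial>sample_law n P)
    = ennreal ((\<sigma>\<^sup>2 + V) * bin_mean n q (\<lambda>k. inverse (real k)) + m\<^sup>2 * (1 - q) ^ n)"
proof -
  let ?M = "PiM {..<n} (\<lambda>_. P)"
  define N where "N = sample_count {..<n} S"
  define w where "w D = (inverse (real (N D)))\<^sup>2" for D
  define xi where "xi z = (snd z - m) * indicator S (fst z)" for z :: "(nat \<Rightarrow> real) \<times> real"
  define e where "e z = (indicator S (fst z) :: real)" for z :: "(nat \<Rightarrow> real) \<times> real"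
  note facts = regression_law_sets[OF R]
  interpret p: prob_space P by (rule facts(1))
  interpret M: prob_space ?M by (rule prob_space_PiM) (rule facts(1))
  note cm0 = regression_centred_moments[OF R s bd S m[unfolded q]]
  have cm: "integrable P xi" "(\<integral>z. xi z \<partial>P) = 0" "integrable P (\<lambda>z. (xi z)\<^sup>2)"
    "(\<integral>z. (xi z)\<^sup>2 \<partial>P) = \<sigma>\<^sup>2 * q + V * q" "(\<integral>z. e z \<partial>P) = q"
    unfolding V unfolding xi_def e_def q by (rule cm0; assumption)+
  have "e \<in> borel_measurable P"
    unfolding e_def by (rule measurable_compose[OF facts(4) borel_measurable_indicator[OF S]])
  then have ie: "integrable P e"
    by (intro p.integrable_const_bound[where B = 1]) (auto simp: e_def)
  have Ex2: "(\<integral>z. (xi z)\<^sup>2 \<partial>P) = (\<sigma>\<^sup>2 + V) * q" unfolding cm(4) by (simp add: algebra_simps)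
  have w1: "0 \<le> w D" "w D \<le> 1" for D unfolding w_def by (rule zero_le_power2, rule inverse_sq_le_1)
  have mw: "w \<in> borel_measurable ?M"
    unfolding w_def N_def by (rule measurable_sample_count[OF R finite_lessThan S, of "\<lambda>k. (inverse (real k))\<^sup>2"])
  have ixi: "integrable ?M (\<lambda>D. xi (D i))" and ixi2: "integrable ?M (\<lambda>D. (xi (D i))\<^sup>2)" and iei: "integrable ?M (\<lambda>D. e (D i))" if "i < n" for i
    using integrable_sample_component[OF R, of i "{..<n}"] that cm(1,3) ie by auto
  have iw: "integrable ?M (\<lambda>D. f D * w D)" if "integrable ?M f" for f :: "_ \<Rightarrow> real"
  proof (rule Bochner_Integration.integrable_bound[OF that])
    show "AE D in ?M. norm (f D * w D) \<le> norm (f D)"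
      using w1 by (intro AE_I2) (simp add: abs_mult mult_left_le)
  qed (use that mw in simp)
  have ixx: "integrable ?M (\<lambda>D. xi (D i) * xi (D k))" if "i < n" "k < n" for i k
  proof (rule Bochner_Integration.integrable_bound)
    show "integrable ?M (\<lambda>D. (xi (D i))\<^sup>2 + (xi (D k))\<^sup>2)" using ixi2 that by simp
    show "AE D in ?M. norm (xi (D i) * xi (D k)) \<le> norm ((xi (D i))\<^sup>2 + (xi (D k))\<^sup>2)"
    proof (rule AE_I2)
      fix D
      have "\<bar>a * b\<bar> \<le> a\<^sup>2 + b\<^sup>2" for a b :: real
      proof -
        have "2 * \<bar>a * b\<bar> \<le> a\<^sup>2 + b\<^sup>2" using sum_squares_bound[of "\<bar>a\<bar>" "\<bar>b\<bar>"] by (simp add: abs_mult)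
        then show ?thesis using abs_ge_zero[of "a * b"] by linarith
      qed
      then show "norm (xi (D i) * xi (D k)) \<le> norm ((xi (D i))\<^sup>2 + (xi (D k))\<^sup>2)" by simp
    qed
  qed (use ixi that in auto)
  have cross: "(\<integral>D. xi (D i) * xi (D k) * w D \<partial>?M) = 0" if "i < n" "k < n" "i \<noteq> k" for i k
  proof -
    have "(\<integral>D. xi (D i) * xi (D k) * w D \<partial>?M) = (\<integral>z. xi z \<partial>P) *
      (\<integral>D. xi (D k) * (inverse (real (Suc (sample_count ({..<n} - {i}) S D))))\<^sup>2 \<partial>PiM ({..<n} - {i}) (\<lambda>_. P))"
      unfolding w_def N_def
    proof (rule leave_one_out[OF R that(1)])
      show "integrable ?M (\<lambda>D. xi (D i) * xi (D k) * (inverse (real (sample_count {..<n} S D)))\<^sup>2)"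
        using iw[OF ixx[OF that(1,2)]] unfolding w_def N_def .
    qed (use that(3) in \<open>auto simp: xi_def\<close>)
    then show ?thesis unfolding cm(2) by simp
  qed
  have diag: "(\<integral>D. xi (D i) * xi (D i) * w D \<partial>?M) = (\<sigma>\<^sup>2 + V) * (\<integral>D. e (D i) * w D \<partial>?M)" if "i < n" for i
  proof -
    have 1: "(\<integral>D. (xi (D i))\<^sup>2 * 1 * w D \<partial>?M) = (\<integral>z. (xi z)\<^sup>2 \<partial>P) *
      (\<integral>D. 1 * (inverse (real (Suc (sample_count ({..<n} - {i}) S D))))\<^sup>2 \<partial>PiM ({..<n} - {i}) (\<lambda>_. P))"
      unfolding w_def N_def
    proof (rule leave_one_out[OF R that])
      show "integrable ?M (\<lambda>D. (xi (D i))\<^sup>2 * 1 * (inverse (real (sample_count {..<n} S D)))\<^sup>2)"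
        using iw[OF ixi2[OF that]] unfolding w_def N_def mult_1_right .
    qed (auto simp: xi_def)
    have 2: "(\<integral>D. e (D i) * 1 * w D \<partial>?M) = (\<integral>z. e z \<partial>P) *
      (\<integral>D. 1 * (inverse (real (Suc (sample_count ({..<n} - {i}) S D))))\<^sup>2 \<partial>PiM ({..<n} - {i}) (\<lambda>_. P))"
      unfolding w_def N_def
    proof (rule leave_one_out[OF R that])
      show "integrable ?M (\<lambda>D. e (D i) * 1 * (inverse (real (sample_count {..<n} S D)))\<^sup>2)"
        using iw[OF iei[OF that]] unfolding w_def N_def mult_1_right .
    qed (auto simp: e_def)
    show ?thesis
      using 1[unfolded Ex2] 2[unfolded cm(5)] unfolding power2_eq_square[of "xi _", symmetric] by simp
  qed
  define A where "A = bin_mean n q (\<lambda>k. inverse (real k))"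
  have sumN: "(\<Sum>i<n. e (D i)) = real (N D)" for D
    by (simp add: e_def N_def real_sample_count)
  have Ns: "real (N D) * w D = inverse (real (N D))" for D
    by (cases "N D = 0") (auto simp: w_def power2_eq_square)
  have sum_w: "(\<Sum>i<n. \<integral>D. e (D i) * w D \<partial>?M) = A"
  proof -
    have "(\<Sum>i<n. \<integral>D. e (D i) * w D \<partial>?M) = (\<integral>D. (\<Sum>i<n. e (D i) * w D) \<partial>?M)"
      by (rule Bochner_Integration.integral_sum[symmetric]) (use iw iei in auto)
    also have "\<dots> = (\<integral>D. inverse (real (N D)) \<partial>?M)"
      by (simp add: sumN Ns flip: sum_distrib_right)
    also have "\<dots> = A" unfolding N_def A_def q by (rule integral_sample_count[OF R S])
    finally show ?thesis .
  qed
  let ?Z = "\<lambda>D. if N D = 0 then 1 else 0 :: real"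
  have iZ: "integrable ?M ?Z" unfolding N_def by (rule integrable_sample_count[OF R finite_lessThan S, where f = "\<lambda>k. if k = 0 then 1 else 0"])
  have EZ: "(\<integral>D. ?Z D \<partial>?M) = (1 - q) ^ n"
    unfolding N_def using integral_sample_count[OF R S, where g = "\<lambda>k. if k = 0 then 1 else 0"]
    by (simp add: q bin_mean_zero)
  have dec: "(cell_average n D S - m)\<^sup>2 = (\<Sum>i<n. \<Sum>k<n. xi (D i) * xi (D k) * w D) + m\<^sup>2 * ?Z D" for D
  proof -
    have sx: "(\<Sum>i<n. xi (D i)) = (\<Sum>i<n. snd (D i) * indicator S (fst (D i))) - m * real (N D)"
      unfolding sumN[symmetric] by (simp add: xi_def e_def left_diff_distrib sum_subtractf sum_distrib_left)
    have av: "cell_average n D S = (\<Sum>i<n. snd (D i) * indicator S (fst (D i))) / real (N D)"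
      unfolding cell_average_def N_def real_sample_count ..
    have "(\<Sum>i<n. \<Sum>k<n. xi (D i) * xi (D k) * w D) = ((\<Sum>i<n. xi (D i)) * inverse (real (N D)))\<^sup>2"
    proof -
      have "(\<Sum>i<n. \<Sum>k<n. xi (D i) * xi (D k) * w D) = (\<Sum>i<n. \<Sum>k<n. xi (D i) * xi (D k)) * w D"
        by (simp only: sum_distrib_right)
      also have "(\<Sum>i<n. \<Sum>k<n. xi (D i) * xi (D k)) = (\<Sum>i<n. xi (D i))\<^sup>2"
        unfolding power2_eq_square by (rule sum_product[symmetric])
      finally show ?thesis by (simp only: w_def power_mult_distrib)
    qed
    also have "\<dots> = (cell_average n D S - m)\<^sup>2 - m\<^sup>2 * ?Z D"
      by (cases "N D = 0") (simp_all add: sx av field_simps)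
    finally show ?thesis by simp
  qed
  have int: "integrable ?M (\<lambda>D. (cell_average n D S - m)\<^sup>2)"
    unfolding dec using iw[OF ixx] iZ by (intro Bochner_Integration.integrable_add Bochner_Integration.integrable_sum integrable_mult_right) auto
  have "(\<integral>D. (cell_average n D S - m)\<^sup>2 \<partial>?M)
      = (\<integral>D. (\<Sum>i<n. \<Sum>k<n. xi (D i) * xi (D k) * w D) \<partial>?M) + (\<integral>D. m\<^sup>2 * ?Z D \<partial>?M)"
    unfolding dec using iw[OF ixx] iZ
    by (intro Bochner_Integration.integral_add Bochner_Integration.integrable_sum integrable_mult_right) auto
  also have "(\<integral>D. (\<Sum>i<n. \<Sum>k<n. xi (D i) * xi (D k) * w D) \<partial>?M)
      = (\<Sum>i<n. \<Sum>k<n. \<integral>D. xi (D i) * xi (D k) * w D \<partial>?M)"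
    using iw[OF ixx] by (subst Bochner_Integration.integral_sum, fastforce, intro sum.cong refl Bochner_Integration.integral_sum) auto
  also have "\<dots> = (\<Sum>i<n. \<Sum>k<n. if k = i then (\<sigma>\<^sup>2 + V) * (\<integral>D. e (D i) * w D \<partial>?M) else 0)"
    using cross diag by (intro sum.cong refl) auto
  also have "\<dots> = (\<sigma>\<^sup>2 + V) * A" unfolding sum_w[symmetric] sum_distrib_left by simp
  also have "(\<integral>D. m\<^sup>2 * ?Z D \<partial>?M) = m\<^sup>2 * (1 - q) ^ n" using EZ by simp
  finally have "(\<integral>D. (cell_average n D S - m)\<^sup>2 \<partial>?M) = (\<sigma>\<^sup>2 + V) * A + m\<^sup>2 * (1 - q) ^ n" .
  then show ?thesis
    unfolding sample_law_def A_def using nn_integral_eq_integral[OF int] by simp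
qed

section \<open>Integration over sample, point and partition\<close>


text \<open>
  Measurable functions on the cube that are bounded by \<open>K\<close>.
\<close>

definition bounded_regression :: "nat \<Rightarrow> ((nat \<Rightarrow> real) \<Rightarrow> real) \<Rightarrow> real \<Rightarrow> bool" where
  "bounded_regression d s K \<longleftrightarrow> s \<in> borel_measurable (unif_cube d) \<and> (\<forall>x\<in>cube d. \<bar>s x\<bar> \<le> K)"

lemma bounded_regressionD:
  assumes "bounded_regression d s K"
  shows "s \<in> borel_measurable (unif_cube d)" "\<And>x. x \<in> cube d \<Longrightarrow> \<bar>s x\<bar> \<le> K"
  using assms by (auto simp: bounded_regression_def)

lemma integrable_cell_box:
  assumes s: "bounded_regression d s K" and c: "valid_cell d c"
  shows "integrable (unif_cube d) (\<lambda>x. s x * indicator (cell_box d c) x)"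
proof -
  interpret prob_space "unif_cube d" by (rule prob_space_unif_cube)
  have "integrable (unif_cube d) s"
    by (rule integrable_const_bound[where B = K])
       (use bounded_regressionD[OF s] in \<open>auto simp: space_unif_cube\<close>)
  then show ?thesis using sets_cell_box[OF c] by (rule integrable_real_mult_indicator[rotated])
qed

lemma integral_indicator_cell_box:
  assumes "valid_cell d c"
  shows "integrable (unif_cube d) (\<lambda>x. indicator (cell_box d c) x :: real)"
    "(\<integral>x. indicator (cell_box d c) x \<partial>unif_cube d) = cell_vol d c"
proof -
  interpret prob_space "unif_cube d" by (rule prob_space_unif_cube)
  show "integrable (unif_cube d) (\<lambda>x. indicator (cell_box d c) x :: real)"
    using sets_cell_box[OF assms] by (simp add: emeasure_eq_measure)
  show "(\<integral>x. indicator (cell_box d c) x \<partial>unif_cube d) = cell_vol d c"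
    using sets_cell_box[OF assms] measure_cell_box[OF assms] by simp
qed

lemma integral_cell_box_le:
  assumes s: "bounded_regression d s K" and c: "valid_cell d c"
    and le: "\<And>x. x \<in> cell_box d c \<Longrightarrow> s x \<le> b"
  shows "(\<integral>x. s x * indicator (cell_box d c) x \<partial>unif_cube d) \<le> b * cell_vol d c"
proof -
  have "(\<integral>x. s x * indicator (cell_box d c) x \<partial>unif_cube d) \<le> (\<integral>x. b * indicator (cell_box d c) x \<partial>unif_cube d)"
    using integral_indicator_cell_box(1)[OF c] le
    by (intro integral_mono integrable_cell_box[OF s c] integrable_mult_right) (auto simp: indicator_def)
  then show ?thesis using integral_indicator_cell_box[OF c] by simp
qed

lemma bounded_regression_uminus: "bounded_regression d s K \<Longrightarrow> bounded_regression d (\<lambda>x. - s x) K"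
  by (auto simp: bounded_regression_def)

lemma abs_integral_cell_box_le:
  assumes s: "bounded_regression d s K" and c: "valid_cell d c"
    and le: "\<And>x. x \<in> cell_box d c \<Longrightarrow> \<bar>s x\<bar> \<le> b"
  shows "\<bar>\<integral>x. s x * indicator (cell_box d c) x \<partial>unif_cube d\<bar> \<le> b * cell_vol d c"
proof -
  have "s x \<le> b" "- s x \<le> b" if "x \<in> cell_box d c" for x using le[OF that] by auto
  from integral_cell_box_le[OF s c this(1)] integral_cell_box_le[OF bounded_regression_uminus[OF s] c this(2)]
  show ?thesis by (simp add: abs_le_iff)
qed

text \<open>
  The mean of a function over a cell (0 for a cell of volume 0).
\<close>

definition cell_value :: "nat \<Rightarrow> ((nat \<Rightarrow> real) \<Rightarrow> real) \<Rightarrow> cell \<Rightarrow> real" where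
  "cell_value d s c = (\<integral>x. s x * indicator (cell_box d c) x \<partial>unif_cube d) / cell_vol d c"

lemma cell_value_mult:
  assumes s: "bounded_regression d s K" and c: "valid_cell d c"
  shows "(\<integral>x. s x * indicator (cell_box d c) x \<partial>unif_cube d) = cell_value d s c * cell_vol d c"
proof (cases "cell_vol d c = 0")
  case True
  have "\<bar>s x\<bar> \<le> K" if "x \<in> cell_box d c" for x
    using bounded_regressionD(2)[OF s] cell_box_subset_cube[OF c] that by blast
  then show ?thesis using abs_integral_cell_box_le[OF s c, of K] True by simp
qed (simp add: cell_value_def)

lemma cell_value_bound:
  assumes s: "bounded_regression d s K" and c: "valid_cell d c" and K: "0 \<le> K"
  shows "\<bar>cell_value d s c\<bar> \<le> K"
proof (cases "cell_vol d c = 0")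
  case False
  then have v: "0 < cell_vol d c" using cell_vol_bounds[OF c] by simp
  have "\<bar>s x\<bar> \<le> K" if "x \<in> cell_box d c" for x
    using bounded_regressionD(2)[OF s] cell_box_subset_cube[OF c] that by blast
  then have "\<bar>cell_value d s c * cell_vol d c\<bar> \<le> K * cell_vol d c"
    unfolding cell_value_mult[OF s c, symmetric] by (intro abs_integral_cell_box_le[OF s c])
  then show ?thesis using v by (simp add: abs_mult)
qed (simp add: cell_value_def K)

lemma measurable_integral_cell_box:
  assumes "f \<in> borel_measurable (unif_cube d)"
  shows "(\<lambda>c. \<integral>x. f x * indicator (cell_box d c) x \<partial>unif_cube d :: real) \<in> borel_measurable cell_space"
proof -
  interpret prob_space "unif_cube d" by (rule prob_space_unif_cube)
  have 1: "(\<lambda>u. (snd u, fst u)) \<in> measurable (cell_space \<Otimes>\<^sub>M unif_cube d) (unif_cube d \<Otimes>\<^sub>M cell_space)"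
    by (intro measurable_Pair measurable_fst measurable_snd)
  have "(\<lambda>u. indicator (cell_box d (fst u)) (snd u) :: real) \<in> borel_measurable (cell_space \<Otimes>\<^sub>M unif_cube d)"
    using measurable_compose[OF 1 measurable_indicator_cell_box_joint] by simp
  moreover have "(\<lambda>u. f (snd u)) \<in> borel_measurable (cell_space \<Otimes>\<^sub>M unif_cube d)"
    by (rule measurable_compose[OF measurable_snd assms])
  ultimately have "(\<lambda>u. f (snd u) * indicator (cell_box d (fst u)) (snd u)) \<in> borel_measurable (cell_space \<Otimes>\<^sub>M unif_cube d)"
    by (intro borel_measurable_times)
  then show ?thesis by (intro borel_measurable_lebesgue_integral) (simp add: case_prod_beta')
qed

lemma measurable_cell_value:
  assumes "s \<in> borel_measurable (unif_cube d)" shows "cell_value d s \<in> borel_measurable cell_space"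
  unfolding cell_value_def
  by (intro borel_measurable_divide measurable_integral_cell_box assms measurable_cell_vol)

lemma prob_space_sample_law:
  assumes "regression_law d s \<sigma> P" shows "prob_space (sample_law n P)"
  unfolding sample_law_def by (rule prob_space_PiM) (rule regression_law_sets(1)[OF assms])

lemma measurable_cell_average:
  assumes R: "regression_law d s \<sigma> P"
  shows "(\<lambda>u. cell_average n (fst u) (cell_box d (snd u))) \<in> borel_measurable (sample_law n P \<Otimes>\<^sub>M cell_space)"
proof -
  let ?M = "sample_law n P \<Otimes>\<^sub>M cell_space"
  have D: "(\<lambda>u. fst u i) \<in> measurable ?M P" if "i < n" for i
    unfolding sample_law_def using that
    by (intro measurable_compose[OF measurable_fst measurable_component_singleton]) auto
  have X: "(\<lambda>u. (fst (fst u i), snd u)) \<in> measurable ?M (unif_cube d \<Otimes>\<^sub>M cell_space)" if "i < n" for i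
    by (intro measurable_Pair measurable_snd measurable_compose[OF D[OF that] regression_law_sets(4)[OF R]])
  have I: "(\<lambda>u. indicator (cell_box d (snd u)) (fst (fst u i)) :: real) \<in> borel_measurable ?M" if "i < n" for i
    using measurable_compose[OF X[OF that] measurable_indicator_cell_box_joint] by simp
  have Y: "(\<lambda>u. snd (fst u i)) \<in> borel_measurable ?M" if "i < n" for i
    by (rule measurable_compose[OF D[OF that] regression_law_sets(5)[OF R]])
  show ?thesis unfolding cell_average_def
    by (intro borel_measurable_divide borel_measurable_sum borel_measurable_times I Y) auto
qed

lemma abs_cell_average_le: "\<bar>cell_average n D S\<bar> \<le> (\<Sum>i<n. \<bar>snd (D i)\<bar>)"
proof -
  let ?N = "\<Sum>i<n. indicator S (fst (D i)) :: real"
  have N: "?N = real (sample_count {..<n} S D)" by (rule real_sample_count[symmetric])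
  have num: "\<bar>\<Sum>i<n. snd (D i) * indicator S (fst (D i))\<bar> \<le> (\<Sum>i<n. \<bar>snd (D i)\<bar>)"
    by (intro order_trans[OF sum_abs] sum_mono) (auto simp: indicator_def)
  show ?thesis
  proof (cases "sample_count {..<n} S D = 0")
    case True
    then show ?thesis unfolding cell_average_def N by (simp add: sum_nonneg)
  next
    case False
    then have "1 \<le> real (sample_count {..<n} S D)" by simp
    then have "\<bar>cell_average n D S\<bar> \<le> \<bar>\<Sum>i<n. snd (D i) * indicator S (fst (D i))\<bar> / 1"
      unfolding cell_average_def N abs_divide by (intro divide_left_mono) auto
    then show ?thesis using num by simp
  qed
qed

text \<open>
  Joint measurability, in the point and the draws, of a functional of the cell that contains the point.
\<close>

lemma measurable_cell_sum:
  assumes "1 \<le> d" and f: "(\<lambda>u. f (fst u) (fst (snd u)) (snd (snd u)) :: real) \<in> borel_measurable (M \<Otimes>\<^sub>M (unif_cube d \<Otimes>\<^sub>M cell_space))"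
  shows "(\<lambda>u. \<Sum>j<2 ^ p. indicator (cell_box d (bprf_cell (snd (snd u)) p j)) (fst (snd u))
      * f (fst u) (fst (snd u)) (bprf_cell (snd (snd u)) p j)) \<in> borel_measurable (M \<Otimes>\<^sub>M (unif_cube d \<Otimes>\<^sub>M bprf_draws d p))"
proof (intro borel_measurable_sum borel_measurable_times)
  let ?M = "M \<Otimes>\<^sub>M (unif_cube d \<Otimes>\<^sub>M bprf_draws d p)"
  fix j assume "j \<in> {..<2 ^ p :: nat}"
  then have c: "(\<lambda>u. bprf_cell (snd (snd u)) p j) \<in> measurable ?M cell_space"
    using measurable_bprf_cell[of p p j d]
    by (intro measurable_compose[OF measurable_snd] measurable_compose[OF measurable_snd]) auto
  have x: "(\<lambda>u. fst (snd u)) \<in> measurable ?M (unif_cube d)"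
    by (intro measurable_compose[OF measurable_snd measurable_fst])
  show "(\<lambda>u. indicator (cell_box d (bprf_cell (snd (snd u)) p j)) (fst (snd u)) :: real) \<in> borel_measurable ?M"
    using measurable_compose[OF measurable_Pair[OF x c] measurable_indicator_cell_box_joint] by simp
  show "(\<lambda>u. f (fst u) (fst (snd u)) (bprf_cell (snd (snd u)) p j)) \<in> borel_measurable ?M"
    using measurable_compose[OF measurable_Pair[OF measurable_fst measurable_Pair[OF x c]] f] by simp
qed

text \<open>
  Tonelli for three factors, for the two orders of integration that occur below.
\<close>

lemma nn_integral_triple:
  assumes M: "prob_space M" and N: "prob_space N" and W: "prob_space W"
    and h: "h \<in> borel_measurable (M \<Otimes>\<^sub>M (N \<Otimes>\<^sub>M W))"
  shows "(\<integral>\<^sup>+u. h u \<partial>(M \<Otimes>\<^sub>M (N \<Otimes>\<^sub>M W))) = (\<integral>\<^sup>+D. \<integral>\<^sup>+x. \<integral>\<^sup>+w. h (D, x, w) \<partial>W \<partial>N \<partial>M)"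
    and "(\<integral>\<^sup>+u. h u \<partial>(M \<Otimes>\<^sub>M (N \<Otimes>\<^sub>M W))) = (\<integral>\<^sup>+w. \<integral>\<^sup>+D. \<integral>\<^sup>+x. h (D, x, w) \<partial>N \<partial>M \<partial>W)"
proof -
  interpret M: prob_space M by fact
  interpret N: prob_space N by fact
  interpret W: prob_space W by fact
  interpret NW: pair_prob_space N W ..
  interpret MN: pair_prob_space M N ..
  interpret MNW: pair_prob_space M "N \<Otimes>\<^sub>M W" ..
  have hD: "(\<lambda>v. h (D, v)) \<in> borel_measurable (N \<Otimes>\<^sub>M W)" if "D \<in> space M" for D
    using measurable_Pair2[OF h that] .
  have 1: "(\<integral>\<^sup>+u. h u \<partial>(M \<Otimes>\<^sub>M (N \<Otimes>\<^sub>M W))) = (\<integral>\<^sup>+D. \<integral>\<^sup>+v. h (D, v) \<partial>(N \<Otimes>\<^sub>M W) \<partial>M)"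
    by (rule sigma_finite_measure.nn_integral_fst[OF prob_space_imp_sigma_finite[OF NW.prob_space_axioms] h, symmetric])
  also have "\<dots> = (\<integral>\<^sup>+D. \<integral>\<^sup>+x. \<integral>\<^sup>+w. h (D, x, w) \<partial>W \<partial>N \<partial>M)"
    by (rule nn_integral_cong) (rule W.nn_integral_fst[OF hD, symmetric])
  finally show "(\<integral>\<^sup>+u. h u \<partial>(M \<Otimes>\<^sub>M (N \<Otimes>\<^sub>M W))) = (\<integral>\<^sup>+D. \<integral>\<^sup>+x. \<integral>\<^sup>+w. h (D, x, w) \<partial>W \<partial>N \<partial>M)" .
  have "(\<integral>\<^sup>+u. h u \<partial>(M \<Otimes>\<^sub>M (N \<Otimes>\<^sub>M W))) = (\<integral>\<^sup>+v. \<integral>\<^sup>+D. h (D, v) \<partial>M \<partial>(N \<Otimes>\<^sub>M W))"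
    unfolding 1 by (rule MNW.Fubini'[symmetric]) (simp add: h)
  also have "\<dots> = (\<integral>\<^sup>+w. \<integral>\<^sup>+x. \<integral>\<^sup>+D. h (D, x, w) \<partial>M \<partial>N \<partial>W)"
  proof -
    have "(\<lambda>(x, D). h (D, x)) \<in> borel_measurable ((N \<Otimes>\<^sub>M W) \<Otimes>\<^sub>M M)"
      using measurable_compose[OF measurable_pair_swap' h] by (simp add: case_prod_beta')
    then have "(\<lambda>v. \<integral>\<^sup>+D. h (D, v) \<partial>M) \<in> borel_measurable (N \<Otimes>\<^sub>M W)"
      by (rule M.borel_measurable_nn_integral)
    then show ?thesis by (rule NW.nn_integral_snd[symmetric])
  qed
  also have "\<dots> = (\<integral>\<^sup>+w. \<integral>\<^sup>+D. \<integral>\<^sup>+x. h (D, x, w) \<partial>N \<partial>M \<partial>W)"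
  proof (rule nn_integral_cong)
    fix w assume w: "w \<in> space W"
    have "(\<lambda>v. (fst v, snd v, w)) \<in> measurable (M \<Otimes>\<^sub>M N) (M \<Otimes>\<^sub>M (N \<Otimes>\<^sub>M W))"
      using w by (intro measurable_Pair measurable_fst measurable_snd measurable_const) auto
    from measurable_compose[OF this h]
    have "(\<lambda>(D, x). h (D, x, w)) \<in> borel_measurable (M \<Otimes>\<^sub>M N)" by (simp add: case_prod_beta')
    then show "(\<integral>\<^sup>+x. \<integral>\<^sup>+D. h (D, x, w) \<partial>M \<partial>N) = (\<integral>\<^sup>+D. \<integral>\<^sup>+x. h (D, x, w) \<partial>N \<partial>M)"
      by (rule MN.Fubini')
  qed
  finally show "(\<integral>\<^sup>+u. h u \<partial>(M \<Otimes>\<^sub>M (N \<Otimes>\<^sub>M W))) = (\<integral>\<^sup>+w. \<integral>\<^sup>+D. \<integral>\<^sup>+x. h (D, x, w) \<partial>N \<partial>M \<partial>W)" .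
qed

text \<open>
  A nonnegative functional of the sample, the point and the cell that contains the point: the integral over
  the partition may be taken first, as for a forest, or last, as a sum over the cells.
\<close>

lemma nn_integral_cell_sum:
  fixes d p :: nat and f :: "'a \<Rightarrow> (nat \<Rightarrow> real) \<Rightarrow> cell \<Rightarrow> real"
  assumes d: "1 \<le> d" and M: "prob_space M"
    and f: "(\<lambda>u. f (fst u) (fst (snd u)) (snd (snd u)) :: real) \<in> borel_measurable (M \<Otimes>\<^sub>M (unif_cube d \<Otimes>\<^sub>M cell_space))"
    and pos: "\<And>D x c. 0 \<le> f D x c"
  defines "h \<equiv> \<lambda>(D, x, \<omega>). ennreal (\<Sum>j<2 ^ p. indicator (cell_box d (bprf_cell \<omega> p j)) x * f D x (bprf_cell \<omega> p j))"
  shows "(\<integral>\<^sup>+u. h u \<partial>(M \<Otimes>\<^sub>M (unif_cube d \<Otimes>\<^sub>M bprf_draws d p)))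
      = (\<integral>\<^sup>+\<omega>. (\<Sum>j<2 ^ p. \<integral>\<^sup>+D. \<integral>\<^sup>+x. ennreal (f D x (bprf_cell \<omega> p j)) * indicator (cell_box d (bprf_cell \<omega> p j)) x
          \<partial>unif_cube d \<partial>M) \<partial>bprf_draws d p)" (is ?A)
    "(\<integral>\<^sup>+D. \<integral>\<^sup>+x. \<integral>\<^sup>+\<omega>. h (D, x, \<omega>) \<partial>bprf_draws d p \<partial>unif_cube d \<partial>M)
      = (\<integral>\<^sup>+u. h u \<partial>(M \<Otimes>\<^sub>M (unif_cube d \<Otimes>\<^sub>M bprf_draws d p)))" (is ?B)
    "h \<in> borel_measurable (M \<Otimes>\<^sub>M (unif_cube d \<Otimes>\<^sub>M bprf_draws d p))" (is ?C)
proof -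
  let ?U = "unif_cube d" let ?W = "bprf_draws d p"
  interpret U: prob_space ?U by (rule prob_space_unif_cube)
  show C: ?C
    using measurable_compose[OF measurable_cell_sum[OF d f, of p] measurable_ennreal]
    unfolding h_def case_prod_beta' .
  note tr = nn_integral_triple[OF M prob_space_unif_cube prob_space_bprf_draws[OF d] C]
  show ?B by (rule tr(1)[symmetric])
  show ?A unfolding tr(2)
  proof (rule nn_integral_cong)
    fix \<omega> assume \<omega>: "\<omega> \<in> space ?W"
    let ?c = "bprf_cell \<omega> p" let ?g = "\<lambda>j D x. ennreal (f D x (?c j)) * indicator (cell_box d (?c j)) x"
    have mg: "(\<lambda>u. ?g j (fst u) (snd u)) \<in> borel_measurable (M \<Otimes>\<^sub>M ?U)" if j: "j < 2 ^ p" for j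
    proof -
      have "(\<lambda>u. (fst u, snd u, ?c j)) \<in> measurable (M \<Otimes>\<^sub>M ?U) (M \<Otimes>\<^sub>M (?U \<Otimes>\<^sub>M cell_space))"
        by (intro measurable_Pair measurable_fst measurable_snd measurable_const) (simp add: space_cell_space)
      from measurable_compose[OF this f]
      have "(\<lambda>u. f (fst u) (snd u) (?c j)) \<in> borel_measurable (M \<Otimes>\<^sub>M ?U)" by simp
      moreover have "(\<lambda>u. indicator (cell_box d (?c j)) (snd u) :: ennreal) \<in> borel_measurable (M \<Otimes>\<^sub>M ?U)"
        using measurable_compose[OF measurable_snd borel_measurable_indicator[OF sets_cell_box[OF valid_bprf_cell[OF \<omega> order_refl j]]]] .
      ultimately show ?thesis by simp
    qed
    have "(\<integral>\<^sup>+D. \<integral>\<^sup>+x. h (D, x, \<omega>) \<partial>?U \<partial>M) = (\<integral>\<^sup>+D. \<integral>\<^sup>+x. (\<Sum>j<2 ^ p. ?g j D x) \<partial>?U \<partial>M)"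
    proof (intro nn_integral_cong)
      fix D x
      have "h (D, x, \<omega>) = (\<Sum>j<2 ^ p. ennreal (indicator (cell_box d (?c j)) x * f D x (?c j)))"
        unfolding h_def prod.case using pos by (intro sum_ennreal[symmetric]) auto
      also have "\<dots> = (\<Sum>j<2 ^ p. ?g j D x)" by (intro sum.cong refl) (simp split: split_indicator)
      finally show "h (D, x, \<omega>) = (\<Sum>j<2 ^ p. ?g j D x)" .
    qed
    also have "\<dots> = (\<integral>\<^sup>+D. (\<Sum>j<2 ^ p. \<integral>\<^sup>+x. ?g j D x \<partial>?U) \<partial>M)"
    proof (intro nn_integral_cong nn_integral_sum)
      fix D j assume "D \<in> space M" "j \<in> {..<2 ^ p :: nat}"
      then show "?g j D \<in> borel_measurable ?U" using measurable_Pair2[OF mg, of j D] by simp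
    qed
    also have "\<dots> = (\<Sum>j<2 ^ p. \<integral>\<^sup>+D. \<integral>\<^sup>+x. ?g j D x \<partial>?U \<partial>M)"
    proof (rule nn_integral_sum)
      fix j assume "j \<in> {..<2 ^ p :: nat}"
      then have "(\<lambda>(D, x). ?g j D x) \<in> borel_measurable (M \<Otimes>\<^sub>M ?U)" using mg[of j] by (simp add: case_prod_beta')
      then show "(\<lambda>D. \<integral>\<^sup>+x. ?g j D x \<partial>?U) \<in> borel_measurable M" by (rule U.borel_measurable_nn_integral)
    qed
    finally show "(\<integral>\<^sup>+D. \<integral>\<^sup>+x. h (D, x, \<omega>) \<partial>?U \<partial>M) = (\<Sum>j<2 ^ p. \<integral>\<^sup>+D. \<integral>\<^sup>+x. ?g j D x \<partial>?U \<partial>M)" .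
  qed
qed

text \<open>
  The passage between the extended nonnegative and the real expectation of a sum over the cells.
\<close>

lemma nn_integral_cells_bounds:
  assumes d: "1 \<le> d" and f: "bounded_cell_fun d f"
  shows "ennreal (cell_mean d p f) \<le> (\<integral>\<^sup>+\<omega>. (\<Sum>j<2 ^ p. ennreal (f (bprf_cell \<omega> p j))) \<partial>bprf_draws d p)"
    "(\<And>c. valid_cell d c \<Longrightarrow> 0 \<le> f c) \<Longrightarrow>
      (\<integral>\<^sup>+\<omega>. (\<Sum>j<2 ^ p. ennreal (f (bprf_cell \<omega> p j))) \<partial>bprf_draws d p) = ennreal (cell_mean d p f)"
proof -
  let ?W = "bprf_draws d p"
  have int: "integrable ?W (\<lambda>\<omega>. \<Sum>j<2 ^ p. g (bprf_cell \<omega> p j))" if "bounded_cell_fun d g" for g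
    by (intro Bochner_Integration.integrable_sum integrable_cell_fun d that) auto
  have eq: "(\<integral>\<^sup>+\<omega>. (\<Sum>j<2 ^ p. ennreal (g (bprf_cell \<omega> p j))) \<partial>?W) = ennreal (cell_mean d p g)"
    if g: "bounded_cell_fun d g" and pos: "\<And>c. valid_cell d c \<Longrightarrow> 0 \<le> g c" for g
  proof -
    have p0: "0 \<le> g (bprf_cell \<omega> p j)" if "\<omega> \<in> space ?W" "j < 2 ^ p" for \<omega> j
      using pos valid_bprf_cell[OF that(1) order_refl that(2)] by blast
    have "(\<integral>\<^sup>+\<omega>. (\<Sum>j<2 ^ p. ennreal (g (bprf_cell \<omega> p j))) \<partial>?W) = (\<integral>\<^sup>+\<omega>. ennreal (\<Sum>j<2 ^ p. g (bprf_cell \<omega> p j)) \<partial>?W)"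
      by (intro nn_integral_cong sum_ennreal) (use p0 in auto)
    also have "\<dots> = ennreal (cell_mean d p g)" unfolding cell_mean_def
      by (intro nn_integral_eq_integral int g AE_I2 sum_nonneg) (use p0 in auto)
    finally show ?thesis .
  qed
  show "(\<And>c. valid_cell d c \<Longrightarrow> 0 \<le> f c) \<Longrightarrow>
      (\<integral>\<^sup>+\<omega>. (\<Sum>j<2 ^ p. ennreal (f (bprf_cell \<omega> p j))) \<partial>?W) = ennreal (cell_mean d p f)"
    by (rule eq[OF f])
  obtain K where K: "\<And>c. valid_cell d c \<Longrightarrow> \<bar>f c\<bar> \<le> K" and fm: "f \<in> borel_measurable cell_space"
    using f by (auto simp: bounded_cell_fun_def)
  have g: "bounded_cell_fun d (\<lambda>c. max 0 (f c))"
  proof (rule bounded_cell_funI[where K = K])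
    fix c assume "valid_cell d c"
    then show "\<bar>max 0 (f c)\<bar> \<le> K" using K[of c] by (auto simp: max_def)
  qed (use fm in measurable)
  have "ennreal (cell_mean d p f) \<le> ennreal (cell_mean d p (\<lambda>c. max 0 (f c)))"
    by (intro ennreal_leI cell_mean_mono d f g) auto
  also have "\<dots> = (\<integral>\<^sup>+\<omega>. (\<Sum>j<2 ^ p. ennreal (max 0 (f (bprf_cell \<omega> p j)))) \<partial>?W)"
    by (rule eq[OF g, symmetric]) simp
  also have "\<dots> = (\<integral>\<^sup>+\<omega>. (\<Sum>j<2 ^ p. ennreal (f (bprf_cell \<omega> p j))) \<partial>?W)"
  proof -
    have "ennreal (max 0 y) = ennreal y" for y :: real by (simp add: max_def ennreal_neg)
    then show ?thesis by (simp only:)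
  qed
  finally show "ennreal (cell_mean d p f) \<le> (\<integral>\<^sup>+\<omega>. (\<Sum>j<2 ^ p. ennreal (f (bprf_cell \<omega> p j))) \<partial>?W)" .
qed

lemma tree_risk_eq:
  assumes d: "1 \<le> d" and R: "regression_law d s \<sigma> P" and s: "s \<in> borel_measurable (unif_cube d)"
  shows "tree_risk d p n s P = (\<integral>\<^sup>+\<omega>. (\<Sum>j<2 ^ p. \<integral>\<^sup>+D. \<integral>\<^sup>+x.
      ennreal ((cell_average n D (cell_box d (bprf_cell \<omega> p j)) - s x)\<^sup>2) * indicator (cell_box d (bprf_cell \<omega> p j)) x
        \<partial>unif_cube d \<partial>sample_law n P) \<partial>bprf_draws d p)"
proof -
  let ?S = "sample_law n P" let ?U = "unif_cube d" let ?W = "bprf_draws d p"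
  define f where "f = (\<lambda>D x c. (cell_average n D (cell_box d c) - s x)\<^sup>2)"
  have f: "(\<lambda>u. f (fst u) (fst (snd u)) (snd (snd u)) :: real) \<in> borel_measurable (?S \<Otimes>\<^sub>M (?U \<Otimes>\<^sub>M cell_space))"
  proof -
    have "(\<lambda>u. (fst u, snd (snd u))) \<in> measurable (?S \<Otimes>\<^sub>M (?U \<Otimes>\<^sub>M cell_space)) (?S \<Otimes>\<^sub>M cell_space)"
      by (intro measurable_Pair measurable_fst measurable_compose[OF measurable_snd measurable_snd])
    from measurable_compose[OF this measurable_cell_average[OF R]]
    have "(\<lambda>u. cell_average n (fst u) (cell_box d (snd (snd u)))) \<in> borel_measurable (?S \<Otimes>\<^sub>M (?U \<Otimes>\<^sub>M cell_space))" by simp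
    moreover have "(\<lambda>u. s (fst (snd u))) \<in> borel_measurable (?S \<Otimes>\<^sub>M (?U \<Otimes>\<^sub>M cell_space))"
      by (intro measurable_compose[OF measurable_compose[OF measurable_snd measurable_fst] s])
    ultimately show ?thesis unfolding f_def by simp
  qed
  have "tree_risk d p n s P = (\<integral>\<^sup>+u. (case u of (D, x, \<omega>) \<Rightarrow>
      ennreal (\<Sum>j<2 ^ p. indicator (cell_box d (bprf_cell \<omega> p j)) x * f D x (bprf_cell \<omega> p j))) \<partial>(?S \<Otimes>\<^sub>M (?U \<Otimes>\<^sub>M ?W)))"
    unfolding tree_risk_def
  proof (rule nn_integral_cong)
    fix u assume u: "u \<in> space (?S \<Otimes>\<^sub>M (?U \<Otimes>\<^sub>M ?W))"
    obtain D x \<omega> where u_eq: "u = (D, x, \<omega>)" by (cases u)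
    have x: "x \<in> cube d" and \<omega>: "\<omega> \<in> space ?W"
      using u unfolding u_eq by (simp_all add: space_pair_measure space_unif_cube)
    obtain i where i: "i < 2 ^ p" "x \<in> cell_box d (bprf_cell \<omega> p i)"
      "\<And>F. (\<Sum>j<2 ^ p. indicator (cell_box d (bprf_cell \<omega> p j)) x * F j) = (F i :: real)"
      using bprf_cell_containing[OF \<omega> x] by metis
    show "(case u of (D, x, \<omega>) \<Rightarrow> ennreal ((tree_estimator (bprf_partition d p \<omega>) n D x - s x)\<^sup>2)) =
         (case u of (D, x, \<omega>) \<Rightarrow> ennreal (\<Sum>j<2 ^ p. indicator (cell_box d (bprf_cell \<omega> p j)) x * f D x (bprf_cell \<omega> p j)))"
      unfolding u_eq prod.case tree_estimator_eq[OF \<omega>] i(3) f_def by simp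
  qed
  also have "\<dots> = (\<integral>\<^sup>+\<omega>. (\<Sum>j<2 ^ p. \<integral>\<^sup>+D. \<integral>\<^sup>+x. ennreal (f D x (bprf_cell \<omega> p j)) * indicator (cell_box d (bprf_cell \<omega> p j)) x
          \<partial>?U \<partial>?S) \<partial>?W)"
    by (rule nn_integral_cell_sum(1)[OF d prob_space_sample_law[OF R] f]) (simp add: f_def)
  finally show ?thesis by (simp add: f_def)
qed

section \<open>Approximation error of the tree\<close>


lemma bounded_cell_fun_add:
  assumes "bounded_cell_fun d f" "bounded_cell_fun d g"
  shows "bounded_cell_fun d (\<lambda>c. f c + g c)"
proof -
  obtain K L where "\<And>c. valid_cell d c \<Longrightarrow> \<bar>f c\<bar> \<le> K" "\<And>c. valid_cell d c \<Longrightarrow> \<bar>g c\<bar> \<le> L"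
    using assms by (auto simp: bounded_cell_fun_def)
  then show ?thesis using assms
    by (intro bounded_cell_funI[where K = "K + L"])
       (auto simp: bounded_cell_fun_def intro: order_trans[OF abs_triangle_ineq add_mono])
qed

lemma bounded_cell_fun_const: "bounded_cell_fun d (\<lambda>_. a)"
  by (rule bounded_cell_funI[where K = "\<bar>a\<bar>"]) auto

lemma bounded_cell_fun_sum:
  assumes "finite I" "\<And>i. i \<in> I \<Longrightarrow> bounded_cell_fun d (f i)"
  shows "bounded_cell_fun d (\<lambda>c. \<Sum>i\<in>I. f i c)"
  using assms by (induction I rule: finite_induct) (auto intro: bounded_cell_fun_add bounded_cell_fun_const)

lemma cell_mean_sum:
  assumes d: "1 \<le> d" and "finite I" "\<And>i. i \<in> I \<Longrightarrow> bounded_cell_fun d (f i)"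
  shows "cell_mean d p (\<lambda>c. \<Sum>i\<in>I. f i c) = (\<Sum>i\<in>I. cell_mean d p (f i))"
  using assms(2,3)
  by (induction I rule: finite_induct)
     (auto simp: cell_mean_const[OF d] cell_mean_add[OF d _ bounded_cell_fun_sum])

lemma bounded_width_sq_at_point: "i < d \<Longrightarrow> bounded_cell_fun d (\<lambda>c. indicator (cell_box d c) x * (width c i)\<^sup>2)"
  unfolding width_def by (rule bounded_cell_fun_at_point[where K = 1]) (auto simp: power_le_one_iff)

lemma cell_diff_le_width:
  "x \<in> cell_box d c \<Longrightarrow> t \<in> cell_box d c \<Longrightarrow> i < d \<Longrightarrow> \<bar>t i - x i\<bar> \<le> width c i"
  unfolding mem_cell_box width_def by (smt (verit))

lemma cell_sum_sq_le:
  assumes "x \<in> cell_box d c" "t \<in> cell_box d c"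
  shows "(\<Sum>i<d. (t i - x i)\<^sup>2) \<le> (\<Sum>i<d. (width c i)\<^sup>2)"
proof (rule sum_mono)
  fix i assume "i \<in> {..<d}"
  then show "(t i - x i)\<^sup>2 \<le> (width c i)\<^sup>2"
    using cell_diff_le_width[OF assms, of i] by (simp add: abs_le_square_iff[symmetric] abs_le_iff)
qed

lemma sum_sq_le: "(\<Sum>i<d. f i)\<^sup>2 \<le> real d * (\<Sum>i<d. (f i)\<^sup>2)" for f :: "nat \<Rightarrow> real"
  using sum_squared_le_sum_of_squares[of f "{..<d}"] by (simp add: mult.commute)

text \<open>
  The gradient is taken at a common point of the cell and of the box \<open>b\<close>; if there is none, the bound is not
  positive.
\<close>

lemma cell_bias_lower:
  assumes T: "taylor_bound d s grad C" and c: "valid_cell d c" and i: "i < d"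
    and b: "valid_cell d b" and g: "0 \<le> g" "\<And>x. x \<in> cell_box d b \<Longrightarrow> g \<le> \<bar>grad x i\<bar>"
  shows "ennreal (g\<^sup>2 / 32 * ((width c i)\<^sup>2 * (\<integral>x. indicator (cell_box d b) x * indicator (cell_box d c) x \<partial>unif_cube d))
       + - (C\<^sup>2 * real d) * (\<Sum>k<d. cell_vol d c * width c k ^ 4))
    \<le> (\<integral>\<^sup>+x. ennreal ((M - s x)\<^sup>2) * indicator (cell_box d c) x \<partial>unif_cube d)"
proof -
  let ?be = "\<integral>x. indicator (cell_box d b) x * indicator (cell_box d c) x \<partial>unif_cube d :: real"
  have C: "0 < C" using T by (simp add: taylor_bound_def)
  have v: "0 \<le> cell_vol d c" using cell_vol_bounds[OF c] by simp
  have neg: "- (C\<^sup>2 * real d) * (\<Sum>k<d. cell_vol d c * width c k ^ 4) \<le> 0"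
    using v by (auto intro!: mult_nonneg_nonneg sum_nonneg)
  show ?thesis
  proof (cases "cell_box d b \<inter> cell_box d c = {}")
    case True
    then have "(\<lambda>x. indicator (cell_box d b) x * indicator (cell_box d c) x :: real) = (\<lambda>x. 0)"
      by (auto simp: indicator_def fun_eq_iff)
    then have be0: "?be = 0" by simp
    show ?thesis unfolding be0 using neg by (simp add: ennreal_neg)
  next
    case False
    then obtain x0 where x0: "x0 \<in> cell_box d b" "x0 \<in> cell_box d c" by blast
    let ?g = "grad x0 i"
    define W where "W = (\<Sum>k<d. (width c k)\<^sup>2)"
    have cub: "x \<in> cube d" if "x \<in> cell_box d c" for x using cell_box_subset_cube[OF c] that by blast
    have lin: "\<bar>s (x(i := t)) - s x - ?g * (t - x i)\<bar> \<le> 2 * C * W"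
      if x: "x \<in> cell_box d c" and y: "x(i := t) \<in> cell_box d c" for x t
    proof -
      have e: "\<bar>s z - s x0 - (\<Sum>k<d. grad x0 k * (z k - x0 k))\<bar> \<le> C * W" if z: "z \<in> cell_box d c" for z
        using taylor_boundD[OF T cub[OF z] cub[OF x0(2)]] cell_sum_sq_le[OF x0(2) z] C
        by (rule_tac order_trans[OF _ mult_left_mono[of _ W C]]) (auto simp: W_def)
      have "(\<Sum>k<d. grad x0 k * ((x(i := t)) k - x0 k))
          = (\<Sum>k<d. grad x0 k * (x k - x0 k) + grad x0 k * ((x(i := x i + (t - x i))) k - x k))"
        by (intro sum.cong) (auto simp: algebra_simps)
      also have "\<dots> = (\<Sum>k<d. grad x0 k * (x k - x0 k)) + ?g * (t - x i)"
        by (simp only: sum.distrib sum_upd_diff[OF i])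
      finally show ?thesis using e[OF x] e[OF y] by linarith
    qed
    have be: "?be \<le> 1 * cell_vol d c"
    proof (rule integral_cell_box_le[OF _ c])
      show "bounded_regression d (indicator (cell_box d b)) 1"
        using sets_cell_box[OF b] by (auto simp: bounded_regression_def)
    qed auto
    have gg: "g\<^sup>2 \<le> ?g\<^sup>2" using g(1) g(2)[OF x0(1)] by (simp add: abs_le_square_iff[symmetric])
    have "g\<^sup>2 / 32 * ((width c i)\<^sup>2 * ?be) \<le> ?g\<^sup>2 / 32 * ((width c i)\<^sup>2 * cell_vol d c)"
      using gg be by (intro mult_mono mult_left_mono divide_right_mono)
        (auto intro!: mult_nonneg_nonneg Bochner_Integration.integral_nonneg)
    moreover have "cell_vol d c * (C\<^sup>2 * W\<^sup>2) \<le> C\<^sup>2 * real d * (\<Sum>k<d. cell_vol d c * width c k ^ 4)"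
    proof -
      have "W\<^sup>2 \<le> real d * (\<Sum>k<d. width c k ^ 4)"
        using sum_sq_le[of "\<lambda>k. (width c k)\<^sup>2" d] by (simp add: W_def flip: power_mult)
      then have "cell_vol d c * C\<^sup>2 * W\<^sup>2 \<le> cell_vol d c * C\<^sup>2 * (real d * (\<Sum>k<d. width c k ^ 4))"
        using v by (intro mult_left_mono) auto
      then show ?thesis by (simp add: sum_distrib_left ac_simps)
    qed
    ultimately have "g\<^sup>2 / 32 * ((width c i)\<^sup>2 * ?be) + - (C\<^sup>2 * real d) * (\<Sum>k<d. cell_vol d c * width c k ^ 4)
        \<le> cell_vol d c * (?g\<^sup>2 * (width c i)\<^sup>2 / 32 - (2 * C * W)\<^sup>2 / 4)"
      by (simp add: algebra_simps power_mult_distrib)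
    then show ?thesis
      using cell_variation_lower[OF c i taylor_measurable[OF T] lin, of M] by (rule_tac order_trans[OF ennreal_leI]) 
  qed
qed

text \<open>
  Integrating \<open>cell_mean_width_sq_at_point\<close> over the box \<open>b\<close> bounds below the expected sum of the squared
  widths, each weighted by the volume that the cell has in common with \<open>b\<close>.
\<close>

lemma cell_mean_width_sq_region:
  fixes d p :: nat and \<eta> :: real
  assumes d: "1 \<le> d" and i: "i < d" and b: "valid_cell d b"
    and eta: "0 < \<eta>" "\<And>x. x \<in> cell_box d b \<Longrightarrow> \<eta> \<le> x i * (1 - x i)"
  defines "L \<equiv> 6 * kappa d ^ p * \<eta> - rho d ^ p / 2"
  defines "F \<equiv> \<lambda>c. (width c i)\<^sup>2 * (\<integral>x. indicator (cell_box d b) x * indicator (cell_box d c) x \<partial>unif_cube d)"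
  shows "bounded_cell_fun d F" and "L * cell_vol d b \<le> cell_mean d p F"
proof -
  let ?U = "unif_cube d" let ?I = "\<lambda>x. indicator (cell_box d b) x :: real"
  interpret U: prob_space ?U by (rule prob_space_unif_cube)
  have br: "bounded_regression d ?I 1"
    using sets_cell_box[OF b] by (auto simp: bounded_regression_def)
  have Imeas: "?I \<in> borel_measurable ?U" using sets_cell_box[OF b] by simp
  have be: "0 \<le> (\<integral>x. ?I x * indicator (cell_box d c) x \<partial>?U)" for c
    by (rule Bochner_Integration.integral_nonneg) simp
  have be1: "(\<integral>x. ?I x * indicator (cell_box d c) x \<partial>?U) \<le> 1" if c: "valid_cell d c" for c
    using integral_cell_box_le[OF br c, of 1] cell_vol_bounds[OF c] by simp
  show F: "bounded_cell_fun d F"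
  proof (rule bounded_cell_funI[where K = 1])
    show "F \<in> borel_measurable cell_space" unfolding F_def
      by (intro borel_measurable_times borel_measurable_power measurable_width measurable_integral_cell_box Imeas)
    fix c assume c: "valid_cell d c"
    have "(width c i)\<^sup>2 \<le> 1" using width_bounds[OF c i] by (simp add: power_le_one)
    then have "F c \<le> 1 * 1" unfolding F_def using be be1[OF c] by (intro mult_mono) auto
    then show "\<bar>F c\<bar> \<le> 1" using be by (simp add: F_def)
  qed
  show "L * cell_vol d b \<le> cell_mean d p F"
  proof (cases "0 \<le> L")
    case False
    have "cell_mean d p (\<lambda>_. 0) \<le> cell_mean d p F"
      by (intro cell_mean_mono d F bounded_cell_fun_const) (use be in \<open>auto simp: F_def\<close>)
    then show ?thesis using False cell_vol_bounds[OF b] cell_mean_const[OF d, of p 0]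
      by (auto intro: order_trans[OF mult_nonpos_nonneg])
  next
    case True
    \<comment> \<open>No sample is involved; a second, unused point takes its place.\<close>
    define f where "f = (\<lambda>(D :: nat \<Rightarrow> real) x c. ?I x * (width c i)\<^sup>2)"
    have fm: "(\<lambda>u. f (fst u) (fst (snd u)) (snd (snd u))) \<in> borel_measurable (?U \<Otimes>\<^sub>M (?U \<Otimes>\<^sub>M cell_space))"
      unfolding f_def
      by (intro borel_measurable_times borel_measurable_power
          measurable_compose[OF measurable_compose[OF measurable_snd measurable_fst] Imeas]
          measurable_compose[OF measurable_compose[OF measurable_snd measurable_snd] measurable_width])
    note S = nn_integral_cell_sum[OF d U.prob_space_axioms fm, where p = p]
    have "ennreal (L * cell_vol d b) = (\<integral>\<^sup>+x. ennreal L * indicator (cell_box d b) x \<partial>?U)"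
      using True sets_cell_box[OF b] by (simp add: nn_integral_cmult_indicator emeasure_cell_box[OF b] ennreal_mult')
    also have "\<dots> = (\<integral>\<^sup>+D. \<integral>\<^sup>+x. ennreal L * indicator (cell_box d b) x \<partial>?U \<partial>?U)"
      by (simp add: U.emeasure_space_1)
    also have "\<dots> \<le> (\<integral>\<^sup>+D. \<integral>\<^sup>+x. \<integral>\<^sup>+\<omega>. ennreal (\<Sum>j<2 ^ p. indicator (cell_box d (bprf_cell \<omega> p j)) x * f D x (bprf_cell \<omega> p j))
        \<partial>bprf_draws d p \<partial>?U \<partial>?U)"
    proof (intro nn_integral_mono)
      fix D x assume x: "x \<in> space ?U"
      show "ennreal L * indicator (cell_box d b) x
        \<le> (\<integral>\<^sup>+\<omega>. ennreal (\<Sum>j<2 ^ p. indicator (cell_box d (bprf_cell \<omega> p j)) x * f D x (bprf_cell \<omega> p j)) \<partial>bprf_draws d p)"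
      proof (cases "x \<in> cell_box d b")
        case xb: True
        have xc: "x \<in> cube d" using x by (simp add: space_unif_cube)
        let ?q = "x i * (1 - x i)"
        have r: "0 \<le> rho d" "0 \<le> kappa d" using d by (auto simp: field_simps)
        have "?q \<le> 1 / 4" using zero_le_power2[of "x i - 1 / 2"] by (simp add: power2_eq_square algebra_simps)
        then have "rho d ^ p * (- (1 / 2)) \<le> rho d ^ p * (1 - 6 * ?q)"
          using r by (intro mult_left_mono) auto
        moreover have "6 * kappa d ^ p * \<eta> \<le> 6 * kappa d ^ p * ?q"
          using eta(2)[OF xb] r by (intro mult_left_mono) auto
        ultimately have "L \<le> cell_mean d p (\<lambda>c. indicator (cell_box d c) x * (width c i)\<^sup>2)"
          unfolding cell_mean_width_sq_at_point[OF d i xc] L_def by linarith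
        then have "ennreal L \<le> ennreal (cell_mean d p (\<lambda>c. indicator (cell_box d c) x * (width c i)\<^sup>2))"
          by (rule ennreal_leI)
        also have "\<dots> = (\<integral>\<^sup>+\<omega>. (\<Sum>j<2 ^ p. ennreal (indicator (cell_box d (bprf_cell \<omega> p j)) x * (width (bprf_cell \<omega> p j) i)\<^sup>2)) \<partial>bprf_draws d p)"
          by (rule nn_integral_cells_bounds(2)[OF d bounded_width_sq_at_point[OF i], symmetric]) simp
        also have "\<dots> = (\<integral>\<^sup>+\<omega>. ennreal (\<Sum>j<2 ^ p. indicator (cell_box d (bprf_cell \<omega> p j)) x * f D x (bprf_cell \<omega> p j)) \<partial>bprf_draws d p)"
          using xb by (intro nn_integral_cong) (simp add: f_def)
        finally show ?thesis using xb by simp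
      qed simp
    qed
    also have "\<dots> = (\<integral>\<^sup>+\<omega>. (\<Sum>j<2 ^ p. \<integral>\<^sup>+D. \<integral>\<^sup>+x. ennreal (f D x (bprf_cell \<omega> p j)) * indicator (cell_box d (bprf_cell \<omega> p j)) x
          \<partial>?U \<partial>?U) \<partial>bprf_draws d p)"
      using S(1,2) by (simp add: f_def)
    also have "\<dots> = (\<integral>\<^sup>+\<omega>. (\<Sum>j<2 ^ p. ennreal (F (bprf_cell \<omega> p j))) \<partial>bprf_draws d p)"
    proof (intro nn_integral_cong sum.cong refl)
      fix \<omega> j assume \<omega>: "\<omega> \<in> space (bprf_draws d p)" and j: "j \<in> {..<2 ^ p :: nat}"
      let ?c = "bprf_cell \<omega> p j"
      have c: "valid_cell d ?c" using valid_bprf_cell[OF \<omega> order_refl] j by simp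
      have "(\<integral>\<^sup>+x. ennreal (f D x ?c) * indicator (cell_box d ?c) x \<partial>?U) = ennreal (F ?c)" for D
      proof -
        have "(\<integral>\<^sup>+x. ennreal (f D x ?c) * indicator (cell_box d ?c) x \<partial>?U)
            = (\<integral>\<^sup>+x. ennreal ((width ?c i)\<^sup>2 * (?I x * indicator (cell_box d ?c) x)) \<partial>?U)"
          by (intro nn_integral_cong) (auto simp: f_def split: split_indicator)
        also have "\<dots> = ennreal (\<integral>x. (width ?c i)\<^sup>2 * (?I x * indicator (cell_box d ?c) x) \<partial>?U)"
          by (intro nn_integral_eq_integral integrable_mult_right integrable_cell_box[OF br c]) auto
        finally show ?thesis by (simp add: F_def)
      qed
      then show "(\<integral>\<^sup>+D. \<integral>\<^sup>+x. ennreal (f D x ?c) * indicator (cell_box d ?c) x \<partial>?U \<partial>?U) = ennreal (F ?c)"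
        by (simp add: U.emeasure_space_1)
    qed
    also have "\<dots> = ennreal (cell_mean d p F)"
      by (rule nn_integral_cells_bounds(2)[OF d F]) (use be in \<open>simp add: F_def\<close>)
    finally show ?thesis
    proof (subst (asm) ennreal_le_iff)
      have "cell_mean d p (\<lambda>_. 0) \<le> cell_mean d p F"
        by (intro cell_mean_mono d F bounded_cell_fun_const) (use be in \<open>auto simp: F_def\<close>)
      then show "0 \<le> cell_mean d p F" using cell_mean_const[OF d, of p 0] by simp
    qed
  qed
qed

text \<open>
  For any sample, the error of the tree is at least the variation of \<open>s\<close> inside its cells. The first term
  comes from the cells that meet the box \<open>b\<close>, the last one from the Taylor remainders.
\<close>

lemma tree_risk_ge_bias:
  assumes d: "1 \<le> d" and R: "regression_law d s \<sigma> P" and T: "taylor_bound d s grad C"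
    and i: "i < d" and b: "valid_cell d b" and g: "0 \<le> g" "\<And>x. x \<in> cell_box d b \<Longrightarrow> g \<le> \<bar>grad x i\<bar>"
    and eta: "0 < \<eta>" "\<And>x. x \<in> cell_box d b \<Longrightarrow> \<eta> \<le> x i * (1 - x i)"
  shows "ennreal (g\<^sup>2 / 32 * ((6 * kappa d ^ p * \<eta> - rho d ^ p / 2) * cell_vol d b)
     - C\<^sup>2 * (real d)\<^sup>2 * rho d ^ p) \<le> tree_risk d p n s P"
proof -
  let ?U = "unif_cube d" let ?S = "sample_law n P"
  interpret S: prob_space ?S by (rule prob_space_sample_law[OF R])
  define F where "F = (\<lambda>c. (width c i)\<^sup>2 * (\<integral>x. indicator (cell_box d b) x * indicator (cell_box d c) x \<partial>?U))"
  have F: "bounded_cell_fun d F"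
    unfolding F_def by (rule cell_mean_width_sq_region(1)[where \<eta> = \<eta>]) (fact d i b eta)+
  have F2: "(6 * kappa d ^ p * \<eta> - rho d ^ p / 2) * cell_vol d b \<le> cell_mean d p F"
    unfolding F_def by (rule cell_mean_width_sq_region(2)) (fact d i b eta)+
  let ?V = "\<lambda>c. \<Sum>k<d. cell_vol d c * width c k ^ 4"
  let ?L = "\<lambda>c. g\<^sup>2 / 32 * F c + - (C\<^sup>2 * real d) * ?V c"
  have V: "bounded_cell_fun d ?V" by (intro bounded_cell_fun_sum bounded_vol_width4) auto
  have L: "bounded_cell_fun d ?L"
    by (intro bounded_cell_fun_add bounded_cell_fun_cmult F V)
  have "cell_mean d p ?V = (\<Sum>k<d. rho d ^ p)"
    by (subst cell_mean_sum[OF d]) (auto simp: bounded_vol_width4 cell_mean_vol_width4[OF d] intro!: sum.cong)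
  then have "cell_mean d p ?L = g\<^sup>2 / 32 * cell_mean d p F - C\<^sup>2 * (real d)\<^sup>2 * rho d ^ p"
    unfolding cell_mean_add[OF d bounded_cell_fun_cmult[OF F] bounded_cell_fun_cmult[OF V]] cell_mean_cmult
    by (simp add: power2_eq_square)
  moreover have "g\<^sup>2 / 32 * ((6 * kappa d ^ p * \<eta> - rho d ^ p / 2) * cell_vol d b)
      \<le> g\<^sup>2 / 32 * cell_mean d p F"
    by (intro mult_left_mono F2) simp
  ultimately have "ennreal (g\<^sup>2 / 32 * ((6 * kappa d ^ p * \<eta> - rho d ^ p / 2) * cell_vol d b)
     - C\<^sup>2 * (real d)\<^sup>2 * rho d ^ p) \<le> ennreal (cell_mean d p ?L)"
    by (intro ennreal_leI) linarith
  also have "\<dots> \<le> (\<integral>\<^sup>+\<omega>. (\<Sum>j<2 ^ p. ennreal (?L (bprf_cell \<omega> p j))) \<partial>bprf_draws d p)"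
    by (rule nn_integral_cells_bounds(1)[OF d L])
  also have "\<dots> \<le> (\<integral>\<^sup>+\<omega>. (\<Sum>j<2 ^ p. \<integral>\<^sup>+D. \<integral>\<^sup>+x.
      ennreal ((cell_average n D (cell_box d (bprf_cell \<omega> p j)) - s x)\<^sup>2) * indicator (cell_box d (bprf_cell \<omega> p j)) x
        \<partial>?U \<partial>?S) \<partial>bprf_draws d p)"
  proof (intro nn_integral_mono sum_mono)
    fix \<omega> j assume \<omega>: "\<omega> \<in> space (bprf_draws d p)" and j: "j \<in> {..<2 ^ p :: nat}"
    let ?c = "bprf_cell \<omega> p j"
    have c: "valid_cell d ?c" using valid_bprf_cell[OF \<omega> order_refl] j by simp
    have "ennreal (?L ?c) = (\<integral>\<^sup>+D. ennreal (?L ?c) \<partial>?S)" by (simp add: S.emeasure_space_1)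
    also have "\<dots> \<le> (\<integral>\<^sup>+D. \<integral>\<^sup>+x. ennreal ((cell_average n D (cell_box d ?c) - s x)\<^sup>2) * indicator (cell_box d ?c) x \<partial>?U \<partial>?S)"
      by (intro nn_integral_mono) (use cell_bias_lower[OF T c i b g] in \<open>simp add: F_def\<close>)
    finally show "ennreal (?L ?c) \<le> \<dots>" .
  qed
  also have "\<dots> = tree_risk d p n s P" by (rule tree_risk_eq[OF d R taylor_measurable[OF T], symmetric])
  finally show ?thesis .
qed

text \<open>
  Pythagoras: the deviation of \<open>s\<close> from a constant \<open>M\<close> is the deviation from its mean plus that of the mean
  from \<open>M\<close>.
\<close>

lemma cell_square_decomposition:
  assumes s: "bounded_regression d s K" and c: "valid_cell d c"
  shows "(\<integral>\<^sup>+x. ennreal ((M - s x)\<^sup>2) * indicator (cell_box d c) x \<partial>unif_cube d)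
    = ennreal (cell_vol d c * (M - cell_value d s c)\<^sup>2
        + (\<integral>x. (s x - cell_value d s c)\<^sup>2 * indicator (cell_box d c) x \<partial>unif_cube d))"
proof -
  let ?U = "unif_cube d" let ?I = "\<lambda>x. indicator (cell_box d c) x :: real" let ?m = "cell_value d s c"
  have sq: "bounded_regression d (\<lambda>x. (a - s x)\<^sup>2) ((\<bar>a\<bar> + K)\<^sup>2)" for a
    unfolding bounded_regression_def
  proof (intro conjI ballI)
    show "(\<lambda>x. (a - s x)\<^sup>2) \<in> borel_measurable ?U" using bounded_regressionD(1)[OF s] by simp
    fix x assume "x \<in> cube d"
    then have "\<bar>a - s x\<bar> \<le> \<bar>a\<bar> + K" using bounded_regressionD(2)[OF s, of x] by linarith
    then have "\<bar>a - s x\<bar>\<^sup>2 \<le> (\<bar>a\<bar> + K)\<^sup>2" by (intro power_mono) auto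
    then show "\<bar>(a - s x)\<^sup>2\<bar> \<le> (\<bar>a\<bar> + K)\<^sup>2" by simp
  qed
  note i1 = integrable_cell_box[OF s c] and i2 = integrable_cell_box[OF sq[of ?m] c]
    and i3 = integral_indicator_cell_box[OF c]
  have "(\<integral>\<^sup>+x. ennreal ((M - s x)\<^sup>2) * indicator (cell_box d c) x \<partial>?U) = (\<integral>\<^sup>+x. ennreal ((M - s x)\<^sup>2 * ?I x) \<partial>?U)"
    by (intro nn_integral_cong) (auto split: split_indicator)
  also have "\<dots> = ennreal (\<integral>x. (M - s x)\<^sup>2 * ?I x \<partial>?U)"
    by (rule nn_integral_eq_integral[OF integrable_cell_box[OF sq c]]) simp
  also have "(\<integral>x. (M - s x)\<^sup>2 * ?I x \<partial>?U)
      = (\<integral>x. ((M - ?m)\<^sup>2 + 2 * (M - ?m) * ?m) * ?I x - 2 * (M - ?m) * (s x * ?I x) + (?m - s x)\<^sup>2 * ?I x \<partial>?U)"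
    by (intro Bochner_Integration.integral_cong) (auto simp: power2_eq_square algebra_simps)
  also have "\<dots> = ((M - ?m)\<^sup>2 + 2 * (M - ?m) * ?m) * cell_vol d c - 2 * (M - ?m) * (?m * cell_vol d c)
      + (\<integral>x. (?m - s x)\<^sup>2 * ?I x \<partial>?U)"
    using i1 i2 i3 cell_value_mult[OF s c] by simp
  also have "\<dots> = cell_vol d c * (M - ?m)\<^sup>2 + (\<integral>x. (s x - ?m)\<^sup>2 * ?I x \<partial>?U)"
    by (simp add: algebra_simps power2_commute[of ?m])
  finally show ?thesis .
qed

section \<open>Estimation error of the cells\<close>


lemma power_one_minus_le_exp:
  fixes q :: real
  assumes "0 \<le> q" "q \<le> 1" shows "(1 - q) ^ n \<le> exp (- (real n * q))"
proof -
  have "(1 - q) ^ n \<le> exp (- q) ^ n" using assms exp_ge_add_one_self[of "- q"] by (intro power_mono) auto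
  also have "\<dots> = exp (- (real n * q))" by (simp flip: exp_of_nat_mult)
  finally show ?thesis .
qed

lemma cell_risk:
  assumes R: "regression_law d s \<sigma> P" and s: "bounded_regression d s K" and c: "valid_cell d c"
    and q: "0 < cell_vol d c"
  obtains V where "0 \<le> V" "V * cell_vol d c = (\<integral>x. (s x - cell_value d s c)\<^sup>2 * indicator (cell_box d c) x \<partial>unif_cube d)"
    "(\<integral>\<^sup>+D. ennreal ((cell_average n D (cell_box d c) - cell_value d s c)\<^sup>2) \<partial>sample_law n P)
      = ennreal ((\<sigma>\<^sup>2 + V) * bin_mean n (cell_vol d c) (\<lambda>k. inverse (real k)) + (cell_value d s c)\<^sup>2 * (1 - cell_vol d c) ^ n)"
proof -
  let ?I = "\<integral>x. (s x - cell_value d s c)\<^sup>2 * indicator (cell_box d c) x \<partial>unif_cube d"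
  define V where "V = ?I / cell_vol d c"
  have "0 \<le> ?I" by (rule Bochner_Integration.integral_nonneg) simp
  then have V0: "0 \<le> V" using q by (simp add: V_def)
  have Vq: "V * cell_vol d c = ?I" using q by (simp add: V_def)
  show ?thesis
    by (rule that[OF V0 Vq cell_average_risk[OF R bounded_regressionD[OF s] sets_cell_box[OF c]
          measure_cell_box[OF c, symmetric] q cell_value_mult[OF s c] Vq]])
qed

lemma measurable_cell_average_sample:
  assumes R: "regression_law d s \<sigma> P"
  shows "(\<lambda>D. cell_average n D (cell_box d c)) \<in> borel_measurable (sample_law n P)"
proof -
  have "(\<lambda>D. (D, c)) \<in> measurable (sample_law n P) (sample_law n P \<Otimes>\<^sub>M cell_space)"
    by (intro measurable_Pair measurable_const) (simp_all add: space_cell_space)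
  from measurable_compose[OF this measurable_cell_average[OF R]] show ?thesis by simp
qed

text \<open>
  A cell of volume at least \<open>1 / n\<close> contributes at least \<open>\<sigma>^2 / (4 n)\<close>. The indicator of the smaller cells is
  replaced by a negative power of the shifted volume, whose expectation is under control.
\<close>

lemma cell_risk_ge_noise:
  assumes R: "regression_law d s \<sigma> P" and s: "bounded_regression d s K" and c: "valid_cell d c"
    and n: "1 \<le> n" and k: "0 \<le> k"
  shows "ennreal (\<sigma>\<^sup>2 / (4 * real n) * (1 - (2 / real n) powr k * (cell_vol d c + 1 / real n) powr - k))
    \<le> (\<integral>\<^sup>+D. \<integral>\<^sup>+x. ennreal ((cell_average n D (cell_box d c) - s x)\<^sup>2) * indicator (cell_box d c) x
          \<partial>unif_cube d \<partial>sample_law n P)"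
proof -
  let ?q = "cell_vol d c"
  have n0: "0 < real n" using n by simp
  have q01: "0 \<le> ?q" "?q \<le> 1" by (rule cell_vol_bounds[OF c])+
  show ?thesis
  proof (cases "?q < 1 / real n")
    case True
    have "(2 / real n) powr - k \<le> (?q + 1 / real n) powr - k"
      using True q01 n0 k by (intro powr_mono2') (auto intro: add_nonneg_pos)
    then have "(2 / real n) powr k * (2 / real n) powr - k \<le> (2 / real n) powr k * (?q + 1 / real n) powr - k"
      by (intro mult_left_mono) auto
    then have "1 \<le> (2 / real n) powr k * (?q + 1 / real n) powr - k"
      using n0 by (simp flip: powr_add)
    then have "\<sigma>\<^sup>2 / (4 * real n) * (1 - (2 / real n) powr k * (?q + 1 / real n) powr - k) \<le> 0"
      using n0 by (intro mult_nonneg_nonpos) auto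
    then show ?thesis by (simp add: ennreal_neg)
  next
    case False
    then have nq: "1 \<le> real n * ?q" "0 < ?q" using n0 by (auto simp: field_simps intro: less_le_trans[of 0 "1 / real n"])
    obtain V where V: "0 \<le> V"
      "(\<integral>\<^sup>+D. ennreal ((cell_average n D (cell_box d c) - cell_value d s c)\<^sup>2) \<partial>sample_law n P)
      = ennreal ((\<sigma>\<^sup>2 + V) * bin_mean n ?q (\<lambda>k. inverse (real k)) + (cell_value d s c)\<^sup>2 * (1 - ?q) ^ n)"
      using cell_risk[OF R s c nq(2), of n thesis] by blast
    let ?A = "bin_mean n ?q (\<lambda>k. inverse (real k))"
    have "(1 - ?q) ^ n \<le> exp (- (real n * ?q))" by (rule power_one_minus_le_exp[OF q01])
    also have "\<dots> \<le> exp (- 1)" using nq by simp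
    also have "\<dots> \<le> 1 / 2" using exp_ge_add_one_self[of 1] by (simp add: exp_minus field_simps)
    finally have "(1 / 2)\<^sup>2 \<le> (1 - (1 - ?q) ^ n)\<^sup>2" by (intro power_mono) auto
    then have "1 / (4 * real n) \<le> (1 - (1 - ?q) ^ n)\<^sup>2 / real n"
      using n0 by (simp add: power2_eq_square field_simps)
    also have "\<dots> \<le> ?q * ?A" by (rule bin_mean_inverse_ge[OF nq(2) q01(2) n])
    finally have qA: "1 / (4 * real n) \<le> ?q * ?A" .
    have A0: "0 \<le> ?A"
      using bin_mean_mono[OF q01, of "\<lambda>_. 0" "\<lambda>k. inverse (real k)" n] by (simp add: bin_mean_const)
    have "\<sigma>\<^sup>2 / (4 * real n) * (1 - (2 / real n) powr k * (?q + 1 / real n) powr - k) \<le> \<sigma>\<^sup>2 / (4 * real n) * 1"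
      using n0 by (intro mult_left_mono) auto
    also have "\<dots> = \<sigma>\<^sup>2 * (1 / (4 * real n))" by simp
    also have "\<dots> \<le> \<sigma>\<^sup>2 * (?q * ?A)" using qA by (intro mult_left_mono) auto
    also have "\<dots> \<le> ?q * ((\<sigma>\<^sup>2 + V) * ?A + (cell_value d s c)\<^sup>2 * (1 - ?q) ^ n)"
      using V(1) A0 q01 by (simp add: algebra_simps)
    finally have "ennreal (\<sigma>\<^sup>2 / (4 * real n) * (1 - (2 / real n) powr k * (?q + 1 / real n) powr - k))
        \<le> ennreal ?q * ennreal ((\<sigma>\<^sup>2 + V) * ?A + (cell_value d s c)\<^sup>2 * (1 - ?q) ^ n)"
      using q01 by (subst ennreal_mult'[symmetric]) (auto intro: ennreal_leI)
    also have "\<dots> = ennreal ?q * (\<integral>\<^sup>+D. ennreal ((cell_average n D (cell_box d c) - cell_value d s c)\<^sup>2) \<partial>sample_law n P)"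
      unfolding V(2) ..
    also have "\<dots> = (\<integral>\<^sup>+D. ennreal ?q * ennreal ((cell_average n D (cell_box d c) - cell_value d s c)\<^sup>2) \<partial>sample_law n P)"
      using measurable_cell_average_sample[OF R, of n c] by (intro nn_integral_cmult[symmetric]) simp
    also have "\<dots> \<le> (\<integral>\<^sup>+D. \<integral>\<^sup>+x. ennreal ((cell_average n D (cell_box d c) - s x)\<^sup>2) * indicator (cell_box d c) x
          \<partial>unif_cube d \<partial>sample_law n P)"
      unfolding cell_square_decomposition[OF s c]
      using q01 by (intro nn_integral_mono) (auto simp flip: ennreal_mult' intro!: ennreal_leI)
    finally show ?thesis .
  qed
qed

lemma tree_risk_ge_noise:
  assumes d: "1 \<le> d" and R: "regression_law d s \<sigma> P" and s: "bounded_regression d s K"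
    and n: "1 \<le> n" and k: "0 \<le> k" "k < 1"
  shows "ennreal (\<sigma>\<^sup>2 / (4 * real n) * (2 ^ p - (2 / real n) powr k * (2 / (1 - k)) ^ p)) \<le> tree_risk d p n s P"
proof -
  let ?f = "\<lambda>c. (cell_vol d c + 1 / real n) powr - k"
  let ?F = "\<lambda>c. \<sigma>\<^sup>2 / (4 * real n) * (1 + (- ((2 / real n) powr k)) * ?f c)"
  have n0: "0 < 1 / real n" using n by simp
  have f: "bounded_cell_fun d ?f" by (rule bounded_cell_fun_vol_powr[OF n0 k(1)])
  have F: "bounded_cell_fun d ?F"
    by (intro bounded_cell_fun_cmult bounded_cell_fun_add bounded_cell_fun_const f)
  have "cell_mean d p ?F = \<sigma>\<^sup>2 / (4 * real n) * (2 ^ p + (- ((2 / real n) powr k)) * cell_mean d p ?f)"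
    unfolding cell_mean_cmult cell_mean_add[OF d bounded_cell_fun_const bounded_cell_fun_cmult[OF f]]
      cell_mean_const[OF d] by simp
  moreover have "(2 / real n) powr k * cell_mean d p ?f \<le> (2 / real n) powr k * (2 / (1 - k)) ^ p"
    by (intro mult_left_mono cell_mean_vol_powr[OF d n0 k]) auto
  then have "2 ^ p - (2 / real n) powr k * (2 / (1 - k)) ^ p \<le> 2 ^ p + (- ((2 / real n) powr k)) * cell_mean d p ?f"
    by simp
  then have "\<sigma>\<^sup>2 / (4 * real n) * (2 ^ p - (2 / real n) powr k * (2 / (1 - k)) ^ p)
      \<le> \<sigma>\<^sup>2 / (4 * real n) * (2 ^ p + (- ((2 / real n) powr k)) * cell_mean d p ?f)"
    by (rule mult_left_mono) simp
  ultimately have "\<sigma>\<^sup>2 / (4 * real n) * (2 ^ p - (2 / real n) powr k * (2 / (1 - k)) ^ p) \<le> cell_mean d p ?F"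
    by (simp only:)
  then have "ennreal (\<sigma>\<^sup>2 / (4 * real n) * (2 ^ p - (2 / real n) powr k * (2 / (1 - k)) ^ p)) \<le> ennreal (cell_mean d p ?F)"
    by (rule ennreal_leI)
  also have "\<dots> \<le> (\<integral>\<^sup>+\<omega>. (\<Sum>j<2 ^ p. ennreal (?F (bprf_cell \<omega> p j))) \<partial>bprf_draws d p)"
    by (rule nn_integral_cells_bounds(1)[OF d F])
  also have "\<dots> \<le> (\<integral>\<^sup>+\<omega>. (\<Sum>j<2 ^ p. \<integral>\<^sup>+D. \<integral>\<^sup>+x.
      ennreal ((cell_average n D (cell_box d (bprf_cell \<omega> p j)) - s x)\<^sup>2) * indicator (cell_box d (bprf_cell \<omega> p j)) x
        \<partial>unif_cube d \<partial>sample_law n P) \<partial>bprf_draws d p)"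
  proof (intro nn_integral_mono sum_mono)
    fix \<omega> j assume \<omega>: "\<omega> \<in> space (bprf_draws d p)" and j: "j \<in> {..<2 ^ p :: nat}"
    have c: "valid_cell d (bprf_cell \<omega> p j)" using valid_bprf_cell[OF \<omega> order_refl] j by simp
    show "ennreal (?F (bprf_cell \<omega> p j)) \<le> (\<integral>\<^sup>+D. \<integral>\<^sup>+x.
      ennreal ((cell_average n D (cell_box d (bprf_cell \<omega> p j)) - s x)\<^sup>2) * indicator (cell_box d (bprf_cell \<omega> p j)) x
        \<partial>unif_cube d \<partial>sample_law n P)"
      using cell_risk_ge_noise[OF R s c n k(1)] by simp
  qed
  also have "\<dots> = tree_risk d p n s P" by (rule tree_risk_eq[OF d R bounded_regressionD(1)[OF s], symmetric])
  finally show ?thesis .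
qed

text \<open>
  With \<open>x = n q\<close>, this is \<open>x exp (- x) \<le> 2 / (x + 1) \<le> 2 (x + 1) powr (- k)\<close>.
\<close>

lemma empty_cell_bound:
  fixes q k :: real
  assumes q: "0 \<le> q" "q \<le> 1" and n: "1 \<le> n" and k: "0 \<le> k" "k \<le> 1"
  shows "q * (1 - q) ^ n \<le> 2 / real n * (real n powr - k * (q + 1 / real n) powr - k)"
proof -
  let ?x = "real n * q"
  have n0: "0 < real n" using n by simp
  have x: "0 \<le> ?x" using q by simp
  have "real n powr - k * (q + 1 / real n) powr - k = (real n * (q + 1 / real n)) powr - k"
    using q n0 by (subst powr_mult) (auto intro: add_nonneg_nonneg)
  also have "real n * (q + 1 / real n) = ?x + 1" using n0 by (simp add: field_simps)
  finally have 1: "real n powr - k * (q + 1 / real n) powr - k = (?x + 1) powr - k" .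
  have 2: "inverse (?x + 1) \<le> (?x + 1) powr - k"
  proof -
    have "(?x + 1) powr - 1 \<le> (?x + 1) powr - k" using x k by (intro powr_mono) auto
    then show ?thesis using x by (simp add: powr_minus)
  qed
  have "?x * (?x + 1) \<le> 2 * exp ?x"
    using exp_lower_Taylor_quadratic[OF x] x by (simp add: power2_eq_square algebra_simps)
  then have 3: "?x * exp (- ?x) \<le> 2 * inverse (?x + 1)"
    using x by (simp add: exp_minus field_simps)
  have "real n * (q * (1 - q) ^ n) \<le> ?x * exp (- ?x)"
    using power_one_minus_le_exp[OF q, of n] x by (simp add: mult_left_mono flip: mult.assoc)
  also have "\<dots> \<le> 2 * (?x + 1) powr - k" using 2 3 by linarith
  finally show ?thesis unfolding 1 using n0 by (simp add: field_simps)
qed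

text \<open>
  A bound for the estimation error of a cell. The first term contains the noise and the variance of \<open>s\<close> over
  the cell, where \<open>L\<close> is a Lipschitz constant; the second one is the risk \<open>K^2 q (1 - q)^n\<close> of an empty cell,
  bounded by a negative power of the shifted volume.
\<close>

definition cell_risk_bound :: "nat \<Rightarrow> nat \<Rightarrow> real \<Rightarrow> real \<Rightarrow> real \<Rightarrow> real \<Rightarrow> cell \<Rightarrow> real" where
  "cell_risk_bound d n \<sigma> K L k c = 2 / real n * (\<sigma>\<^sup>2 + L\<^sup>2 * real d * (\<Sum>i<d. (width c i)\<^sup>2))
     + K\<^sup>2 * (2 / real n * real n powr - k) * (cell_vol d c + 1 / real n) powr - k"

lemma cell_risk_le:
  assumes R: "regression_law d s \<sigma> P" and s: "bounded_regression d s K" and c: "valid_cell d c"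
    and n: "1 \<le> n" and k: "0 \<le> k" "k \<le> 1" and K: "0 \<le> K" and L0: "0 \<le> L"
    and L: "\<And>x t. x \<in> cube d \<Longrightarrow> t \<in> cube d \<Longrightarrow> \<bar>s t - s x\<bar> \<le> L * (\<Sum>i<d. \<bar>t i - x i\<bar>)"
  shows "(\<integral>\<^sup>+D. \<integral>\<^sup>+x. ennreal ((cell_average n D (cell_box d c) - cell_value d s c)\<^sup>2) * indicator (cell_box d c) x
      \<partial>unif_cube d \<partial>sample_law n P) \<le> ennreal (cell_risk_bound d n \<sigma> K L k c)"
proof -
  let ?q = "cell_vol d c" let ?m = "cell_value d s c"
  let ?J = "\<integral>\<^sup>+D. ennreal ((cell_average n D (cell_box d c) - ?m)\<^sup>2) \<partial>sample_law n P"
  have q01: "0 \<le> ?q" "?q \<le> 1" by (rule cell_vol_bounds[OF c])+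
  have n0: "0 < real n" using n by simp
  have "(\<integral>\<^sup>+D. \<integral>\<^sup>+x. ennreal ((cell_average n D (cell_box d c) - ?m)\<^sup>2) * indicator (cell_box d c) x \<partial>unif_cube d \<partial>sample_law n P)
      = (\<integral>\<^sup>+D. ennreal ((cell_average n D (cell_box d c) - ?m)\<^sup>2) * ennreal ?q \<partial>sample_law n P)"
    by (intro nn_integral_cong) (simp add: nn_integral_cmult_indicator[OF sets_cell_box[OF c]] emeasure_cell_box[OF c])
  also have "\<dots> = ?J * ennreal ?q"
    using measurable_cell_average_sample[OF R, of n c] by (intro nn_integral_multc) simp
  also have "\<dots> \<le> ennreal (cell_risk_bound d n \<sigma> K L k c)"
  proof (cases "?q = 0")
    case False
    then have q: "0 < ?q" using q01 by simp
    obtain V where V: "0 \<le> V" "V * ?q = (\<integral>x. (s x - ?m)\<^sup>2 * indicator (cell_box d c) x \<partial>unif_cube d)"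
      "?J = ennreal ((\<sigma>\<^sup>2 + V) * bin_mean n ?q (\<lambda>k. inverse (real k)) + ?m\<^sup>2 * (1 - ?q) ^ n)"
      using cell_risk[OF R s c q, of n thesis] by blast
    let ?A = "bin_mean n ?q (\<lambda>k. inverse (real k))"
    let ?W = "L\<^sup>2 * real d * (\<Sum>i<d. (width c i)\<^sup>2)"
    have cub: "x \<in> cube d" if "x \<in> cell_box d c" for x using cell_box_subset_cube[OF c] that by blast
    have dev: "\<bar>s t - s x\<bar> \<le> L * (\<Sum>i<d. width c i)" if "x \<in> cell_box d c" "t \<in> cell_box d c" for x t
    proof -
      have "\<bar>s t - s x\<bar> \<le> L * (\<Sum>i<d. \<bar>t i - x i\<bar>)" by (rule L[OF cub cub, OF that])
      also have "\<dots> \<le> L * (\<Sum>i<d. width c i)"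
      proof (intro mult_left_mono sum_mono L0)
        show "\<bar>t i - x i\<bar> \<le> width c i" if "i \<in> {..<d}" for i
          using cell_diff_le_width[OF \<open>x \<in> cell_box d c\<close> \<open>t \<in> cell_box d c\<close>] that by simp
      qed
      finally show ?thesis .
    qed
    have dm: "\<bar>s x - ?m\<bar> \<le> L * (\<Sum>i<d. width c i)" if x: "x \<in> cell_box d c" for x
    proof -
      have br: "bounded_regression d (\<lambda>t. s t - s x) (2 * K)"
        unfolding bounded_regression_def
      proof (intro conjI ballI)
        show "(\<lambda>t. s t - s x) \<in> borel_measurable (unif_cube d)" using bounded_regressionD(1)[OF s] by simp
        show "\<bar>s t - s x\<bar> \<le> 2 * K" if "t \<in> cube d" for t
          using bounded_regressionD(2)[OF s that] bounded_regressionD(2)[OF s cub[OF x]] by linarith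
      qed
      have "(\<integral>t. (s t - s x) * indicator (cell_box d c) t \<partial>unif_cube d) = (?m - s x) * ?q"
        using integrable_cell_box[OF s c] integral_indicator_cell_box[OF c] cell_value_mult[OF s c]
        by (simp add: left_diff_distrib)
      then have "\<bar>(?m - s x) * ?q\<bar> \<le> L * (\<Sum>i<d. width c i) * ?q"
        using abs_integral_cell_box_le[OF br c dev[OF x]] by simp
      then show ?thesis using q by (simp add: abs_mult abs_minus_commute)
    qed
    have VW: "V \<le> ?W"
    proof -
      have bq: "bounded_regression d (\<lambda>x. (s x - ?m)\<^sup>2) ((K + \<bar>?m\<bar>)\<^sup>2)"
        unfolding bounded_regression_def
      proof (intro conjI ballI)
        show "(\<lambda>x. (s x - ?m)\<^sup>2) \<in> borel_measurable (unif_cube d)" using bounded_regressionD(1)[OF s] by simp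
        fix x assume "x \<in> cube d"
        then have "\<bar>s x - ?m\<bar> \<le> K + \<bar>?m\<bar>" using bounded_regressionD(2)[OF s, of x] by linarith
        then have "\<bar>s x - ?m\<bar>\<^sup>2 \<le> (K + \<bar>?m\<bar>)\<^sup>2" by (intro power_mono) auto
        then show "\<bar>(s x - ?m)\<^sup>2\<bar> \<le> (K + \<bar>?m\<bar>)\<^sup>2" by simp
      qed
      have "V * ?q \<le> (L * (\<Sum>i<d. width c i))\<^sup>2 * ?q" unfolding V(2)
      proof (rule integral_cell_box_le[OF bq c])
        fix x assume "x \<in> cell_box d c"
        then have "\<bar>s x - ?m\<bar>\<^sup>2 \<le> (L * (\<Sum>i<d. width c i))\<^sup>2" using dm by (intro power_mono) auto
        then show "(s x - ?m)\<^sup>2 \<le> (L * (\<Sum>i<d. width c i))\<^sup>2" by simp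
      qed
      then have "V \<le> L\<^sup>2 * (\<Sum>i<d. width c i)\<^sup>2" using q by (simp add: power_mult_distrib)
      also have "\<dots> \<le> L\<^sup>2 * (real d * (\<Sum>i<d. (width c i)\<^sup>2))"
        by (intro mult_left_mono sum_sq_le) auto
      finally show ?thesis by (simp add: mult.assoc)
    qed
    have qA: "?q * ?A \<le> 2 / real n"
    proof -
      have "?q * ?A \<le> 2 / real (Suc n)" by (rule bin_mean_inverse_le[OF q01])
      also have "\<dots> \<le> 2 / real n" using n0 by (intro divide_left_mono) auto
      finally show ?thesis .
    qed
    have m2: "?m\<^sup>2 \<le> K\<^sup>2" using cell_value_bound[OF s c K] K by (simp add: abs_le_square_iff[symmetric])
    have "((\<sigma>\<^sup>2 + V) * ?A + ?m\<^sup>2 * (1 - ?q) ^ n) * ?q = (\<sigma>\<^sup>2 + V) * (?q * ?A) + ?m\<^sup>2 * (?q * (1 - ?q) ^ n)"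
      by (simp add: algebra_simps)
    also have "\<dots> \<le> (\<sigma>\<^sup>2 + V) * (2 / real n) + K\<^sup>2 * (2 / real n * (real n powr - k * (?q + 1 / real n) powr - k))"
    proof (rule add_mono)
      show "(\<sigma>\<^sup>2 + V) * (?q * ?A) \<le> (\<sigma>\<^sup>2 + V) * (2 / real n)"
        using V(1) by (intro mult_left_mono qA) simp
      show "?m\<^sup>2 * (?q * (1 - ?q) ^ n) \<le> K\<^sup>2 * (2 / real n * (real n powr - k * (?q + 1 / real n) powr - k))"
        by (rule mult_mono[OF m2 empty_cell_bound[OF q01 n k]]) (use q01 in simp_all)
    qed
    also have "\<dots> \<le> (\<sigma>\<^sup>2 + ?W) * (2 / real n) + K\<^sup>2 * (2 / real n * (real n powr - k * (?q + 1 / real n) powr - k))"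
      using VW n0 by (intro add_mono mult_right_mono) auto
    also have "\<dots> = cell_risk_bound d n \<sigma> K L k c" by (simp add: cell_risk_bound_def mult.commute mult.left_commute)
    finally show ?thesis unfolding V(3) using q01 by (subst ennreal_mult''[symmetric]) (auto intro: ennreal_leI)
  qed simp
  finally show ?thesis .
qed

lemma cell_mean_risk_bound:
  assumes d: "1 \<le> d" and n: "1 \<le> n" and k: "0 \<le> k" "k < 1"
  shows "bounded_cell_fun d (cell_risk_bound d n \<sigma> K L k)"
    "cell_mean d p (cell_risk_bound d n \<sigma> K L k) \<le> 2 ^ p / real n * (2 * \<sigma>\<^sup>2 + 2 * L\<^sup>2 * (real d)\<^sup>2 * rho d ^ p
        + 2 * K\<^sup>2 * (real n powr - k * (1 / (1 - k)) ^ p))"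
proof -
  let ?f = "\<lambda>c. (cell_vol d c + 1 / real n) powr - k" let ?w = "\<lambda>c. \<Sum>i<d. (width c i)\<^sup>2"
  have n0: "0 < 1 / real n" using n by simp
  have f: "bounded_cell_fun d ?f" by (rule bounded_cell_fun_vol_powr[OF n0 k(1)])
  have w: "bounded_cell_fun d ?w" by (intro bounded_cell_fun_sum bounded_width_sq) auto
  have eq: "cell_risk_bound d n \<sigma> K L k = (\<lambda>c. (2 / real n * \<sigma>\<^sup>2 + (2 / real n * (L\<^sup>2 * real d)) * ?w c)
      + (K\<^sup>2 * (2 / real n * real n powr - k)) * ?f c)"
    by (simp add: cell_risk_bound_def fun_eq_iff algebra_simps)
  note b1 = bounded_cell_fun_cmult[OF w, of "2 / real n * (L\<^sup>2 * real d)"]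
    and b2 = bounded_cell_fun_cmult[OF f, of "K\<^sup>2 * (2 / real n * real n powr - k)"]
  note b3 = bounded_cell_fun_add[OF bounded_cell_fun_const[of d "2 / real n * \<sigma>\<^sup>2"] b1]
  show "bounded_cell_fun d (cell_risk_bound d n \<sigma> K L k)"
    unfolding eq by (rule bounded_cell_fun_add[OF b3 b2])
  have "cell_mean d p ?w = (\<Sum>i<d. cell_mean d p (\<lambda>c. (width c i)\<^sup>2))"
    by (rule cell_mean_sum[OF d]) (auto simp: bounded_width_sq)
  also have "\<dots> = (\<Sum>i<d. 2 ^ p * rho d ^ p)"
    by (intro sum.cong refl) (simp only: lessThan_iff cell_mean_width_sq[OF d] power_mult_distrib)
  finally have ww: "cell_mean d p ?w = real d * (2 ^ p * rho d ^ p)" by simp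
  have "cell_mean d p (cell_risk_bound d n \<sigma> K L k)
      = 2 ^ p * (2 / real n * \<sigma>\<^sup>2) + (2 / real n * (L\<^sup>2 * real d)) * cell_mean d p ?w + (K\<^sup>2 * (2 / real n * real n powr - k)) * cell_mean d p ?f"
    unfolding eq by (simp only: cell_mean_add[OF d b3 b2] cell_mean_add[OF d bounded_cell_fun_const b1] cell_mean_cmult cell_mean_const[OF d])
      (simp only: mult.left_commute)
  also have "\<dots> \<le> 2 ^ p * (2 / real n * \<sigma>\<^sup>2) + (2 / real n * (L\<^sup>2 * real d)) * (real d * (2 ^ p * rho d ^ p))
      + (K\<^sup>2 * (2 / real n * real n powr - k)) * (2 / (1 - k)) ^ p"
    unfolding ww by (intro add_left_mono mult_left_mono cell_mean_vol_powr[OF d n0 k]) auto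
  also have "(2 / (1 - k)) ^ p = 2 ^ p * (1 / (1 - k)) ^ p" by (simp add: power_divide)
  finally show "cell_mean d p (cell_risk_bound d n \<sigma> K L k) \<le> 2 ^ p / real n * (2 * \<sigma>\<^sup>2 + 2 * L\<^sup>2 * (real d)\<^sup>2 * rho d ^ p
        + 2 * K\<^sup>2 * (real n powr - k * (1 / (1 - k)) ^ p))"
    by (simp add: algebra_simps power2_eq_square)
qed

section \<open>Risk of the infinite forest\<close>


text \<open>
  The mean of \<open>s\<close> over a cell differs from \<open>s x\<close> by the gradient applied to the offset of the centre from \<open>x\<close>, up
  to the Taylor remainder.
\<close>

lemma cell_value_expansion:
  assumes T: "taylor_bound d s grad C" and c: "valid_cell d c" and x: "x \<in> cell_box d c"
  shows "\<bar>cell_value d s c - s x - (\<Sum>i<d. grad x i / 2 * (fst c i + snd c i - 2 * x i))\<bar> \<le> C * (\<Sum>i<d. (width c i)\<^sup>2)"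
proof -
  let ?U = "unif_cube d" let ?I = "\<lambda>t. indicator (cell_box d c) t :: real" let ?q = "cell_vol d c"
  have C: "0 < C" using T by (simp add: taylor_bound_def)
  have cub: "t \<in> cube d" if "t \<in> cell_box d c" for t using cell_box_subset_cube[OF c] that by blast
  obtain K where K: "0 \<le> K" "\<And>x. x \<in> cube d \<Longrightarrow> \<bar>s x\<bar> \<le> K" using taylor_bounded[OF T] by blast
  have s: "bounded_regression d s K" using K taylor_measurable[OF T] by (simp add: bounded_regression_def)
  have q: "0 < ?q" unfolding cell_vol_def width_def
  proof (rule prod_pos)
    show "0 < snd c i - fst c i" if "i \<in> {..<d}" for i
      using x that unfolding mem_cell_box by (smt (verit) lessThan_iff)
  qed
  define f where "f t = s t - s x - (\<Sum>i<d. grad x i * (t i - x i))" for t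
  have f_bd: "\<bar>f t\<bar> \<le> C * (\<Sum>i<d. (t i - x i)\<^sup>2)" if "t \<in> cube d" for t
    unfolding f_def by (rule taylor_boundD[OF T that cub[OF x]])
  have fb: "bounded_regression d f (C * real d)"
    unfolding bounded_regression_def
  proof (intro conjI ballI)
    show "f \<in> borel_measurable ?U" unfolding f_def
      by (intro borel_measurable_diff borel_measurable_sum borel_measurable_times borel_measurable_const
          taylor_measurable[OF T] measurable_coord_unif_cube) auto
    fix t assume t: "t \<in> cube d"
    have "(\<Sum>i<d. (t i - x i)\<^sup>2) \<le> (\<Sum>i<d. 1)"
    proof (rule sum_mono)
      fix i assume "i \<in> {..<d}"
      then show "(t i - x i)\<^sup>2 \<le> 1" using cube_diff[OF cub[OF x] t, of i] by (simp add: abs_square_le_1)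
    qed
    then have "C * (\<Sum>i<d. (t i - x i)\<^sup>2) \<le> C * real d" using C by (intro mult_left_mono) auto
    then show "\<bar>f t\<bar> \<le> C * real d" using f_bd[OF t] by linarith
  qed
  have ti: "integrable ?U (\<lambda>t. t i * ?I t)" if "i < d" for i
    by (rule integrable_cell_box[OF _ c, where K = 1])
       (use measurable_coord_unif_cube[OF that] that in \<open>auto simp: bounded_regression_def cube_mem less_imp_le\<close>)
  have "(\<integral>t. f t * ?I t \<partial>?U)
      = (\<integral>t. s t * ?I t - s x * ?I t - (\<Sum>i<d. grad x i * (t i * ?I t - x i * ?I t)) \<partial>?U)"
    by (intro Bochner_Integration.integral_cong refl) (simp add: f_def left_diff_distrib right_diff_distrib sum_distrib_right mult.assoc)
  also have "\<dots> = cell_value d s c * ?q - s x * ?q - (\<Sum>i<d. grad x i * (?q * ((fst c i + snd c i) / 2) - x i * ?q))"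
  proof (rule has_bochner_integral_integral_eq)
    have "has_bochner_integral ?U (\<lambda>t. s t * ?I t) (cell_value d s c * ?q)"
      using integrable_cell_box[OF s c] cell_value_mult[OF s c] by (simp add: has_bochner_integral_iff)
    moreover have "has_bochner_integral ?U ?I ?q"
      using integral_indicator_cell_box[OF c] by (simp add: has_bochner_integral_iff)
    moreover have "has_bochner_integral ?U (\<lambda>t. t i * ?I t) (?q * ((fst c i + snd c i) / 2))" if "i < d" for i
      using ti[OF that] integral_coord_cell_box[OF c that] by (simp add: has_bochner_integral_iff)
    ultimately show "has_bochner_integral ?U (\<lambda>t. s t * ?I t - s x * ?I t - (\<Sum>i<d. grad x i * (t i * ?I t - x i * ?I t)))
      (cell_value d s c * ?q - s x * ?q - (\<Sum>i<d. grad x i * (?q * ((fst c i + snd c i) / 2) - x i * ?q)))"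
      by (intro has_bochner_integral_diff has_bochner_integral_sum has_bochner_integral_mult_right) auto
  qed
  also have "\<dots> = (cell_value d s c - s x - (\<Sum>i<d. grad x i / 2 * (fst c i + snd c i - 2 * x i))) * ?q"
  proof -
    have "(\<Sum>i<d. grad x i * (?q * ((fst c i + snd c i) / 2) - x i * ?q))
        = (\<Sum>i<d. grad x i / 2 * (fst c i + snd c i - 2 * x i)) * ?q"
      unfolding sum_distrib_right by (intro sum.cong refl) (simp add: field_simps)
    then show ?thesis by (simp add: algebra_simps)
  qed
  finally have eq: "(\<integral>t. f t * ?I t \<partial>?U) = \<dots>" .
  have "\<bar>\<integral>t. f t * ?I t \<partial>?U\<bar> \<le> C * (\<Sum>i<d. (width c i)\<^sup>2) * ?q"
  proof (rule abs_integral_cell_box_le[OF fb c])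
    fix t assume t: "t \<in> cell_box d c"
    have "C * (\<Sum>i<d. (t i - x i)\<^sup>2) \<le> C * (\<Sum>i<d. (width c i)\<^sup>2)"
      using C by (intro mult_left_mono cell_sum_sq_le[OF x t]) auto
    then show "\<bar>f t\<bar> \<le> C * (\<Sum>i<d. (width c i)\<^sup>2)" using f_bd[OF cub[OF t]] by linarith
  qed
  then show ?thesis unfolding eq abs_mult using q by simp
qed

lemma bounded_offset_at_point:
  "i < d \<Longrightarrow> bounded_cell_fun d (\<lambda>c. indicator (cell_box d c) x * (fst c i + snd c i - 2 * x i))"
  by (rule bounded_cell_fun_at_point[where K = 1]) auto

lemma bounded_cell_fun_indicator:
  assumes "f \<in> borel_measurable cell_space" "\<And>c. valid_cell d c \<Longrightarrow> \<bar>f c\<bar> \<le> K" 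
  shows "bounded_cell_fun d (\<lambda>c. indicator (cell_box d c) x * f c)"
proof (rule bounded_cell_funI[where K = K])
  show "(\<lambda>c. indicator (cell_box d c) x * f c) \<in> borel_measurable cell_space"
    by (intro borel_measurable_times measurable_indicator_cell_box assms(1))
  fix c assume "valid_cell d c"
  then show "\<bar>indicator (cell_box d c) x * f c\<bar> \<le> K" using assms(2)[of c] by (auto simp: indicator_def)
qed

text \<open>
  The expectation over the partition is taken before the absolute value. This is where the forest gains over
  a tree: its bias is of order \<open>kappa ^ p\<close>, which for a tree is the order of the squared bias.
\<close>

lemma forest_bias:
  assumes d: "1 \<le> d" and T: "taylor_bound d s grad C"
  obtains B where "0 \<le> B" "\<And>x p. x \<in> cube d \<Longrightarrow>
    \<bar>cell_mean d p (\<lambda>c. indicator (cell_box d c) x * (cell_value d s c - s x))\<bar> \<le> B * kappa d ^ p"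
proof -
  have C: "0 < C" using T by (simp add: taylor_bound_def)
  obtain K where K: "0 \<le> K" "\<And>x. x \<in> cube d \<Longrightarrow> \<bar>s x\<bar> \<le> K" using taylor_bounded[OF T] by blast
  obtain G where G: "0 \<le> G" "\<And>x i. x \<in> cube d \<Longrightarrow> i < d \<Longrightarrow> \<bar>grad x i\<bar> \<le> G"
    using taylor_gradient_bounded[OF T] by blast
  have s: "bounded_regression d s K" using K taylor_measurable[OF T] by (simp add: bounded_regression_def)
  let ?k = "kappa d" let ?r = "rho d"
  have r: "0 \<le> ?r" "?r \<le> ?k" "0 \<le> ?k" using d by (auto simp: field_simps)
  show ?thesis
  proof (rule that)
    show "0 \<le> real d * G + C * (real d * 3)" using G C by simp
    fix x p assume x: "x \<in> cube d"
    let ?I = "\<lambda>c. indicator (cell_box d c) x :: real"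
    let ?f = "\<lambda>c. ?I c * (cell_value d s c - s x)"
    let ?g = "\<lambda>c. \<Sum>i<d. grad x i / 2 * (?I c * (fst c i + snd c i - 2 * x i))"
    let ?w = "\<lambda>c. \<Sum>i<d. ?I c * (width c i)\<^sup>2"
    have f: "bounded_cell_fun d ?f"
    proof (rule bounded_cell_fun_indicator[where K = "2 * K"])
      show "(\<lambda>c. cell_value d s c - s x) \<in> borel_measurable cell_space"
        by (intro borel_measurable_diff measurable_cell_value bounded_regressionD(1)[OF s] borel_measurable_const)
      fix c assume "valid_cell d c"
      then show "\<bar>cell_value d s c - s x\<bar> \<le> 2 * K" using cell_value_bound[OF s _ K(1), of c] K(2)[OF x] by linarith
    qed
    have g: "bounded_cell_fun d ?g"
      by (intro bounded_cell_fun_sum bounded_cell_fun_cmult bounded_offset_at_point) auto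
    have w: "bounded_cell_fun d ?w" by (intro bounded_cell_fun_sum bounded_width_sq_at_point) auto
    have near: "\<bar>?f c - ?g c\<bar> \<le> C * ?w c" if c: "valid_cell d c" for c
    proof (cases "x \<in> cell_box d c")
      case True
      then show ?thesis using cell_value_expansion[OF T c True] by simp
    qed simp
    have mg: "cell_mean d p ?g = (\<Sum>i<d. grad x i / 2 * (?k ^ p * (1 - 2 * x i)))"
      by (subst cell_mean_sum[OF d])
         (auto simp: cell_mean_cmult cell_mean_offset[OF d _ x] intro!: sum.cong bounded_cell_fun_cmult bounded_offset_at_point simp del: times_divide_eq_left)
    have "\<bar>cell_mean d p ?g\<bar> \<le> (\<Sum>i<d. G * ?k ^ p)" unfolding mg
    proof (intro order_trans[OF sum_abs] sum_mono)
      fix i assume "i \<in> {..<d}"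
      then have i: "i < d" by simp
      have "\<bar>1 - 2 * x i\<bar> \<le> 1" using x i by (auto simp: cube_mem abs_le_iff)
      then have "\<bar>grad x i / 2\<bar> * (?k ^ p * \<bar>1 - 2 * x i\<bar>) \<le> G * (?k ^ p * 1)"
        using G(1) G(2)[OF x i] r by (intro mult_mono mult_left_mono) auto
      then show "\<bar>grad x i / 2 * (?k ^ p * (1 - 2 * x i))\<bar> \<le> G * ?k ^ p"
        using r by (simp add: abs_mult)
    qed
    then have g1: "\<bar>cell_mean d p ?g\<bar> \<le> real d * G * ?k ^ p" by simp
    have "cell_mean d p ?w = (\<Sum>i<d. cell_mean d p (\<lambda>c. ?I c * (width c i)\<^sup>2))"
      by (rule cell_mean_sum[OF d]) (auto simp: bounded_width_sq_at_point)
    also have "\<dots> \<le> (\<Sum>i<d. 3 * ?k ^ p)"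
    proof (rule sum_mono)
      fix i assume "i \<in> {..<d}"
      then have i: "i < d" by simp
      have x01: "0 \<le> x i" "x i \<le> 1" using x i by (auto simp: cube_mem less_imp_le)
      let ?u = "x i * (1 - x i)"
      have u: "0 \<le> ?u" using x01 by simp
      have u4: "?u \<le> 1 / 4" using zero_le_power2[of "x i - 1 / 2"] by (simp add: power2_eq_square algebra_simps)
      have "?r ^ p * (1 - 6 * ?u) \<le> ?r ^ p * 1" using u r by (intro mult_left_mono) auto
      also have "\<dots> \<le> ?k ^ p" using r by (simp add: power_mono)
      finally have 1: "?r ^ p * (1 - 6 * ?u) \<le> ?k ^ p" .
      have "6 * ?k ^ p * ?u \<le> 6 * ?k ^ p * (1 / 4)" using u4 r by (intro mult_left_mono) auto
      with 1 have "6 * ?k ^ p * ?u + ?r ^ p * (1 - 6 * ?u) \<le> (5 / 2) * ?k ^ p" by linarith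
      also have "\<dots> \<le> 3 * ?k ^ p" using r by (intro mult_right_mono) auto
      finally show "cell_mean d p (\<lambda>c. ?I c * (width c i)\<^sup>2) \<le> 3 * ?k ^ p"
        unfolding cell_mean_width_sq_at_point[OF d i x] .
    qed
    finally have w1: "C * cell_mean d p ?w \<le> C * (real d * 3 * ?k ^ p)" using C by simp
    have "cell_mean d p ?f \<le> cell_mean d p (\<lambda>c. ?g c + C * ?w c)"
      by (intro cell_mean_mono d f bounded_cell_fun_add g bounded_cell_fun_cmult w) (use near in \<open>auto simp: abs_le_iff\<close>, fastforce)
    also have "\<dots> = cell_mean d p ?g + C * cell_mean d p ?w"
      unfolding cell_mean_add[OF d g bounded_cell_fun_cmult[OF w]] cell_mean_cmult ..
    finally have up: "cell_mean d p ?f \<le> cell_mean d p ?g + C * cell_mean d p ?w" .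
    have "cell_mean d p ?g + - C * cell_mean d p ?w = cell_mean d p (\<lambda>c. ?g c + - C * ?w c)"
      unfolding cell_mean_add[OF d g bounded_cell_fun_cmult[OF w]] cell_mean_cmult ..
    also have "\<dots> \<le> cell_mean d p ?f"
      by (intro cell_mean_mono d f bounded_cell_fun_add g bounded_cell_fun_cmult w) (use near in \<open>auto simp: abs_le_iff\<close>, fastforce)
    finally have lo: "cell_mean d p ?g + - C * cell_mean d p ?w \<le> cell_mean d p ?f" .
    have "\<bar>cell_mean d p ?f\<bar> \<le> real d * G * ?k ^ p + C * (real d * 3 * ?k ^ p)"
      using up lo g1 w1 by (simp add: abs_le_iff)
    then show "\<bar>cell_mean d p ?f\<bar> \<le> (real d * G + C * (real d * 3)) * ?k ^ p" by (simp add: algebra_simps)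
  qed
qed

text \<open>
  A bias-variance bound; Jensen's inequality moves the square inside the expectation over the partition.
\<close>

lemma forest_pointwise:
  assumes d: "1 \<le> d" and R: "regression_law d s \<sigma> P" and s: "bounded_regression d s K" and K: "0 \<le> K"
    and D: "D \<in> space (sample_law n P)" and x: "x \<in> cube d"
    and B: "\<bar>cell_mean d p (\<lambda>c. indicator (cell_box d c) x * (cell_value d s c - s x))\<bar> \<le> b"
  shows "ennreal ((forest_estimator d p n D x - s x)\<^sup>2) \<le>
    2 * (\<integral>\<^sup>+\<omega>. ennreal (\<Sum>j<2 ^ p. indicator (cell_box d (bprf_cell \<omega> p j)) x *
        (cell_average n D (cell_box d (bprf_cell \<omega> p j)) - cell_value d s (bprf_cell \<omega> p j))\<^sup>2) \<partial>bprf_draws d p)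
      + ennreal (2 * b\<^sup>2)"
proof -
  let ?W = "bprf_draws d p" let ?I = "\<lambda>c. indicator (cell_box d c) x :: real"
  interpret W: prob_space ?W by (rule prob_space_bprf_draws[OF d])
  define a where "a c = cell_average n D (cell_box d c)" for c
  define A where "A = (\<Sum>i<n. \<bar>snd (D i)\<bar>)"
  have am: "a \<in> borel_measurable cell_space"
    unfolding a_def using measurable_Pair2[OF measurable_cell_average[OF R, of n] D] by simp
  have ab: "\<bar>a c\<bar> \<le> A" for c unfolding a_def A_def by (rule abs_cell_average_le)
  have vm: "cell_value d s \<in> borel_measurable cell_space" by (rule measurable_cell_value[OF bounded_regressionD(1)[OF s]])
  have vb: "\<bar>cell_value d s c\<bar> \<le> K" if "valid_cell d c" for c by (rule cell_value_bound[OF s that K])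
  let ?u = "\<lambda>c. ?I c * (a c - cell_value d s c)" let ?v = "\<lambda>c. ?I c * (cell_value d s c - s x)"
  let ?q = "\<lambda>c. ?I c * (a c - cell_value d s c)\<^sup>2"
  have dev: "\<bar>a c - cell_value d s c\<bar> \<le> A + K" if "valid_cell d c" for c
    using ab[of c] vb[OF that] by linarith
  have u: "bounded_cell_fun d ?u"
    by (rule bounded_cell_fun_indicator[OF _ dev]) (intro borel_measurable_diff am vm)
  have q: "bounded_cell_fun d ?q"
  proof (rule bounded_cell_fun_indicator[where K = "(A + K)\<^sup>2"])
    show "(\<lambda>c. (a c - cell_value d s c)\<^sup>2) \<in> borel_measurable cell_space"
      by (intro borel_measurable_power borel_measurable_diff am vm)
    fix c assume "valid_cell d c"
    from power_mono[OF dev[OF this] abs_ge_zero, of 2] show "\<bar>(a c - cell_value d s c)\<^sup>2\<bar> \<le> (A + K)\<^sup>2" by simp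
  qed
  have v: "bounded_cell_fun d ?v"
  proof (rule bounded_cell_fun_indicator[where K = "K + \<bar>s x\<bar>"])
    show "(\<lambda>c. cell_value d s c - s x) \<in> borel_measurable cell_space" using vm by simp
    fix c assume "valid_cell d c"
    then show "\<bar>cell_value d s c - s x\<bar> \<le> K + \<bar>s x\<bar>" using vb[of c] by linarith
  qed
  define X where "X \<omega> = (\<Sum>j<2 ^ p. ?u (bprf_cell \<omega> p j))" for \<omega>
  have intX: "integrable ?W X" unfolding X_def
    by (intro Bochner_Integration.integrable_sum integrable_cell_fun d u) auto
  have X2: "(X \<omega>)\<^sup>2 = (\<Sum>j<2 ^ p. ?q (bprf_cell \<omega> p j))" if \<omega>: "\<omega> \<in> space ?W" for \<omega>
  proof -
    obtain i where i: "\<And>F. (\<Sum>j<2 ^ p. ?I (bprf_cell \<omega> p j) * F j) = (F i :: real)"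
      using bprf_cell_containing[OF \<omega> x] by metis
    show ?thesis unfolding X_def i ..
  qed
  have intX2: "integrable ?W (\<lambda>\<omega>. (X \<omega>)\<^sup>2)"
  proof -
    have "integrable ?W (\<lambda>\<omega>. \<Sum>j<2 ^ p. ?q (bprf_cell \<omega> p j))"
      by (intro Bochner_Integration.integrable_sum integrable_cell_fun d q) auto
    then show ?thesis using X2 by (subst Bochner_Integration.integrable_cong[OF refl]) auto
  qed
  have EX: "(\<integral>\<omega>. X \<omega> \<partial>?W) = cell_mean d p ?u" by (simp add: X_def cell_mean_def)
  have EX2: "(\<integral>\<omega>. (X \<omega>)\<^sup>2 \<partial>?W) = cell_mean d p ?q"
    unfolding cell_mean_def using X2 by (intro Bochner_Integration.integral_cong) auto
  have jensen: "(cell_mean d p ?u)\<^sup>2 \<le> cell_mean d p ?q"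
    using W.variance_positive[of X] W.variance_eq[OF intX intX2] unfolding EX EX2 by simp
  have split: "forest_estimator d p n D x - s x = cell_mean d p ?u + cell_mean d p ?v"
  proof -
    have int: "integrable ?W (\<lambda>\<omega>. \<Sum>j<2 ^ p. ?u (bprf_cell \<omega> p j) + ?v (bprf_cell \<omega> p j))"
      by (intro Bochner_Integration.integrable_sum integrable_cell_fun d bounded_cell_fun_add u v) auto
    have "forest_estimator d p n D x = (\<integral>\<omega>. (\<Sum>j<2 ^ p. ?u (bprf_cell \<omega> p j) + ?v (bprf_cell \<omega> p j)) + s x \<partial>?W)"
      unfolding forest_estimator_def
    proof (rule Bochner_Integration.integral_cong[OF refl])
      fix \<omega> assume \<omega>: "\<omega> \<in> space ?W"
      obtain i where i: "\<And>F. (\<Sum>j<2 ^ p. ?I (bprf_cell \<omega> p j) * F j) = (F i :: real)"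
        using bprf_cell_containing[OF \<omega> x] by metis
      have "tree_estimator (bprf_partition d p \<omega>) n D x = a (bprf_cell \<omega> p i)"
        unfolding tree_estimator_eq[OF \<omega>] i a_def ..
      moreover have "(\<Sum>j<2 ^ p. ?u (bprf_cell \<omega> p j) + ?v (bprf_cell \<omega> p j)) = a (bprf_cell \<omega> p i) - s x"
        unfolding distrib_left[symmetric] i by simp
      ultimately show "tree_estimator (bprf_partition d p \<omega>) n D x
          = (\<Sum>j<2 ^ p. ?u (bprf_cell \<omega> p j) + ?v (bprf_cell \<omega> p j)) + s x" by simp
    qed
    also have "\<dots> = cell_mean d p (\<lambda>c. ?u c + ?v c) + s x"
      unfolding cell_mean_def using int by (simp add: W.prob_space)
    also have "cell_mean d p (\<lambda>c. ?u c + ?v c) = cell_mean d p ?u + cell_mean d p ?v"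
      by (rule cell_mean_add[OF d u v])
    finally show ?thesis by simp
  qed
  have "(cell_mean d p ?v)\<^sup>2 \<le> b\<^sup>2" using power_mono[OF B abs_ge_zero, of 2] by simp
  moreover have "(y + z)\<^sup>2 \<le> 2 * y\<^sup>2 + 2 * z\<^sup>2" for y z :: real
    using zero_le_power2[of "y - z"] by (simp add: power2_eq_square algebra_simps)
  ultimately have "(forest_estimator d p n D x - s x)\<^sup>2 \<le> 2 * cell_mean d p ?q + 2 * b\<^sup>2"
    unfolding split using jensen by (smt (verit))
  then have "ennreal ((forest_estimator d p n D x - s x)\<^sup>2) \<le> ennreal (2 * cell_mean d p ?q + 2 * b\<^sup>2)"
    by (rule ennreal_leI)
  also have "\<dots> = 2 * ennreal (cell_mean d p ?q) + ennreal (2 * b\<^sup>2)"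
    using order_trans[OF zero_le_power2 jensen] by (simp add: ennreal_mult)
  also have "ennreal (cell_mean d p ?q) = (\<integral>\<^sup>+\<omega>. (\<Sum>j<2 ^ p. ennreal (?q (bprf_cell \<omega> p j))) \<partial>?W)"
    by (rule nn_integral_cells_bounds(2)[OF d q, symmetric]) simp
  also have "\<dots> = (\<integral>\<^sup>+\<omega>. ennreal (\<Sum>j<2 ^ p. ?q (bprf_cell \<omega> p j)) \<partial>?W)"
    by (intro nn_integral_cong sum_ennreal) simp
  finally show ?thesis unfolding a_def .
qed

lemma forest_risk_le:
  assumes d: "1 \<le> d" and T: "taylor_bound d s grad C"
  obtains A where "0 \<le> A" "\<And>\<sigma> P n p k. regression_law d s \<sigma> P \<Longrightarrow> 1 \<le> n \<Longrightarrow> 0 \<le> k \<Longrightarrow> k < 1 \<Longrightarrow>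
    forest_risk d p n s P \<le> ennreal (A * ((kappa d ^ p)\<^sup>2
      + 2 ^ p / real n * (\<sigma>\<^sup>2 + rho d ^ p + real n powr - k * (1 / (1 - k)) ^ p)))"
proof -
  obtain K where K: "0 \<le> K" "\<And>x. x \<in> cube d \<Longrightarrow> \<bar>s x\<bar> \<le> K" using taylor_bounded[OF T] by blast
  have s: "bounded_regression d s K" using K taylor_measurable[OF T] by (simp add: bounded_regression_def)
  obtain L where L: "0 \<le> L" "\<And>x t. x \<in> cube d \<Longrightarrow> t \<in> cube d \<Longrightarrow> \<bar>s t - s x\<bar> \<le> L * (\<Sum>i<d. \<bar>t i - x i\<bar>)"
    using taylor_lipschitz[OF T] by blast
  obtain B where B: "0 \<le> B" "\<And>x p. x \<in> cube d \<Longrightarrow>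
    \<bar>cell_mean d p (\<lambda>c. indicator (cell_box d c) x * (cell_value d s c - s x))\<bar> \<le> B * kappa d ^ p"
    using forest_bias[OF d T] by blast
  let ?k = "kappa d" let ?r = "rho d"
  define A where "A = max (2 * B\<^sup>2) (max 4 (max (4 * L\<^sup>2 * (real d)\<^sup>2) (4 * K\<^sup>2)))"
  show ?thesis
  proof (rule that)
    show "0 \<le> A" by (simp add: A_def)
    fix \<sigma> k :: real and P and n p :: nat assume R: "regression_law d s \<sigma> P" and n: "1 \<le> n" and k: "0 \<le> k" "k < (1::real)"
    let ?S = "sample_law n P" let ?U = "unif_cube d" let ?W = "bprf_draws d p"
    interpret S: prob_space ?S by (rule prob_space_sample_law[OF R])
    interpret U: prob_space ?U by (rule prob_space_unif_cube)
    interpret W: prob_space ?W by (rule prob_space_bprf_draws[OF d])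
    define f where "f = (\<lambda>D (x :: nat \<Rightarrow> real) c. (cell_average n D (cell_box d c) - cell_value d s c)\<^sup>2)"
    define h where "h = (\<lambda>(D, x, \<omega>). ennreal (\<Sum>j<2 ^ p. indicator (cell_box d (bprf_cell \<omega> p j)) x * f D x (bprf_cell \<omega> p j)))"
    have fm: "(\<lambda>u. f (fst u) (fst (snd u)) (snd (snd u))) \<in> borel_measurable (?S \<Otimes>\<^sub>M (?U \<Otimes>\<^sub>M cell_space))"
    proof -
      have "(\<lambda>u. (fst u, snd (snd u))) \<in> measurable (?S \<Otimes>\<^sub>M (?U \<Otimes>\<^sub>M cell_space)) (?S \<Otimes>\<^sub>M cell_space)"
        by (intro measurable_Pair measurable_fst measurable_compose[OF measurable_snd measurable_snd])
      from measurable_compose[OF this measurable_cell_average[OF R]]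
      have "(\<lambda>u. cell_average n (fst u) (cell_box d (snd (snd u)))) \<in> borel_measurable (?S \<Otimes>\<^sub>M (?U \<Otimes>\<^sub>M cell_space))" by simp
      moreover have "(\<lambda>u. cell_value d s (snd (snd u))) \<in> borel_measurable (?S \<Otimes>\<^sub>M (?U \<Otimes>\<^sub>M cell_space))"
        by (intro measurable_compose[OF measurable_compose[OF measurable_snd measurable_snd] measurable_cell_value[OF bounded_regressionD(1)[OF s]]])
      ultimately show ?thesis unfolding f_def by simp
    qed
    note FS = nn_integral_cell_sum[OF d S.prob_space_axioms fm, where p = p, folded h_def]
    have fpos: "0 \<le> f D x c" for D x c by (simp add: f_def)
    define E where "E = (\<integral>\<^sup>+u. h u \<partial>(?S \<Otimes>\<^sub>M (?U \<Otimes>\<^sub>M ?W)))"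
    have "E = (\<integral>\<^sup>+\<omega>. (\<Sum>j<2 ^ p. \<integral>\<^sup>+D. \<integral>\<^sup>+x. ennreal (f D x (bprf_cell \<omega> p j)) * indicator (cell_box d (bprf_cell \<omega> p j)) x
          \<partial>?U \<partial>?S) \<partial>?W)"
      unfolding E_def by (rule FS(1)) (simp add: f_def)
    also have "\<dots> \<le> (\<integral>\<^sup>+\<omega>. (\<Sum>j<2 ^ p. ennreal (cell_risk_bound d n \<sigma> K L k (bprf_cell \<omega> p j))) \<partial>?W)"
    proof (intro nn_integral_mono sum_mono)
      fix \<omega> j assume \<omega>: "\<omega> \<in> space ?W" and j: "j \<in> {..<2 ^ p :: nat}"
      have c: "valid_cell d (bprf_cell \<omega> p j)" using valid_bprf_cell[OF \<omega> order_refl] j by simp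
      show "(\<integral>\<^sup>+D. \<integral>\<^sup>+x. ennreal (f D x (bprf_cell \<omega> p j)) * indicator (cell_box d (bprf_cell \<omega> p j)) x \<partial>?U \<partial>?S)
          \<le> ennreal (cell_risk_bound d n \<sigma> K L k (bprf_cell \<omega> p j))"
        unfolding f_def using cell_risk_le[OF R s c n k(1) less_imp_le[OF k(2)] K(1) L] by blast
    qed
    also have "\<dots> = ennreal (cell_mean d p (cell_risk_bound d n \<sigma> K L k))"
      by (rule nn_integral_cells_bounds(2)[OF d cell_mean_risk_bound(1)[OF d n k]])
         (unfold cell_risk_bound_def, intro add_nonneg_nonneg mult_nonneg_nonneg sum_nonneg, auto)
    also have "\<dots> \<le> ennreal (2 ^ p / real n * (2 * \<sigma>\<^sup>2 + 2 * L\<^sup>2 * (real d)\<^sup>2 * ?r ^ p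
        + 2 * K\<^sup>2 * (real n powr - k * (1 / (1 - k)) ^ p)))" (is "_ \<le> ennreal ?V")
      by (intro ennreal_leI cell_mean_risk_bound(2)[OF d n k])
    finally have E: "E \<le> ennreal ?V" .
    define g where "g = (\<lambda>u. \<integral>\<^sup>+\<omega>. h (fst u, snd u, \<omega>) \<partial>?W)"
    have gm: "g \<in> borel_measurable (?S \<Otimes>\<^sub>M ?U)"
    proof -
      have "(\<lambda>v. (fst (fst v), snd (fst v), snd v)) \<in> measurable ((?S \<Otimes>\<^sub>M ?U) \<Otimes>\<^sub>M ?W) (?S \<Otimes>\<^sub>M (?U \<Otimes>\<^sub>M ?W))"
        by (intro measurable_Pair measurable_snd measurable_compose[OF measurable_fst measurable_fst]
            measurable_compose[OF measurable_fst measurable_snd])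
      from measurable_compose[OF this FS(3)[OF fpos]]
      have "(\<lambda>(u, \<omega>). h (fst u, snd u, \<omega>)) \<in> borel_measurable ((?S \<Otimes>\<^sub>M ?U) \<Otimes>\<^sub>M ?W)"
        by (simp add: case_prod_beta')
      then show ?thesis unfolding g_def by (rule W.borel_measurable_nn_integral)
    qed
    have gE: "(\<integral>\<^sup>+u. g u \<partial>(?S \<Otimes>\<^sub>M ?U)) = E"
    proof -
      have "(\<integral>\<^sup>+u. g u \<partial>(?S \<Otimes>\<^sub>M ?U)) = (\<integral>\<^sup>+D. \<integral>\<^sup>+x. g (D, x) \<partial>?U \<partial>?S)"
        by (rule U.nn_integral_fst[OF gm, symmetric])
      also have "\<dots> = E" unfolding g_def E_def fst_conv snd_conv by (rule FS(2)) (rule fpos)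
      finally show ?thesis .
    qed
    interpret SU: pair_prob_space ?S ?U ..
    have "forest_risk d p n s P \<le> (\<integral>\<^sup>+u. 2 * g u + ennreal (2 * (B * ?k ^ p)\<^sup>2) \<partial>(?S \<Otimes>\<^sub>M ?U))"
      unfolding forest_risk_def
    proof (rule nn_integral_mono)
      fix u assume u: "u \<in> space (?S \<Otimes>\<^sub>M ?U)"
      obtain D x where ux: "u = (D, x)" by (cases u)
      have D: "D \<in> space ?S" and x: "x \<in> cube d" using u unfolding ux by (simp_all add: space_pair_measure space_unif_cube)
      show "(case u of (D, x) \<Rightarrow> ennreal ((forest_estimator d p n D x - s x)\<^sup>2)) \<le> 2 * g u + ennreal (2 * (B * ?k ^ p)\<^sup>2)"
        using forest_pointwise[OF d R s K(1) D x B(2)[OF x, of p]] unfolding ux g_def h_def f_def by simp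
    qed
    also have "\<dots> = 2 * E + ennreal (2 * (B * ?k ^ p)\<^sup>2)"
      using gm gE by (simp add: nn_integral_add nn_integral_cmult SU.emeasure_space_1)
    also have "\<dots> \<le> 2 * ennreal ?V + ennreal (2 * (B * ?k ^ p)\<^sup>2)"
      using E by (intro add_right_mono mult_left_mono) auto
    also have "\<dots> = ennreal (2 * ?V + 2 * (B * ?k ^ p)\<^sup>2)"
    proof -
      have r0: "0 \<le> ?r" using d by (simp add: field_simps)
      have "0 \<le> ?V" using r0 k by (intro mult_nonneg_nonneg add_nonneg_nonneg) auto
      moreover have "2 * ennreal v + ennreal w = ennreal (2 * v + w)" if "0 \<le> v" "0 \<le> w" for v w
        using that by (simp add: ennreal_mult)
      ultimately show ?thesis by simp
    qed
    also have "\<dots> \<le> ennreal (A * ((?k ^ p)\<^sup>2 + 2 ^ p / real n * (\<sigma>\<^sup>2 + ?r ^ p + real n powr - k * (1 / (1 - k)) ^ p)))"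
    proof (rule ennreal_leI)
      have r0: "0 \<le> ?r" using d by (simp add: field_simps)
      let ?t = "real n powr - k * (1 / (1 - k)) ^ p"
      have t0: "0 \<le> ?t" using k by simp
      have A: "2 * B\<^sup>2 \<le> A" "4 \<le> A" "4 * L\<^sup>2 * (real d)\<^sup>2 \<le> A" "4 * K\<^sup>2 \<le> A" by (auto simp: A_def)
      have "4 * \<sigma>\<^sup>2 + 4 * L\<^sup>2 * (real d)\<^sup>2 * ?r ^ p + 4 * K\<^sup>2 * ?t \<le> A * \<sigma>\<^sup>2 + A * ?r ^ p + A * ?t"
        using A r0 t0 by (intro add_mono mult_right_mono) auto
      then have "2 ^ p / real n * (4 * \<sigma>\<^sup>2 + 4 * L\<^sup>2 * (real d)\<^sup>2 * ?r ^ p + 4 * K\<^sup>2 * ?t) \<le> 2 ^ p / real n * (A * \<sigma>\<^sup>2 + A * ?r ^ p + A * ?t)"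
        by (intro mult_left_mono) auto
      moreover have "2 * B\<^sup>2 * (?k ^ p)\<^sup>2 \<le> A * (?k ^ p)\<^sup>2" using A by (intro mult_right_mono) auto
      moreover have "2 * ?V = 2 ^ p / real n * (4 * \<sigma>\<^sup>2 + 4 * L\<^sup>2 * (real d)\<^sup>2 * ?r ^ p + 4 * K\<^sup>2 * ?t)"
        by (simp add: algebra_simps)
      moreover have "A * ((?k ^ p)\<^sup>2 + 2 ^ p / real n * (\<sigma>\<^sup>2 + ?r ^ p + ?t))
          = A * (?k ^ p)\<^sup>2 + 2 ^ p / real n * (A * \<sigma>\<^sup>2 + A * ?r ^ p + A * ?t)"
        by (simp add: algebra_simps)
      ultimately show "2 * ?V + 2 * (B * ?k ^ p)\<^sup>2 \<le> A * ((?k ^ p)\<^sup>2 + 2 ^ p / real n * (\<sigma>\<^sup>2 + ?r ^ p + ?t))"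
        by (simp only: power_mult_distrib)
    qed
    finally show "forest_risk d p n s P \<le> ennreal (A * ((?k ^ p)\<^sup>2
      + 2 ^ p / real n * (\<sigma>\<^sup>2 + ?r ^ p + real n powr - k * (1 / (1 - k)) ^ p)))" .
  qed
qed

section \<open>Rates of convergence\<close>


lemma bprf_alpha_pos: "1 \<le> d \<Longrightarrow> 0 < bprf_alpha d"
proof -
  assume d: "1 \<le> d"
  then have "0 < kappa d" "kappa d < 1" by (auto simp: field_simps)
  then show ?thesis by (simp add: bprf_alpha_def divide_neg_pos)
qed

lemma two_powr_bprf_alpha: "1 \<le> d \<Longrightarrow> 2 powr (- bprf_alpha d * real p) = kappa d ^ p"
proof -
  assume d: "1 \<le> d"
  then have k: "0 < kappa d" by (auto simp: field_simps)
  have "2 powr (- bprf_alpha d * real p) = exp (real p * ln (kappa d))"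
    by (simp add: powr_def bprf_alpha_def)
  also have "\<dots> = kappa d ^ p" using k by (simp add: exp_of_nat_mult)
  finally show ?thesis .
qed

lemma ln2_alpha: "1 \<le> d \<Longrightarrow> (1 + 2 * bprf_alpha d) * ln 2 = ln 2 - 2 * ln (kappa d)"
  by (simp add: bprf_alpha_def field_simps)

lemma ln_exp_mult_sq: "0 < k \<Longrightarrow> ln (exp 1 * k\<^sup>2) = 1 + 2 * ln k" for k :: real
  by (simp add: ln_mult ln_realpow)

text \<open>
  For \<open>d = 3\<close> this is \<open>2 * (6 / 5)^2 > e\<close>. It means that the depth that balances bias and variance is a multiple
  \<open>b < 1\<close> of \<open>ln (n / \<sigma>^2)\<close>.
\<close>

lemma ln2_alpha_small:
  assumes "1 \<le> d" "d \<le> 3" shows "1 < (1 + 2 * bprf_alpha d) * ln 2"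
proof -
  let ?k = "kappa d"
  have k: "0 < ?k" "?k \<le> 5 / 6" using assms by (auto simp: field_simps)
  have "exp 1 * ?k\<^sup>2 \<le> exp 1 * (5 / 6)\<^sup>2" using k by (intro mult_left_mono power_mono) auto
  also have "\<dots> < 2" using e_less_272 by (simp add: power2_eq_square)
  finally have "ln (exp 1 * ?k\<^sup>2) < ln 2" using k(1) by (intro ln_less_cancel_iff[THEN iffD2] mult_pos_pos zero_less_power) auto
  also have "ln (exp 1 * ?k\<^sup>2) = 1 + 2 * ln ?k" by (rule ln_exp_mult_sq[OF k(1)])
  finally have "1 + 2 * ln ?k < ln 2" .
  then show ?thesis unfolding ln2_alpha[OF assms(1)] by linarith
qed

text \<open>
  For \<open>d = 4\<close> this is \<open>2 * (8 / 7)^2 \<le> e\<close>.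
\<close>

lemma ln2_alpha_large:
  assumes "4 \<le> d" shows "(1 + 2 * bprf_alpha d) * ln 2 \<le> 1"
proof -
  let ?k = "kappa d"
  have k: "7 / 8 \<le> ?k" using assms by (auto simp: field_simps)
  have "13 / 8 \<le> exp (1 / 2 :: real)" using exp_lower_Taylor_quadratic[of "1 / 2 :: real"] by (simp add: power2_eq_square)
  then have "(13 / 8)\<^sup>2 \<le> (exp (1 / 2 :: real))\<^sup>2" by (intro power_mono) auto
  also have "(exp (1 / 2 :: real))\<^sup>2 = exp 1" by (simp flip: exp_of_nat_mult)
  finally have e: "169 / 64 \<le> exp (1::real)" by (simp add: power2_eq_square)
  have "2 \<le> exp 1 * (7 / 8 :: real)\<^sup>2" using e by (simp add: power2_eq_square)
  also have "\<dots> \<le> exp 1 * ?k\<^sup>2" using k by (intro mult_left_mono power_mono) auto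
  finally have le: "2 \<le> exp 1 * ?k\<^sup>2" .
  have k0: "0 < ?k" using k by linarith
  have "ln 2 \<le> ln (exp 1 * ?k\<^sup>2)" using le by (intro ln_le_cancel_iff[THEN iffD2]) linarith+
  also have "ln (exp 1 * ?k\<^sup>2) = 1 + 2 * ln ?k" by (rule ln_exp_mult_sq[OF k0])
  finally have "ln 2 \<le> 1 + 2 * ln ?k" .
  then show ?thesis using assms by (subst ln2_alpha) auto
qed

lemma depth_bound_eq: "1 \<le> n \<Longrightarrow> depth_bound n = ln (real n) + 5 / 2 - sqrt 5 * sqrt (ln (real n) + 5 / 4)"
proof -
  assume "1 \<le> n"
  then have "0 \<le> ln (real n)" by simp
  then show ?thesis by (simp add: depth_bound_def power2_diff power_divide add.commute mult.commute)
qed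

lemma depth_bound_le_ln: "1 \<le> n \<Longrightarrow> depth_bound n \<le> ln (real n)"
proof -
  assume n: "1 \<le> n"
  have "sqrt 5 * sqrt (5 / 4) \<le> sqrt 5 * sqrt (ln (real n) + 5 / 4)"
    using n by (intro mult_left_mono) auto
  moreover have "sqrt 5 * sqrt (5 / 4) = 5 / 2" by (simp add: real_sqrt_divide)
  ultimately show ?thesis unfolding depth_bound_eq[OF n] by linarith
qed

text \<open>
  The form in which the admissible depths are used: minus the logarithm of the volume of a random cell has
  mean \<open>p\<close> and standard deviation \<open>sqrt p\<close>, so the typical cells are larger than \<open>1 / n\<close>.
\<close>

lemma depth_le_ln:
  assumes n: "1 \<le> n" and p: "real p \<le> depth_bound n"
  shows "real p + sqrt 5 * sqrt (real p) \<le> ln (real n)"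
proof -
  let ?u = "sqrt (5 / 4 + ln (real n))"
  have ln: "0 \<le> ln (real n)" using n by simp
  have u: "sqrt 5 / 2 \<le> ?u"
  proof -
    have "sqrt 5 / 2 = sqrt (5 / 4)" by (simp add: real_sqrt_divide)
    also have "\<dots> \<le> ?u" using ln by simp
    finally show ?thesis .
  qed
  have "sqrt (real p) \<le> sqrt (depth_bound n)" using p by simp
  also have "\<dots> = ?u - sqrt 5 / 2" using u by (simp add: depth_bound_def)
  finally have "sqrt (real p) + sqrt 5 / 2 \<le> ?u" by simp
  then have "(sqrt (real p) + sqrt 5 / 2)\<^sup>2 \<le> ?u\<^sup>2" by (intro power_mono) auto
  then have "real p + sqrt (real p) * sqrt 5 + 5 / 4 \<le> 5 / 4 + ln (real n)"
    using ln by (simp add: power2_sum power_divide)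
  then show ?thesis by (simp add: mult.commute)
qed

text \<open>
  With the moment bound for the shifted volume, Markov's inequality shows that at least a quarter of the
  cells, in expectation, have a volume of at least \<open>1 / n\<close>. The exponent \<open>k\<close> is of the order that is optimal for
  \<open>depth_le_ln\<close>.
\<close>

lemma small_cell_proportion:
  assumes n: "1 \<le> n" and p4: "4 \<le> p" and p: "real p \<le> depth_bound n"
  defines "k \<equiv> 1 / (2 * sqrt (real p))"
  shows "0 \<le> k" "k < 1" "(2 / real n) powr k * (1 / (1 - k)) ^ p \<le> 3 / 4"
proof -
  let ?s = "sqrt (real p)"
  have "sqrt 4 \<le> ?s" using p4 by (subst real_sqrt_le_iff) simp
  then have s: "2 \<le> ?s" by simp
  show k0: "0 \<le> k" using s by (simp add: k_def)
  have "1 / (2 * ?s) \<le> 1 / (2 * 2)" using s p4 by (intro divide_left_mono) auto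
  then have k4: "k \<le> 1 / 4" by (simp add: k_def)
  then show k1: "k < 1" by simp
  have n0: "0 < real n" using n by simp
  have ps: "real p = ?s * ?s" by simp
  have kp: "k * real p = ?s / 2" "k * ?s = 1 / 2" "real p * k\<^sup>2 = 1 / 4"
  proof -
    have "1 / (2 * S) * (S * S) = S / 2 \<and> 1 / (2 * S) * S = 1 / 2 \<and> S * S * (1 / (2 * S))\<^sup>2 = 1 / 4"
      if "2 \<le> S" for S :: real
      using that by (auto simp: field_simps power2_eq_square)
    from this[OF s] show "k * real p = ?s / 2" "k * ?s = 1 / 2" "real p * k\<^sup>2 = 1 / 4"
      unfolding k_def ps[symmetric] by blast+
  qed
  have ln2: "ln (2::real) \<le> 1" using ln_le_minus_one[of 2] by simp
  \<comment> \<open>\<open>k ln 2 + 2 p k^2 - sqrt 5 / 2\<close> is at most \<open>1 / 4 + 1 / 2 - 11 / 10\<close>.\<close>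
  have "k * (ln 2 - ln (real n)) - real p * ln (1 - k) \<le> - (7 / 20)"
  proof -
    have "- k - 2 * k\<^sup>2 \<le> ln (1 - k)" using k0 k4 by (intro ln_one_minus_pos_lower_bound) auto
    then have "- real p * ln (1 - k) \<le> real p * (k + 2 * k\<^sup>2)"
      using mult_left_mono[of "- k - 2 * k\<^sup>2" "ln (1 - k)" "real p"] by (simp add: algebra_simps)
    also have "\<dots> = ?s / 2 + 1 / 2" using kp by (simp add: algebra_simps)
    finally have 1: "- real p * ln (1 - k) \<le> ?s / 2 + 1 / 2" .
    have "k * (real p + sqrt 5 * ?s) \<le> k * ln (real n)" using depth_le_ln[OF n p] k0 by (rule mult_left_mono)
    also have "k * (real p + sqrt 5 * ?s) = k * real p + sqrt 5 * (k * ?s)" by (simp add: algebra_simps)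
    finally have 2: "?s / 2 + sqrt 5 / 2 \<le> k * ln (real n)" unfolding kp by simp
    have 3: "k * ln 2 \<le> 1 / 4 * 1" using k0 k4 ln2 by (intro mult_mono) auto
    have 4: "11 / 5 \<le> sqrt 5" by (rule real_le_rsqrt) (simp add: power2_eq_square)
    show ?thesis using 1 2 3 4 by (simp add: right_diff_distrib)
  qed
  moreover have "(2 / real n) powr k * (1 / (1 - k)) ^ p = exp (k * (ln 2 - ln (real n)) - real p * ln (1 - k))"
  proof -
    have "(1 / (1 - k)) ^ p = exp (- real p * ln (1 - k))"
      using k1 by (simp add: exp_minus exp_of_nat_mult power_divide divide_inverse power_inverse)
    moreover have "(2 / real n) powr k = exp (k * (ln 2 - ln (real n)))"
      using n0 by (simp add: powr_def ln_div)
    ultimately show ?thesis by (simp flip: exp_add)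
  qed
  moreover have "exp (- (7 / 20)) \<le> (3 / 4 :: real)"
    using exp_ge_add_one_self[of "7 / 20"] by (simp add: exp_minus field_simps)
  ultimately show "(2 / real n) powr k * (1 / (1 - k)) ^ p \<le> 3 / 4"
    by (metis exp_le_cancel_iff order_trans)
qed

lemma regression_framework_taylor:
  assumes "regression_framework d s \<sigma> P"
  obtains grad C where "1 \<le> d" "0 < \<sigma>" "regression_law d s \<sigma> P" "taylor_bound d s grad C"
  using assms smooth_taylor unfolding regression_framework_def by metis

lemma tree_lower_bound:
  assumes d: "1 \<le> d" and T: "taylor_bound d s grad C" and nc: "\<not> s constant_on cube d"
  obtains a p0 where "0 < a" "\<And>\<sigma> P n p. regression_law d s \<sigma> P \<Longrightarrow> 1 \<le> n \<Longrightarrow> p0 \<le> p \<Longrightarrow> real p \<le> depth_bound n \<Longrightarrow>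
      ennreal (a * 2 powr (- bprf_alpha d * real p)) \<le> tree_risk d p n s P \<and>
      ennreal (\<sigma>\<^sup>2 / real n * 2 ^ p / 16) \<le> tree_risk d p n s P"
proof -
  obtain i b g \<eta> where R: "i < d" "valid_cell d b" "0 < cell_vol d b" "0 < g" "0 < \<eta>"
    "\<And>x. x \<in> cell_box d b \<Longrightarrow> g \<le> \<bar>grad x i\<bar>" "\<And>x. x \<in> cell_box d b \<Longrightarrow> \<eta> \<le> x i * (1 - x i)"
    using taylor_gradient_region[OF T nc] by metis
  obtain K where K: "0 \<le> K" "\<And>x. x \<in> cube d \<Longrightarrow> \<bar>s x\<bar> \<le> K" using taylor_bounded[OF T] by blast
  have s: "bounded_regression d s K" using K taylor_measurable[OF T] by (simp add: bounded_regression_def)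
  let ?k = "kappa d" let ?r = "rho d"
  have kr: "0 \<le> ?r" "?r < ?k" "0 < ?k" using d by (auto simp: field_simps)
  define a where "a = g\<^sup>2 / 32 * (6 * \<eta>) * cell_vol d b"
  define a' where "a' = g\<^sup>2 / 64 * cell_vol d b + C\<^sup>2 * (real d)\<^sup>2"
  have a: "0 < a" using R by (simp add: a_def)
  have "(\<lambda>p. a' * (?r / ?k) ^ p) \<longlonglongrightarrow> a' * 0"
    using kr by (intro tendsto_intros LIMSEQ_realpow_zero) auto
  then have "eventually (\<lambda>p. a' * (?r / ?k) ^ p < a / 2) sequentially"
    using a by (intro order_tendstoD(2)) auto
  then obtain p1 where p1: "\<And>p. p1 \<le> p \<Longrightarrow> a' * (?r / ?k) ^ p < a / 2"
    by (auto simp: eventually_sequentially)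
  show ?thesis
  proof (rule that)
    show "0 < a / 2" using a by simp
    fix \<sigma> :: real and P and n p :: nat
    assume L: "regression_law d s \<sigma> P" and n: "1 \<le> n" and p: "max p1 4 \<le> p" "real p \<le> depth_bound n"
    have "a' * ?r ^ p \<le> a / 2 * ?k ^ p"
      using p1[of p] p(1) kr by (simp add: power_divide field_simps)
    then have "a / 2 * ?k ^ p \<le> a * ?k ^ p - a' * ?r ^ p" by simp
    also have "\<dots> = g\<^sup>2 / 32 * ((6 * ?k ^ p * \<eta> - ?r ^ p / 2) * cell_vol d b) - C\<^sup>2 * (real d)\<^sup>2 * ?r ^ p"
      by (simp add: a_def a'_def algebra_simps)
    finally have "ennreal (a / 2 * ?k ^ p) \<le> ennreal (g\<^sup>2 / 32 * ((6 * ?k ^ p * \<eta> - ?r ^ p / 2) * cell_vol d b) - C\<^sup>2 * (real d)\<^sup>2 * ?r ^ p)"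
      by (rule ennreal_leI)
    also have "\<dots> \<le> tree_risk d p n s P"
      by (rule tree_risk_ge_bias[where i = i and \<eta> = \<eta>]) (fact d L T R(1,2) less_imp_le[OF R(4)] R(6) R(5,7))+
    finally have 1: "ennreal (a / 2 * 2 powr (- bprf_alpha d * real p)) \<le> tree_risk d p n s P"
      unfolding two_powr_bprf_alpha[OF d] .
    have p4: "4 \<le> p" using p by simp
    define k where "k = 1 / (2 * sqrt (real p))"
    note sc = small_cell_proportion[OF n p4 p(2), folded k_def]
    have "(2 / real n) powr k * (2 / (1 - k)) ^ p = 2 ^ p * ((2 / real n) powr k * (1 / (1 - k)) ^ p)"
      by (simp add: power_divide)
    also have "\<dots> \<le> 2 ^ p * (3 / 4)" using sc(3) by (intro mult_left_mono) auto
    finally have "2 ^ p / 4 \<le> 2 ^ p - (2 / real n) powr k * (2 / (1 - k)) ^ p" by simp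
    then have "\<sigma>\<^sup>2 / (4 * real n) * (2 ^ p / 4) \<le> \<sigma>\<^sup>2 / (4 * real n) * (2 ^ p - (2 / real n) powr k * (2 / (1 - k)) ^ p)"
      by (rule mult_left_mono) simp
    then have "ennreal (\<sigma>\<^sup>2 / real n * 2 ^ p / 16) \<le> ennreal (\<sigma>\<^sup>2 / (4 * real n) * (2 ^ p - (2 / real n) powr k * (2 / (1 - k)) ^ p))"
      by (intro ennreal_leI) simp
    also have "\<dots> \<le> tree_risk d p n s P" by (rule tree_risk_ge_noise[OF d L s n sc(1,2)])
    finally show "ennreal (a / 2 * 2 powr (- bprf_alpha d * real p)) \<le> tree_risk d p n s P \<and>
      ennreal (\<sigma>\<^sup>2 / real n * 2 ^ p / 16) \<le> tree_risk d p n s P" using 1 by simp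
  qed
qed

text \<open>
  The two bounds cross at \<open>y = r powr (- 1 / (\<alpha> + 1))\<close>.
\<close>

lemma balance_lower:
  fixes r y \<alpha> a b :: real
  assumes r: "0 < r" and y: "0 < y" and al: "0 < \<alpha>" and ab: "0 < a" "0 < b"
  shows "min a b * r powr (\<alpha> / (\<alpha> + 1)) \<le> max (a * y powr - \<alpha>) (b * (r * y))"
proof (cases "r powr (- (1 / (\<alpha> + 1))) \<le> y")
  case True
  have "r powr (\<alpha> / (\<alpha> + 1)) = r powr (1 + - (1 / (\<alpha> + 1)))"
    using al by (intro arg_cong[where f = "(powr) r"]) (simp add: field_simps)
  also have "\<dots> = r * r powr (- (1 / (\<alpha> + 1)))" using r by (simp only: powr_add powr_one)
  also have "\<dots> \<le> r * y" using True r by (intro mult_left_mono) auto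
  finally have "min a b * r powr (\<alpha> / (\<alpha> + 1)) \<le> b * (r * y)" using ab by (intro mult_mono) auto
  then show ?thesis by simp
next
  case False
  have "r powr (\<alpha> / (\<alpha> + 1)) = (r powr (- (1 / (\<alpha> + 1)))) powr - \<alpha>" by (simp add: powr_powr)
  also have "\<dots> \<le> y powr - \<alpha>" using False y al by (intro powr_mono2') auto
  finally have "min a b * r powr (\<alpha> / (\<alpha> + 1)) \<le> a * y powr - \<alpha>" using ab by (intro mult_mono) auto
  then show ?thesis by simp
qed

text \<open>
  Both rates hold in every dimension; the second one only uses \<open>p \<le> ln n\<close>.
\<close>

lemma tree_lower_rates:
  "\<exists>(p0 :: nat) (c :: real). 0 \<le> c \<and> (\<not> s constant_on cube d \<longrightarrow> 0 < c) \<and>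
    (\<forall>\<sigma> P n p. regression_framework d s \<sigma> P \<longrightarrow> n \<ge> 1 \<longrightarrow> p0 \<le> p \<longrightarrow> real p \<le> depth_bound n \<longrightarrow>
      ennreal (c * (\<sigma>\<^sup>2 / real n) powr (bprf_alpha d / (bprf_alpha d + 1))) \<le> tree_risk d p n s P \<and>
      ennreal (c * real n powr (- bprf_alpha d * ln 2)) \<le> tree_risk d p n s P)"
proof (cases "s constant_on cube d")
  case True
  then show ?thesis by (intro exI[of _ 0]) auto
next
  case nc: False
  show ?thesis
  proof (cases "\<exists>grad C. 1 \<le> d \<and> taylor_bound d s grad C")
    case False
    then have "\<not> regression_framework d s \<sigma> P" for \<sigma> P using regression_framework_taylor by metis
    then show ?thesis by (intro exI[of _ 0] exI[of _ 1]) auto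
  next
    case True
    then obtain grad C where d: "1 \<le> d" and T: "taylor_bound d s grad C" by blast
    obtain a p0 where a: "0 < a" and low: "\<And>\<sigma> P n p. regression_law d s \<sigma> P \<Longrightarrow> 1 \<le> n \<Longrightarrow> p0 \<le> p \<Longrightarrow> real p \<le> depth_bound n \<Longrightarrow>
      ennreal (a * 2 powr (- bprf_alpha d * real p)) \<le> tree_risk d p n s P \<and>
      ennreal (\<sigma>\<^sup>2 / real n * 2 ^ p / 16) \<le> tree_risk d p n s P"
      by (rule tree_lower_bound[OF d T nc]) blast
    have al: "0 < bprf_alpha d" by (rule bprf_alpha_pos[OF d])
    define c where "c = min a (1 / 16)"
    have c: "0 < c" "c \<le> a" using a by (auto simp: c_def)
    show ?thesis
    proof (intro exI[of _ p0] exI[of _ c] conjI allI impI)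
      fix \<sigma> P n p assume F: "regression_framework d s \<sigma> P" and n: "1 \<le> n" and p: "p0 \<le> p" "real p \<le> depth_bound n"
      have sig: "0 < \<sigma>" and L: "regression_law d s \<sigma> P" using F by (auto simp: regression_framework_def)
      note lb = low[OF L n p]
      have n0: "0 < real n" using n by simp
      have "c * (\<sigma>\<^sup>2 / real n) powr (bprf_alpha d / (bprf_alpha d + 1))
          \<le> max (a * (2 powr real p) powr - bprf_alpha d) (1 / 16 * (\<sigma>\<^sup>2 / real n * 2 powr real p))"
        unfolding c_def using sig n0 al a by (intro balance_lower) auto
      also have "\<dots> = max (a * 2 powr (- bprf_alpha d * real p)) (\<sigma>\<^sup>2 / real n * 2 ^ p / 16)"
      proof -
        have "(2 powr real p) powr - bprf_alpha d = 2 powr (- bprf_alpha d * real p)"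
          unfolding powr_powr by (simp add: mult.commute)
        moreover have "2 powr real p = 2 ^ p" by (simp add: powr_realpow)
        ultimately show ?thesis by simp
      qed
      finally have "ennreal (c * (\<sigma>\<^sup>2 / real n) powr (bprf_alpha d / (bprf_alpha d + 1)))
          \<le> ennreal (max (a * 2 powr (- bprf_alpha d * real p)) (\<sigma>\<^sup>2 / real n * 2 ^ p / 16))"
        by (rule ennreal_leI)
      also have "\<dots> \<le> tree_risk d p n s P" using lb by (simp add: max_def)
      finally show "ennreal (c * (\<sigma>\<^sup>2 / real n) powr (bprf_alpha d / (bprf_alpha d + 1))) \<le> tree_risk d p n s P" .
      have "real n powr (- bprf_alpha d * ln 2) = 2 powr (- bprf_alpha d * ln (real n))"
        using n0 by (simp add: powr_def)
      also have "\<dots> \<le> 2 powr (- bprf_alpha d * real p)"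
        using al p(2) depth_bound_le_ln[OF n] by (intro powr_mono) auto
      finally have "c * real n powr (- bprf_alpha d * ln 2) \<le> a * 2 powr (- bprf_alpha d * real p)"
        using c by (intro mult_mono) auto
      then have "ennreal (c * real n powr (- bprf_alpha d * ln 2)) \<le> ennreal (a * 2 powr (- bprf_alpha d * real p))"
        by (rule ennreal_leI)
      then show "ennreal (c * real n powr (- bprf_alpha d * ln 2)) \<le> tree_risk d p n s P"
        using lb by (meson order_trans)
    qed (use c in auto)
  qed
qed

text \<open>
  The constant is chosen before the law of the sample, for every dimension and regression function, smooth or
  not.
\<close>

lemma forest_upper_constant:
  "\<exists>A. 0 \<le> A \<and> (\<forall>\<sigma> P n p k. regression_framework d s \<sigma> P \<longrightarrow> 1 \<le> n \<longrightarrow> 0 \<le> k \<longrightarrow> k < 1 \<longrightarrow>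
    forest_risk d p n s P \<le> ennreal (A * (2 powr (- 2 * bprf_alpha d * real p)
      + 2 ^ p / real n * (\<sigma>\<^sup>2 + rho d ^ p + real n powr - k * (1 / (1 - k)) ^ p))))"
proof (cases "\<exists>grad C. 1 \<le> d \<and> taylor_bound d s grad C")
  case False
  then have "\<not> regression_framework d s \<sigma> P" for \<sigma> P using regression_framework_taylor by metis
  then show ?thesis by (intro exI[of _ 0]) auto
next
  case True
  then obtain grad C where d: "1 \<le> d" and T: "taylor_bound d s grad C" by blast
  have sq: "(kappa d ^ p)\<^sup>2 = 2 powr (- 2 * bprf_alpha d * real p)" for p
  proof -
    have "(kappa d ^ p)\<^sup>2 = kappa d ^ (p * 2)" by (rule power_mult[symmetric])
    also have "\<dots> = 2 powr (- bprf_alpha d * real (p * 2))" by (rule two_powr_bprf_alpha[OF d, symmetric])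
    also have "- bprf_alpha d * real (p * 2) = - 2 * bprf_alpha d * real p" by simp
    finally show ?thesis .
  qed
  show ?thesis
    using forest_risk_le[OF d T] unfolding sq regression_framework_def by metis
qed

text \<open>
  The depth is the largest admissible one.
\<close>

lemma forest_high_dim_arith:
  assumes d: "4 \<le> d" and n: "1 \<le> n" and v: "0 \<le> v"
  defines "p \<equiv> nat \<lfloor>depth_bound n\<rfloor>"
  defines "t \<equiv> real n powr (- 2 * bprf_alpha d * ln 2) * 2 powr (2 * bprf_alpha d * sqrt 5 * sqrt (ln (real n) + 5 / 4))"
  shows "real p \<le> depth_bound n"
    "2 powr (- 2 * bprf_alpha d * real p) + 2 ^ p / real n * v \<le> (2 powr (2 * bprf_alpha d) + 2 powr (5 / 2) * v) * t"
proof -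
  let ?P = "depth_bound n" let ?u = "sqrt (ln (real n) + 5 / 4)" let ?a = "bprf_alpha d"
  have al: "0 < ?a" using d by (intro bprf_alpha_pos) auto
  have n0: "0 < real n" using n by simp
  have P0: "0 \<le> ?P" by (simp add: depth_bound_def)
  have pP: "real p \<le> ?P" "?P < real p + 1" using P0 unfolding p_def by linarith+
  show "real p \<le> ?P" by fact
  have u: "0 \<le> ?u" using n by simp
  have nx: "real n powr x = 2 powr (x * ln (real n) / ln 2)" for x using n0 by (simp add: powr_def)
  have t: "t = 2 powr (- 2 * ?a * ln (real n) + 2 * ?a * sqrt 5 * ?u)"
    unfolding t_def nx by (simp add: algebra_simps flip: powr_add)
  have "2 powr (- 2 * ?a * real p) \<le> 2 powr (2 * ?a + (- 2 * ?a * ln (real n) + 2 * ?a * sqrt 5 * ?u))"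
  proof (intro powr_mono)
    have "2 * ?a * (?P - 1) \<le> 2 * ?a * real p" using pP al by (intro mult_left_mono) auto
    moreover have "0 \<le> 5 * ?a" using al by simp
    ultimately show "- 2 * ?a * real p \<le> 2 * ?a + (- 2 * ?a * ln (real n) + 2 * ?a * sqrt 5 * ?u)"
      unfolding depth_bound_eq[OF n] by (simp add: algebra_simps)
  qed simp
  also have "\<dots> = 2 powr (2 * ?a) * t" by (simp only: t powr_add)
  finally have 1: "2 powr (- 2 * ?a * real p) \<le> 2 powr (2 * ?a) * t" .
  have "2 ^ p / real n \<le> 2 powr (5 / 2) * t"
  proof -
    have "2 ^ p / real n = 2 powr (real p - ln (real n) / ln 2)"
      using n0 by (simp add: powr_diff powr_realpow) (simp add: powr_def)
    also have "\<dots> \<le> 2 powr (5 / 2 + (- 2 * ?a * ln (real n) + 2 * ?a * sqrt 5 * ?u))"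
    proof (intro powr_mono)
      have "(1 + 2 * ?a) * ln 2 * (ln (real n) / ln 2) \<le> 1 * (ln (real n) / ln 2)"
        using ln2_alpha_large[OF d] n by (intro mult_right_mono) auto
      then have "(1 + 2 * ?a) * ln (real n) \<le> ln (real n) / ln 2" by simp
      moreover have "0 \<le> 2 * ?a * sqrt 5 * ?u" "0 \<le> sqrt 5 * ?u" using al u by auto
      ultimately show "real p - ln (real n) / ln 2 \<le> 5 / 2 + (- 2 * ?a * ln (real n) + 2 * ?a * sqrt 5 * ?u)"
        using pP(1) unfolding depth_bound_eq[OF n] by (simp add: algebra_simps)
    qed simp
    also have "\<dots> = 2 powr (5 / 2) * t" by (simp only: t powr_add)
    finally show ?thesis .
  qed
  then have "2 ^ p / real n * v \<le> 2 powr (5 / 2) * t * v" using v by (rule mult_right_mono)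
  with 1 show "2 powr (- 2 * ?a * real p) + 2 ^ p / real n * v \<le> (2 powr (2 * ?a) + 2 powr (5 / 2) * v) * t"
    by (simp add: algebra_simps)
qed

text \<open>
  The subexponential factor is absorbed by any power, as \<open>c u \<le> \<delta> u^2 + c^2 / (4 \<delta>)\<close>.
\<close>

lemma forest_high_dim_rate:
  assumes d: "1 \<le> d" and n: "1 \<le> n" and \<delta>: "0 < \<delta>"
  shows "2 powr (2 * bprf_alpha d * sqrt 5 * sqrt (ln (real n) + 5 / 4))
    \<le> exp (5 * \<delta> / 4 + (2 * bprf_alpha d * sqrt 5 * ln 2)\<^sup>2 / (4 * \<delta>)) * real n powr \<delta>"
proof -
  let ?u = "sqrt (ln (real n) + 5 / 4)" let ?c = "2 * bprf_alpha d * sqrt 5 * ln 2"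
  have n0: "0 < real n" using n by simp
  have u2: "?u\<^sup>2 = ln (real n) + 5 / 4" using n by simp
  have "0 \<le> (2 * \<delta> * ?u - ?c)\<^sup>2" by simp
  then have "4 * \<delta> * (?c * ?u) \<le> 4 * \<delta> * (\<delta> * ?u\<^sup>2) + ?c\<^sup>2"
    by (simp add: power2_eq_square algebra_simps)
  then have "?c * ?u \<le> \<delta> * ?u\<^sup>2 + ?c\<^sup>2 / (4 * \<delta>)" using \<delta> by (simp add: field_simps)
  then have "?c * ?u \<le> (5 * \<delta> / 4 + ?c\<^sup>2 / (4 * \<delta>)) + \<delta> * ln (real n)" unfolding u2 by (simp add: algebra_simps)
  then have "exp (?c * ?u) \<le> exp ((5 * \<delta> / 4 + ?c\<^sup>2 / (4 * \<delta>)) + \<delta> * ln (real n))" by simp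
  then show ?thesis using n0 by (simp add: exp_add powr_def ac_simps)
qed

text \<open>
  The balancing depth is eventually admissible since \<open>b < 1\<close>. The exponent \<open>k\<close> is chosen such that
  \<open>k + b ln (1 - k) > 0\<close>, which makes the contribution of the empty cells a negative power of \<open>n\<close>.
\<close>

lemma forest_low_dim_depth:
  assumes d: "1 \<le> d" "d \<le> 3" and v: "0 < v"
  defines "b \<equiv> 1 / ((1 + 2 * bprf_alpha d) * ln 2)"
  defines "k \<equiv> (1 - b) / 4"
  defines "p \<equiv> \<lambda>n. nat \<lfloor>b * (ln (real n) - ln v)\<rfloor>"
  shows "0 \<le> k" "k < 1"
    "eventually (\<lambda>n. 1 \<le> n \<and> real (p n) \<le> b * (ln (real n) - ln v) \<and> b * (ln (real n) - ln v) < real (p n) + 1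
      \<and> real (p n) \<le> depth_bound n \<and> rho d ^ p n \<le> v \<and> real n powr - k * (1 / (1 - k)) ^ p n \<le> v) sequentially"
proof -
  have b: "0 < b" "b < 1" using ln2_alpha_small[OF d] unfolding b_def by auto
  show k0: "0 \<le> k" and k1: "k < 1" using b by (auto simp: k_def)
  have k4: "0 < k" "k \<le> 1 / 2" using b by (auto simp: k_def)
  let ?r = "rho d"
  have r: "0 \<le> ?r" "?r < 1" using d by (auto simp: field_simps)
  have lim: "filterlim (\<lambda>n. ln (real n)) at_top sequentially"
    by (rule filterlim_compose[OF ln_at_top filterlim_real_sequentially])
  have ev: "eventually (\<lambda>n. y \<le> ln (real n)) sequentially" for y
    using lim by (auto simp: filterlim_at_top)
  obtain N where N: "\<And>m. N \<le> m \<Longrightarrow> ?r ^ m < v"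
    using order_tendstoD(2)[OF LIMSEQ_realpow_zero[OF r] v] by (auto simp: eventually_sequentially)
  define e where "e = k + b * ln (1 - k)"
  have e: "0 < e"
  proof -
    have "- k - 2 * k\<^sup>2 \<le> ln (1 - k)" using k0 k4 by (intro ln_one_minus_pos_lower_bound) auto
    then have "b * (- k - 2 * k\<^sup>2) \<le> b * ln (1 - k)" using b by (intro mult_left_mono) auto
    moreover have "k + b * (- k - 2 * k\<^sup>2) = k * (1 - b) * (1 - b / 2)"
      by (simp add: k_def power2_eq_square field_simps)
    moreover have "0 < k * (1 - b) * (1 - b / 2)" using k4 b by simp
    ultimately show ?thesis unfolding e_def by linarith
  qed
  let ?y1 = "max (ln v) ((real N + 1) / b + ln v)"
  let ?y2 = "(5 / (2 * (1 - b)) + \<bar>b * ln v\<bar>) * 2 / (1 - b)"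
  let ?y3 = "(- ln v + b * ln (1 - k) * ln v) / e"
  show "eventually (\<lambda>n. 1 \<le> n \<and> real (p n) \<le> b * (ln (real n) - ln v) \<and> b * (ln (real n) - ln v) < real (p n) + 1
      \<and> real (p n) \<le> depth_bound n \<and> ?r ^ p n \<le> v \<and> real n powr - k * (1 / (1 - k)) ^ p n \<le> v) sequentially"
    using eventually_ge_at_top[of 1] ev[of ?y1] ev[of ?y2] ev[of ?y3]
  proof eventually_elim
    fix n :: nat assume n: "1 \<le> n" and y1: "?y1 \<le> ln (real n)" and y2: "?y2 \<le> ln (real n)" and y3: "?y3 \<le> ln (real n)"
    let ?X = "ln (real n)" let ?x = "b * (?X - ln v)"
    have n0: "0 < real n" using n by simp
    have y1': "ln v \<le> ?X" "(real N + 1) / b + ln v \<le> ?X" using max.boundedE[OF y1] by blast+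
    have x0: "0 \<le> ?x" using y1' b by (intro mult_nonneg_nonneg) auto
    have p: "real (p n) \<le> ?x" "?x < real (p n) + 1" using x0 unfolding p_def by linarith+
    have dep: "?x \<le> depth_bound n"
    proof -
      define u where "u = sqrt (?X + 5 / 4)"
      have u2: "u\<^sup>2 = ?X + 5 / 4" using n by (simp add: u_def)
      have "2 * ((1 - b) * u) * sqrt 5 \<le> ((1 - b) * u)\<^sup>2 + (sqrt 5)\<^sup>2" by (rule sum_squares_bound)
      moreover have "((1 - b) * u)\<^sup>2 = ((1 - b) / 2 * u\<^sup>2) * (2 * (1 - b))"
        by (simp add: power2_eq_square field_simps)
      ultimately have "(sqrt 5 * u) * (2 * (1 - b)) \<le> ((1 - b) / 2 * u\<^sup>2) * (2 * (1 - b)) + 5"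
        by (simp add: ac_simps)
      also have "\<dots> = ((1 - b) / 2 * u\<^sup>2 + 5 / (2 * (1 - b))) * (2 * (1 - b))"
      proof -
        have "5 / y * y = 5" if "y \<noteq> 0" for y :: real using that by simp
        moreover have "2 * (1 - b) \<noteq> 0" using b by simp
        ultimately have "5 / (2 * (1 - b)) * (2 * (1 - b)) = 5" by blast
        then show ?thesis unfolding distrib_right by (simp only:)
      qed
      finally have "sqrt 5 * u \<le> (1 - b) / 2 * u\<^sup>2 + 5 / (2 * (1 - b))"
        by (rule mult_right_le_imp_le) (use b in simp)
      then have 1: "sqrt 5 * u \<le> (1 - b) / 2 * (?X + 5 / 4) + 5 / (2 * (1 - b))" unfolding u2 .
      have "(1 - b) / 2 * ?y2 \<le> (1 - b) / 2 * ?X" using y2 b by (intro mult_left_mono) auto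
      also have "(1 - b) / 2 * ?y2 = 5 / (2 * (1 - b)) + \<bar>b * ln v\<bar>"
      proof -
        have "y / 2 * (z * 2 / y) = z" if "0 < y" for y z :: real using that by simp
        then show ?thesis using b by (simp only: diff_gt_0_iff_gt)
      qed
      finally have 2: "5 / (2 * (1 - b)) + \<bar>b * ln v\<bar> \<le> (1 - b) / 2 * ?X" .
      have 3: "- (b * ln v) \<le> \<bar>b * ln v\<bar>" by simp
      have 4: "(1 - b) / 2 * (5 / 4) \<le> 5 / 2" using b by simp
      have "?x = b * ?X - b * ln v" by (simp add: right_diff_distrib)
      also have "\<dots> \<le> ?X + 5 / 2 - ((1 - b) / 2 * (?X + 5 / 4) + 5 / (2 * (1 - b)))"
        using 2 3 4 by (simp add: field_simps)
      also have "\<dots> \<le> ?X + 5 / 2 - sqrt 5 * u" using 1 by linarith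
      finally show ?thesis unfolding depth_bound_eq[OF n] u_def .
    qed
    have "?r ^ p n \<le> v"
    proof -
      have "(real N + 1) / b \<le> ?X - ln v" using y1' by auto
      then have "real N + 1 \<le> ?x" using b by (simp add: field_simps)
      then have "N \<le> p n" using p(2) by linarith
      then show ?thesis using N by (simp add: less_imp_le)
    qed
    moreover have "real n powr - k * (1 / (1 - k)) ^ p n \<le> v"
    proof -
      have "real n powr - k * (1 / (1 - k)) ^ p n = exp (- k * ?X - real (p n) * ln (1 - k))"
      proof -
        have "(1 / (1 - k)) ^ p n = exp (- real (p n) * ln (1 - k))"
          using k1 by (simp add: exp_minus exp_of_nat_mult power_divide divide_inverse power_inverse)
        then show ?thesis using n0 by (simp add: powr_def flip: exp_add)
      qed
      also have "\<dots> \<le> exp (ln v)"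
      proof (subst exp_le_cancel_iff)
        have "ln (1 - k) \<le> 0" using k0 k1 by simp
        then have "?x * ln (1 - k) \<le> real (p n) * ln (1 - k)" using p(1) by (intro mult_right_mono_neg)
        moreover have "- ln v + b * ln (1 - k) * ln v \<le> ?X * e" using y3 e by (simp add: divide_le_eq)
        ultimately show "- k * ?X - real (p n) * ln (1 - k) \<le> ln v"
          unfolding e_def by (simp add: algebra_simps)
      qed
      finally show ?thesis using v by simp
    qed
    ultimately show "1 \<le> n \<and> real (p n) \<le> ?x \<and> ?x < real (p n) + 1
      \<and> real (p n) \<le> depth_bound n \<and> ?r ^ p n \<le> v \<and> real n powr - k * (1 / (1 - k)) ^ p n \<le> v"
      using n p dep by auto
  qed
qed

lemma forest_low_dim_arith:
  assumes d: "1 \<le> d" and n: "1 \<le> n" and v: "0 < v"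
  defines "b \<equiv> 1 / ((1 + 2 * bprf_alpha d) * ln 2)"
  assumes p: "real p \<le> b * (ln (real n) - ln v)" "b * (ln (real n) - ln v) < real p + 1"
  shows "2 powr (- 2 * bprf_alpha d * real p) + 2 ^ p / real n * (3 * v)
    \<le> (2 powr (2 * bprf_alpha d) + 3) * (v / real n) powr (2 * bprf_alpha d / (2 * bprf_alpha d + 1))"
proof -
  let ?a = "bprf_alpha d" let ?l = "(ln (real n) - ln v) / ln 2"
  have al: "0 < ?a" by (rule bprf_alpha_pos[OF d])
  have n0: "0 < real n" using n by simp
  have ln2: "0 < ln (2::real)" by simp
  have bl: "b * (ln (real n) - ln v) = ?l / (1 + 2 * ?a)" by (simp add: b_def)
  have vn: "(v / real n) powr x = 2 powr (- x * ?l)" for x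
  proof -
    have "(v / real n) powr x = exp (x * (ln v - ln (real n)))" using v n0 by (simp add: powr_def ln_div)
    also have "x * (ln v - ln (real n)) = (- x * ?l) * ln 2"
    proof -
      have "?l * ln 2 = ln (real n) - ln v" by simp
      then show ?thesis by (simp only: mult.assoc) (simp add: algebra_simps)
    qed
    finally show ?thesis by (simp add: powr_def)
  qed
  have "2 powr (- 2 * ?a * real p) \<le> 2 powr (2 * ?a + - (2 * ?a / (2 * ?a + 1)) * ?l)"
  proof (intro powr_mono)
    have "2 * ?a * (?l / (1 + 2 * ?a)) \<le> 2 * ?a * (real p + 1)"
      using p(2) al unfolding bl by (intro mult_left_mono) auto
    then show "- 2 * ?a * real p \<le> 2 * ?a + - (2 * ?a / (2 * ?a + 1)) * ?l"
      by (simp add: algebra_simps)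
  qed simp
  also have "\<dots> = 2 powr (2 * ?a) * (v / real n) powr (2 * ?a / (2 * ?a + 1))" by (simp only: powr_add vn)
  finally have 1: "2 powr (- 2 * ?a * real p) \<le> 2 powr (2 * ?a) * (v / real n) powr (2 * ?a / (2 * ?a + 1))" .
  have "2 ^ p * (v / real n) = 2 powr (real p + - 1 * ?l)"
    using vn[of 1] v n0 by (simp only: powr_add powr_realpow) (simp add: powr_one)
  also have "\<dots> \<le> 2 powr (- (2 * ?a / (2 * ?a + 1)) * ?l)"
  proof (intro powr_mono)
    have "?l / (1 + 2 * ?a) + - 1 * ?l = - (2 * ?a / (2 * ?a + 1)) * ?l"
      using al by (simp add: divide_simps) (simp add: algebra_simps)
    then show "real p + - 1 * ?l \<le> - (2 * ?a / (2 * ?a + 1)) * ?l" using p(1) unfolding bl by linarith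
  qed simp
  also have "\<dots> = (v / real n) powr (2 * ?a / (2 * ?a + 1))" by (rule vn[symmetric])
  finally have "2 ^ p * (v / real n) \<le> (v / real n) powr (2 * ?a / (2 * ?a + 1))" .
  moreover have "2 ^ p / real n * (3 * v) = 3 * (2 ^ p * (v / real n))" by simp
  ultimately show ?thesis using 1 unfolding distrib_right by linarith
qed


lemma forest_low_dim_bound:
  fixes d :: nat and v :: real
  assumes d: "1 \<le> d" "d \<le> 3" and v: "0 < v"
  shows "\<exists>N. \<forall>n\<ge>N. \<exists>p k. 1 \<le> n \<and> 0 \<le> k \<and> k < 1 \<and> real p \<le> depth_bound n \<and>
    2 powr (- 2 * bprf_alpha d * real p)
      + 2 ^ p / real n * (v + rho d ^ p + real n powr - k * (1 / (1 - k)) ^ p)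
    \<le> (2 powr (2 * bprf_alpha d) + 3) * (v / real n) powr (2 * bprf_alpha d / (2 * bprf_alpha d + 1))"
proof -
  define b where "b = 1 / ((1 + 2 * bprf_alpha d) * ln 2)"
  define k where "k = (1 - b) / 4"
  define p where "p = (\<lambda>n. nat \<lfloor>b * (ln (real n) - ln v)\<rfloor>)"
  have k: "0 \<le> k" "k < 1"
    unfolding k_def b_def by (rule forest_low_dim_depth(1)[OF d v], rule forest_low_dim_depth(2)[OF d v])
  have depth: "eventually (\<lambda>n. 1 \<le> n \<and> real (p n) \<le> b * (ln (real n) - ln v)
      \<and> b * (ln (real n) - ln v) < real (p n) + 1 \<and> real (p n) \<le> depth_bound n
      \<and> rho d ^ p n \<le> v \<and> real n powr - k * (1 / (1 - k)) ^ p n \<le> v) sequentially"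
    unfolding k_def p_def b_def by (rule forest_low_dim_depth(3)[OF d v])
  obtain N where N: "\<And>n. N \<le> n \<Longrightarrow> 1 \<le> n \<and> real (p n) \<le> b * (ln (real n) - ln v)
      \<and> b * (ln (real n) - ln v) < real (p n) + 1 \<and> real (p n) \<le> depth_bound n
      \<and> rho d ^ p n \<le> v \<and> real n powr - k * (1 / (1 - k)) ^ p n \<le> v"
    using depth unfolding eventually_sequentially by blast
  show ?thesis
  proof (rule exI[of _ N], intro allI impI)
    fix n assume "N \<le> n"
    note * = N[OF this]
    then have n: "1 \<le> n" by blast
    let ?w = "v + rho d ^ p n + real n powr - k * (1 / (1 - k)) ^ p n"
    have "2 ^ p n / real n * ?w \<le> 2 ^ p n / real n * (3 * v)"
      using * by (intro mult_left_mono) auto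
    moreover have "2 powr (- 2 * bprf_alpha d * real (p n)) + 2 ^ p n / real n * (3 * v)
      \<le> (2 powr (2 * bprf_alpha d) + 3) * (v / real n) powr (2 * bprf_alpha d / (2 * bprf_alpha d + 1))"
      by (rule forest_low_dim_arith[OF d(1) n v]) (use * in \<open>simp_all only: b_def\<close>)
    ultimately show "\<exists>p k. 1 \<le> n \<and> 0 \<le> k \<and> k < 1 \<and> real p \<le> depth_bound n \<and>
      2 powr (- 2 * bprf_alpha d * real p)
        + 2 ^ p / real n * (v + rho d ^ p + real n powr - k * (1 / (1 - k)) ^ p)
      \<le> (2 powr (2 * bprf_alpha d) + 3) * (v / real n) powr (2 * bprf_alpha d / (2 * bprf_alpha d + 1))"
      using * k by (intro exI[of _ "p n"] exI[of _ k] conjI) linarith+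
  qed
qed

lemma forest_high_dim_bound:
  fixes A :: real
  assumes F: "regression_framework d s \<sigma> P" and d: "4 \<le> d" and n: "1 \<le> n" and A: "0 \<le> A"
    and risk: "\<And>p k. 0 \<le> k \<Longrightarrow> k < 1 \<Longrightarrow> forest_risk d p n s P \<le> ennreal (A * (2 powr (- 2 * bprf_alpha d * real p)
      + 2 ^ p / real n * (\<sigma>\<^sup>2 + rho d ^ p + real n powr - k * (1 / (1 - k)) ^ p)))"
  shows "(INF p\<in>{p. real p \<le> depth_bound n}. forest_risk d p n s P)
    \<le> ennreal (A * (2 powr (2 * bprf_alpha d) + 2 powr (5 / 2) * (\<sigma>\<^sup>2 + 2)) * real n powr (- 2 * bprf_alpha d * ln 2)
          * 2 powr (2 * bprf_alpha d * sqrt 5 * sqrt (ln (real n) + 5 / 4)))"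
proof -
  define p where "p = nat \<lfloor>depth_bound n\<rfloor>"
  have v: "0 \<le> \<sigma>\<^sup>2 + 2" by simp
  note ar = forest_high_dim_arith[OF d n v, folded p_def]
  have r: "0 \<le> rho d" "rho d \<le> 1" using d by (auto simp: field_simps)
  have "rho d ^ p \<le> 1" using r by (rule power_le_one)
  then have "\<sigma>\<^sup>2 + rho d ^ p + real n powr - 0 * (1 / (1 - 0)) ^ p \<le> \<sigma>\<^sup>2 + 2"
    using n by simp
  then have "2 ^ p / real n * (\<sigma>\<^sup>2 + rho d ^ p + real n powr - 0 * (1 / (1 - 0)) ^ p)
      \<le> 2 ^ p / real n * (\<sigma>\<^sup>2 + 2)"
    by (rule mult_left_mono) simp
  then have "A * (2 powr (- 2 * bprf_alpha d * real p)
      + 2 ^ p / real n * (\<sigma>\<^sup>2 + rho d ^ p + real n powr - 0 * (1 / (1 - 0)) ^ p))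
    \<le> A * ((2 powr (2 * bprf_alpha d) + 2 powr (5 / 2) * (\<sigma>\<^sup>2 + 2)) * (real n powr (- 2 * bprf_alpha d * ln 2)
          * 2 powr (2 * bprf_alpha d * sqrt 5 * sqrt (ln (real n) + 5 / 4))))"
    using ar(2) A by (intro mult_left_mono) linarith+
  then have "forest_risk d p n s P \<le> ennreal (A * ((2 powr (2 * bprf_alpha d) + 2 powr (5 / 2) * (\<sigma>\<^sup>2 + 2))
      * (real n powr (- 2 * bprf_alpha d * ln 2) * 2 powr (2 * bprf_alpha d * sqrt 5 * sqrt (ln (real n) + 5 / 4)))))"
    by (rule order_trans[OF risk[of 0 p] ennreal_leI, rotated 2]) simp_all
  then show ?thesis
    using ar(1) by (intro INF_lower2[of p]) (simp_all add: mult.assoc)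
qed

theorem mainTheorem11:
  shows
    "(\<exists>(N :: real \<Rightarrow> nat) (C :: nat \<Rightarrow> ((nat \<Rightarrow> real) \<Rightarrow> real) \<Rightarrow> real).
       \<forall>d s \<sigma> P n. regression_framework d s \<sigma> P \<longrightarrow> d \<le> 3 \<longrightarrow> n \<ge> N (\<sigma>\<^sup>2) \<longrightarrow>
         (INF p\<in>{p. real p \<le> depth_bound n}. forest_risk d p n s P)
           \<le> ennreal (C d s * (\<sigma>\<^sup>2 / real n) powr (2 * bprf_alpha d / (2 * bprf_alpha d + 1)))) \<and>
     (\<exists>(C :: nat \<Rightarrow> ((nat \<Rightarrow> real) \<Rightarrow> real) \<Rightarrow> real \<Rightarrow> real).
       \<forall>d s \<sigma> P n. regression_framework d s \<sigma> P \<longrightarrow> d \<ge> 4 \<longrightarrow> n \<ge> 1 \<longrightarrow>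
         (INF p\<in>{p. real p \<le> depth_bound n}. forest_risk d p n s P)
           \<le> ennreal (C d s (\<sigma>\<^sup>2) * real n powr (- 2 * bprf_alpha d * ln 2)
                * 2 powr (2 * bprf_alpha d * sqrt 5 * sqrt (ln (real n) + 5 / 4)))) \<and>
     (\<forall>\<delta>>0. \<exists>(C :: nat \<Rightarrow> ((nat \<Rightarrow> real) \<Rightarrow> real) \<Rightarrow> real \<Rightarrow> real).
       \<forall>d s \<sigma> P n. regression_framework d s \<sigma> P \<longrightarrow> d \<ge> 4 \<longrightarrow> n \<ge> 1 \<longrightarrow>
         (INF p\<in>{p. real p \<le> depth_bound n}. forest_risk d p n s P)
           \<le> ennreal (C d s (\<sigma>\<^sup>2) * real n powr (- (2 * bprf_alpha d * ln 2 - \<delta>)))) \<and>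
     (\<exists>(p0 :: nat \<Rightarrow> ((nat \<Rightarrow> real) \<Rightarrow> real) \<Rightarrow> nat) (N :: nat \<Rightarrow> real \<Rightarrow> nat)
       (c :: nat \<Rightarrow> ((nat \<Rightarrow> real) \<Rightarrow> real) \<Rightarrow> real).
       (\<forall>d s. c d s \<ge> 0 \<and> (\<not> s constant_on cube d \<longrightarrow> c d s > 0)) \<and>
       (\<forall>d s \<sigma> P n p. regression_framework d s \<sigma> P \<longrightarrow> n \<ge> N d (\<sigma>\<^sup>2) \<longrightarrow>
          p0 d s \<le> p \<longrightarrow> real p \<le> depth_bound n \<longrightarrow>
          (d \<le> 3 \<longrightarrow>
             ennreal (c d s * (\<sigma>\<^sup>2 / real n) powr (bprf_alpha d / (bprf_alpha d + 1)))
               \<le> tree_risk d p n s P) \<and>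
          (d \<ge> 4 \<longrightarrow>
             ennreal (c d s * real n powr (- bprf_alpha d * ln 2)) \<le> tree_risk d p n s P)))"
proof (intro conjI)
  define Q where "Q d s A \<longleftrightarrow> 0 \<le> A \<and> (\<forall>\<sigma> P n p k. regression_framework d s \<sigma> P \<longrightarrow> 1 \<le> n \<longrightarrow> 0 \<le> k \<longrightarrow> k < 1 \<longrightarrow>
    forest_risk d p n s P \<le> ennreal (A * (2 powr (- 2 * bprf_alpha d * real p)
      + 2 ^ p / real n * (\<sigma>\<^sup>2 + rho d ^ p + real n powr - k * (1 / (1 - k)) ^ p))))" for d s and A :: real
  define A where "A d s = (SOME A. Q d s A)" for d s
  have QA: "Q d s (A d s)" for d s
    unfolding A_def by (rule someI_ex) (use forest_upper_constant[of d s] in \<open>simp add: Q_def\<close>)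
  have A0: "0 \<le> A d s" for d s using QA[of d s] by (simp add: Q_def)
  have risk: "forest_risk d p n s P \<le> ennreal (A d s * (2 powr (- 2 * bprf_alpha d * real p)
      + 2 ^ p / real n * (\<sigma>\<^sup>2 + rho d ^ p + real n powr - k * (1 / (1 - k)) ^ p)))"
    if "regression_framework d s \<sigma> P" "1 \<le> n" "0 \<le> k" "k < 1" for d s \<sigma> P n p k
    using QA[of d s] that unfolding Q_def by blast

  let ?rate = "\<lambda>d v n. (v / real n) powr (2 * bprf_alpha d / (2 * bprf_alpha d + 1))"
  define G where "G d v N \<longleftrightarrow> (\<forall>n\<ge>N. \<exists>p k. 1 \<le> n \<and> 0 \<le> k \<and> k < 1 \<and> real p \<le> depth_bound n \<and>
    2 powr (- 2 * bprf_alpha d * real p)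
      + 2 ^ p / real n * (v + rho d ^ p + real n powr - k * (1 / (1 - k)) ^ p)
    \<le> (2 powr (2 * bprf_alpha d) + 3) * ?rate d v n)" for d :: nat and v :: real and N :: nat
  define M where "M d v = (SOME N. G d v N)" for d v
  have GM: "G d v (M d v)" if "1 \<le> d" "d \<le> 3" "0 < v" for d v
    unfolding M_def by (rule someI_ex) (use forest_low_dim_bound[OF that] in \<open>simp add: G_def\<close>)
  show "\<exists>(N :: real \<Rightarrow> nat) (C :: nat \<Rightarrow> ((nat \<Rightarrow> real) \<Rightarrow> real) \<Rightarrow> real).
       \<forall>d s \<sigma> P n. regression_framework d s \<sigma> P \<longrightarrow> d \<le> 3 \<longrightarrow> n \<ge> N (\<sigma>\<^sup>2) \<longrightarrow>
         (INF p\<in>{p. real p \<le> depth_bound n}. forest_risk d p n s P)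
           \<le> ennreal (C d s * (\<sigma>\<^sup>2 / real n) powr (2 * bprf_alpha d / (2 * bprf_alpha d + 1)))"
    \<comment> \<open>The threshold depends on the variance only: it is the largest one over the three dimensions.\<close>
  proof (rule exI[of _ "\<lambda>v. Max ((\<lambda>d. M d v) ` {..3})"], rule exI[of _ "\<lambda>d s. A d s * (2 powr (2 * bprf_alpha d) + 3)"],
      intro allI impI)
    fix d n :: nat and s P and \<sigma> :: real
    assume F: "regression_framework d s \<sigma> P" and d3: "d \<le> 3" and n: "Max ((\<lambda>d. M d (\<sigma>\<^sup>2)) ` {..3}) \<le> n"
    have d: "1 \<le> d" and v: "0 < \<sigma>\<^sup>2" using F by (auto simp: regression_framework_def)
    have "M d (\<sigma>\<^sup>2) \<le> n" using n d3 by (intro order_trans[OF Max_ge n]) auto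
    then obtain p k where pk: "1 \<le> n" "0 \<le> k" "k < 1" "real p \<le> depth_bound n"
      "2 powr (- 2 * bprf_alpha d * real p)
        + 2 ^ p / real n * (\<sigma>\<^sup>2 + rho d ^ p + real n powr - k * (1 / (1 - k)) ^ p)
        \<le> (2 powr (2 * bprf_alpha d) + 3) * ?rate d (\<sigma>\<^sup>2) n"
      using GM[OF d d3 v] unfolding G_def by blast
    have "forest_risk d p n s P \<le> ennreal (A d s * ((2 powr (2 * bprf_alpha d) + 3) * ?rate d (\<sigma>\<^sup>2) n))"
      by (rule order_trans[OF risk[OF F pk(1-3)] ennreal_leI[OF mult_left_mono[OF pk(5) A0]]])
    then show "(INF p\<in>{p. real p \<le> depth_bound n}. forest_risk d p n s P)
        \<le> ennreal (A d s * (2 powr (2 * bprf_alpha d) + 3) * ?rate d (\<sigma>\<^sup>2) n)"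
      using pk(4) by (intro INF_lower2[of p]) (simp_all add: mult.assoc)
  qed

  define B where "B d s v = A d s * (2 powr (2 * bprf_alpha d) + 2 powr (5 / 2) * (v + 2))" for d s v
  have high: "(INF p\<in>{p. real p \<le> depth_bound n}. forest_risk d p n s P)
      \<le> ennreal (B d s (\<sigma>\<^sup>2) * real n powr (- 2 * bprf_alpha d * ln 2)
          * 2 powr (2 * bprf_alpha d * sqrt 5 * sqrt (ln (real n) + 5 / 4)))"
    if "regression_framework d s \<sigma> P" "4 \<le> d" "1 \<le> n" for d s \<sigma> P n
    unfolding B_def by (rule forest_high_dim_bound[OF that A0 risk[OF that(1,3)]])
  then show "\<exists>(C :: nat \<Rightarrow> ((nat \<Rightarrow> real) \<Rightarrow> real) \<Rightarrow> real \<Rightarrow> real).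
       \<forall>d s \<sigma> P n. regression_framework d s \<sigma> P \<longrightarrow> d \<ge> 4 \<longrightarrow> n \<ge> 1 \<longrightarrow>
         (INF p\<in>{p. real p \<le> depth_bound n}. forest_risk d p n s P)
           \<le> ennreal (C d s (\<sigma>\<^sup>2) * real n powr (- 2 * bprf_alpha d * ln 2)
                * 2 powr (2 * bprf_alpha d * sqrt 5 * sqrt (ln (real n) + 5 / 4)))"
    by blast

  show "\<forall>\<delta>>0. \<exists>(C :: nat \<Rightarrow> ((nat \<Rightarrow> real) \<Rightarrow> real) \<Rightarrow> real \<Rightarrow> real).
       \<forall>d s \<sigma> P n. regression_framework d s \<sigma> P \<longrightarrow> d \<ge> 4 \<longrightarrow> n \<ge> 1 \<longrightarrow>
         (INF p\<in>{p. real p \<le> depth_bound n}. forest_risk d p n s P)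
           \<le> ennreal (C d s (\<sigma>\<^sup>2) * real n powr (- (2 * bprf_alpha d * ln 2 - \<delta>)))"
  proof (intro allI impI)
    fix \<delta> :: real assume \<delta>: "0 < \<delta>"
    define E where "E d = exp (5 * \<delta> / 4 + (2 * bprf_alpha d * sqrt 5 * ln 2)\<^sup>2 / (4 * \<delta>))" for d
    show "\<exists>(C :: nat \<Rightarrow> ((nat \<Rightarrow> real) \<Rightarrow> real) \<Rightarrow> real \<Rightarrow> real).
       \<forall>d s \<sigma> P n. regression_framework d s \<sigma> P \<longrightarrow> d \<ge> 4 \<longrightarrow> n \<ge> 1 \<longrightarrow>
         (INF p\<in>{p. real p \<le> depth_bound n}. forest_risk d p n s P)
           \<le> ennreal (C d s (\<sigma>\<^sup>2) * real n powr (- (2 * bprf_alpha d * ln 2 - \<delta>)))"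
    proof (rule exI[of _ "\<lambda>d s v. B d s v * E d"], intro allI impI)
      fix d n :: nat and s P and \<sigma> :: real
      assume F: "regression_framework d s \<sigma> P" and d: "4 \<le> d" and n: "1 \<le> n"
      have B0: "0 \<le> B d s (\<sigma>\<^sup>2)" unfolding B_def using A0 by simp
      have Bn0: "0 \<le> B d s (\<sigma>\<^sup>2) * real n powr (- 2 * bprf_alpha d * ln 2)" using B0 by simp
      have d1: "1 \<le> d" using d by simp
      have "B d s (\<sigma>\<^sup>2) * real n powr (- 2 * bprf_alpha d * ln 2)
          * 2 powr (2 * bprf_alpha d * sqrt 5 * sqrt (ln (real n) + 5 / 4))
        \<le> B d s (\<sigma>\<^sup>2) * real n powr (- 2 * bprf_alpha d * ln 2) * (E d * real n powr \<delta>)"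
        unfolding E_def by (rule mult_left_mono[OF forest_high_dim_rate[OF d1 n \<delta>] Bn0])
      also have "\<dots> = B d s (\<sigma>\<^sup>2) * E d * real n powr (- (2 * bprf_alpha d * ln 2 - \<delta>))"
      proof -
        have "real n powr (- (2 * bprf_alpha d * ln 2 - \<delta>)) = real n powr (- 2 * bprf_alpha d * ln 2) * real n powr \<delta>"
          by (simp flip: powr_add)
        then show ?thesis by (simp add: ac_simps)
      qed
      finally show "(INF p\<in>{p. real p \<le> depth_bound n}. forest_risk d p n s P)
           \<le> ennreal (B d s (\<sigma>\<^sup>2) * E d * real n powr (- (2 * bprf_alpha d * ln 2 - \<delta>)))"
        by (rule order_trans[OF high[OF F d n] ennreal_leI])
    qed
  qed

  define L where "L d s p0 c \<longleftrightarrow> 0 \<le> c \<and> (\<not> s constant_on cube d \<longrightarrow> 0 < c) \<and>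
    (\<forall>\<sigma> P n p. regression_framework d s \<sigma> P \<longrightarrow> n \<ge> 1 \<longrightarrow> p0 \<le> p \<longrightarrow> real p \<le> depth_bound n \<longrightarrow>
      ennreal (c * (\<sigma>\<^sup>2 / real n) powr (bprf_alpha d / (bprf_alpha d + 1))) \<le> tree_risk d p n s P \<and>
      ennreal (c * real n powr (- bprf_alpha d * ln 2)) \<le> tree_risk d p n s P)" for d s and p0 :: nat and c :: real
  have "\<exists>pc. L d s (fst pc) (snd pc)" for d s using tree_lower_rates[of s d] unfolding L_def by simp
  then have "\<forall>ds. \<exists>pc. L (fst ds) (snd ds) (fst pc) (snd pc)" by blast
  then obtain pc where pc: "\<And>ds. L (fst ds) (snd ds) (fst (pc ds)) (snd (pc ds))" by metis
  have L: "L d s (fst (pc (d, s))) (snd (pc (d, s)))" for d s using pc[of "(d, s)"] by simp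
  show "\<exists>(p0 :: nat \<Rightarrow> ((nat \<Rightarrow> real) \<Rightarrow> real) \<Rightarrow> nat) (N :: nat \<Rightarrow> real \<Rightarrow> nat)
       (c :: nat \<Rightarrow> ((nat \<Rightarrow> real) \<Rightarrow> real) \<Rightarrow> real).
       (\<forall>d s. c d s \<ge> 0 \<and> (\<not> s constant_on cube d \<longrightarrow> c d s > 0)) \<and>
       (\<forall>d s \<sigma> P n p. regression_framework d s \<sigma> P \<longrightarrow> n \<ge> N d (\<sigma>\<^sup>2) \<longrightarrow>
          p0 d s \<le> p \<longrightarrow> real p \<le> depth_bound n \<longrightarrow>
          (d \<le> 3 \<longrightarrow>
             ennreal (c d s * (\<sigma>\<^sup>2 / real n) powr (bprf_alpha d / (bprf_alpha d + 1)))
               \<le> tree_risk d p n s P) \<and>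
          (d \<ge> 4 \<longrightarrow>
             ennreal (c d s * real n powr (- bprf_alpha d * ln 2)) \<le> tree_risk d p n s P))"
    by (rule exI[of _ "\<lambda>d s. fst (pc (d, s))"], rule exI[of _ "\<lambda>_ _. 1"], rule exI[of _ "\<lambda>d s. snd (pc (d, s))"])
       (use L in \<open>unfold L_def, blast\<close>)
qed

end
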